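(* Let $p$ be an odd prime, let $K/\mathbb{Q}_p$ be a finite extension with ring of integers $\mathfrak{o}$, maximal ideal $\mathfrak{p}$ and uniformizer $\pi$, and let $n\in\mathfrak{o}$. Let $Q(\mathbf{x})=\sum_{1\leq i\leq r}(b_ix_i^2+c_ix_i)$ with $b_i\in\mathfrak{o}\setminus\{0\}$ and $c_i\in\mathfrak{o}$. For $1\leq i\leq r$ put $t_i\coloneqq\min(\mathrm{ord}_{\mathfrak{p}}(b_i),\mathrm{ord}_{\mathfrak{p}}(c_i))$ and $u_i\coloneqq\pi^{-\mathrm{ord}_{\mathfrak{p}}(b_i)}b_i\in\mathfrak{o}^{\times}$. Let $$D_{\mathfrak{p}}\coloneqq\{1\leq i\leq r: \mathrm{ord}_{\mathfrak{p}}(b_i)>\mathrm{ord}_{\mathfrak{p}}(c_i)\},\qquad N_{\mathfrak{p}}\coloneqq\{1\leq i\leq r: \mathrm{ord}_{\mathfrak{p}}(b_i)\leq\mathrm{ord}_{\mathfrak{p}}(c_i)\},$$ and $\mathfrak{t}_d\coloneqq\min\{t_i: i\in D_{\mathfrak{p}}\}$ (with $\mathfrak{t}_d=\infty$ if $D_{\mathfrak{p}}=\varnothing$). For $t\in\mathbb{Z}$ let $\mathcal{L}_{\mathfrak{p}}(t)\coloneqq\{i\in N_{\mathfrak{p}}: t_i-t<0 \text{ and } t_i-t \text{ is odd}\}$ and $\ell_{\mathfrak{p}}(t)\coloneqq|\mathcal{L}_{\mathfrak{p}}(t)|$. Put $$\mathfrak{n}\coloneqq n+\sum_{i\in N_{\mathfrak{p}}}\frac{c_i^2}{4b_i}.$$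 If $\mathfrak{n}\neq0$ write $\mathfrak{n}=\mathfrak{u}_n\pi^{\mathfrak{t}_n}$ with $\mathfrak{u}_n\in\mathfrak{o}^{\times}$, $\mathfrak{t}_n\in\mathbb{Z}$; otherwise set $\mathfrak{t}_n\coloneqq\infty$. Define $$\tau_{\mathfrak{p}}(t)\coloneqq t+\sum_{\substack{i\in N_{\mathfrak{p}}\\ t_i<t}}\frac{t_i-t}{2},\qquad \delta_{\mathfrak{p}}(t)\coloneqq\epsilon_{\pi}^{3\ell_{\mathfrak{p}}(t)}\prod_{i\in\mathcal{L}_{\mathfrak{p}}(t)}\left(\frac{u_i}{\mathfrak{p}}\right),$$ and $$\omega_{\mathfrak{p}}\coloneqq\begin{cases}0,&\text{if }\mathfrak{t}_n\geq\mathfrak{t}_d,\\ -\frac{1}{\mathrm{N}(\mathfrak{p})},&\text{if }\mathfrak{t}_n<\mathfrak{t}_d\text{ and }\ell_{\mathfrak{p}}(\mathfrak{t}_n+1)\text{ is even},\\ \epsilon_{\pi}\left(\frac{\mathfrak{u}_n}{\mathfrak{p}}\right)\mathrm{N}(\mathfrak{p})^{-1/2},&\text{if }\mathfrak{t}_n<\mathfrak{t}_d\text{ and }\ell_{\mathfrak{p}}(\mathfrak{t}_n+1)\text{ is odd}.\end{cases}$$ Then $$\beta_{\mathfrak{p}}(n;Q)=1+\left(1-\frac{1}{\mathrm{N}(\mathfrak{p})}\right)\sum_{\substack{1\leq t\leq\min(\mathfrak{t}_d,\mathfrak{t}_n)\\ \ell_{\mathfrak{p}}(t)\text{ even}}}\delta_{\mathfrak{p}}(t)\mathrm{N}(\mathfrak{p})^{\tau_{\mathfrak{p}}(t)}+\omega_{\mathfrak{p}}\delta_{\mathfrak{p}}(\mathfrak{t}_n+1)\mathrm{N}(\mathfrak{p})^{\tau_{\mathfrak{p}}(\mathfrak{t}_n+1)}$$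 (the last term being $0$ when $\omega_{\mathfrak{p}}=0$).
   Context: $\mathrm{N}(\mathfrak{p})=|\mathfrak{o}/\mathfrak{p}|$ and $\mathrm{ord}_{\mathfrak{p}}$ is the normalized valuation. Let $\mathfrak{p}^{\mathfrak{d}}$ be the different of $K/\mathbb{Q}_p$. For $\alpha\in\mathbb{Q}_p$ let $e_p(\alpha)\coloneqq e^{-2\pi i a}$ where $a\in\mathbb{Z}[1/p]$ with $\alpha-a\in\mathbb{Z}_p$; for $\alpha\in K$ put $e_{\pi}(\alpha)\coloneqq e_p(\mathrm{Tr}_{K/\mathbb{Q}_p}(\alpha/\pi^{\mathfrak{d}}))$. Let $\mathrm{d}x$ be the Haar measure on $K$ with $\int_{\mathfrak{o}}\mathrm{d}x=1$. The local density of a polynomial $Q$ in $r$ variables with coefficients in $\mathfrak{o}$ is $$\beta_{\mathfrak{p}}(n;Q)\coloneqq\int_K\int_{\mathfrak{o}^r}e_{\pi}\big(\sigma(Q(x_1,\dots,x_r)-n)\big)\,\mathrm{d}x_1\cdots\mathrm{d}x_r\,\mathrm{d}\sigma.$$ For $x\in\mathfrak{o}$, the symbol $\left(\frac{x}{\mathfrak{p}}\right)$ is $1$ if $x\in\mathfrak{o}^\times$ is a square modulo $\mathfrak{p}$, $-1$ if $x\in\mathfrak{o}^\times$ is not a square modulo $\mathfrak{p}$, and $0$ if $x\in\mathfrak{p}$. Let $G_{\pi}(1)\coloneqq\sum_{x\in\mathfrak{o}/\mathfrak{p}}e_{\pi}(x^2/\pi)$, and let $\epsilon_{\pi}\in\{\pm1,\pm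 i\}$ be the fourth root of unity with $G_{\pi}(1)=\epsilon_{\pi}^3\mathrm{N}(\mathfrak{p})^{1/2}$. *)

theory Defs
  imports "HOL-Analysis.Analysis" "HOL-Library.Extended" "HOL-Computational_Algebra.Primes"
begin

section \<open>Non-archimedean valued fields\<close>

text \<open>The absolute value is \<open>x \<mapsto> dist x 0\<close>, so that the library's topology, Borel sets and
  completeness apply to it.\<close>

class valued_field = field_char_0 + metric_space +
  assumes dist_add_right: "dist (x + z) (y + z) = dist x y"
    and dist_mult_zero: "dist (x * y) 0 = dist x 0 * dist y 0"
    and dist_ultrametric: "dist x z \<le> max (dist x y) (dist y z)"

definition vabs :: "'k::valued_field \<Rightarrow> real"
  where "vabs x = dist x 0"

definition int_ring :: "'k::valued_field set"
  where "int_ring = {x. vabs x \<le> 1}"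

definition max_ideal :: "'k::valued_field set"
  where "max_ideal = {x. vabs x < 1}"

definition uniformizer :: "'k::valued_field \<Rightarrow> bool"
  where "uniformizer \<pi> \<longleftrightarrow> max_ideal = (\<lambda>x. \<pi> * x) ` int_ring"

definition residue_field :: "'k::valued_field set set"
  where "residue_field = int_ring // {(x, y). x \<in> int_ring \<and> y \<in> int_ring \<and> x - y \<in> max_ideal}"

definition ideal_norm :: "'k::valued_field itself \<Rightarrow> nat"
  where "ideal_norm _ = card (residue_field :: 'k set set)"

text \<open>The normalized valuation, with values in the integers and \<open>Pinf\<close>.\<close>

definition ord :: "'k::valued_field \<Rightarrow> 'k \<Rightarrow> int extended"
  where "ord \<pi> x = (if x = 0 then Pinf else Fin (THE k. vabs x = vabs \<pi> powi k))"

primrec fin_part :: "int extended \<Rightarrow> int" where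
  "fin_part (Fin k) = k"
| "fin_part Pinf = 0"
| "fin_part Minf = 0"

definition residue_symbol :: "'k::valued_field \<Rightarrow> complex"
  where "residue_symbol x =
    (if x \<in> max_ideal then 0
     else if \<exists>y\<in>int_ring. x - y\<^sup>2 \<in> max_ideal then 1 else - 1)"


section \<open>The field of p-adic numbers and its finite extensions\<close>

definition rat_padic_abs :: "nat \<Rightarrow> rat \<Rightarrow> real"
  where "rat_padic_abs p a =
    (if a = 0 then 0
     else real p powi (int (multiplicity (int p) (snd (quotient_of a)))
                       - int (multiplicity (int p) (fst (quotient_of a)))))"

text \<open>A completion of the rationals with respect to the p-adic absolute value; completeness is
  the sort constraint.\<close>

definition padic_field :: "nat \<Rightarrow> 'q::{valued_field, complete_space} itself \<Rightarrow> bool"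
  where "padic_field p _ \<longleftrightarrow>
    (\<forall>a. vabs (of_rat a :: 'q) = rat_padic_abs p a) \<and> closure (\<rat> :: 'q set) = UNIV"

definition ext_scale :: "('q \<Rightarrow> 'k) \<Rightarrow> 'q \<Rightarrow> 'k \<Rightarrow> 'k::valued_field"
  where "ext_scale \<iota> c x = \<iota> c * x"

definition ext_basis :: "('q::valued_field \<Rightarrow> 'k::valued_field) \<Rightarrow> 'k set \<Rightarrow> bool"
  where "ext_basis \<iota> B \<longleftrightarrow>
    finite B \<and> \<not> module.dependent (ext_scale \<iota>) B \<and> module.span (ext_scale \<iota>) B = UNIV"

text \<open>The absolute value of the extension field is the (unique) one extending the p-adic absolute
  value.\<close>

definition padic_finite_extension ::
    "nat \<Rightarrow> ('q::{valued_field, complete_space} \<Rightarrow> 'k::valued_field) \<Rightarrow> bool"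
  where "padic_finite_extension p \<iota> \<longleftrightarrow>
    padic_field p TYPE('q) \<and>
    (\<forall>x y. \<iota> (x + y) = \<iota> x + \<iota> y) \<and> (\<forall>x y. \<iota> (x * y) = \<iota> x * \<iota> y) \<and> \<iota> 1 = 1 \<and>
    (\<forall>x. vabs (\<iota> x) = vabs x) \<and>
    (\<exists>B. ext_basis \<iota> B)"

text \<open>The trace of multiplication by \<open>\<alpha>\<close>, computed in some basis.\<close>

definition field_trace :: "('q::valued_field \<Rightarrow> 'k::valued_field) \<Rightarrow> 'k \<Rightarrow> 'q"
  where "field_trace \<iota> \<alpha> =
    (let B = (SOME B. ext_basis \<iota> B)
     in \<Sum>b\<in>B. module.representation (ext_scale \<iota>) B (\<alpha> * b) b)"

definition codifferent :: "('q::valued_field \<Rightarrow> 'k::valued_field) \<Rightarrow> 'k set"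
  where "codifferent \<iota> = {x. \<forall>y\<in>int_ring. field_trace \<iota> (x * y) \<in> int_ring}"

definition different :: "('q::valued_field \<Rightarrow> 'k::valued_field) \<Rightarrow> 'k set"
  where "different \<iota> = {y. \<forall>x\<in>codifferent \<iota>. y * x \<in> int_ring}"


section \<open>Additive characters and the quadratic Gauss sum\<close>

definition padic_char :: "nat \<Rightarrow> 'q::valued_field \<Rightarrow> complex"
  where "padic_char p \<alpha> =
    exp (- (2 * of_real pi * \<i> *
      of_rat (SOME a. (\<exists>(m::int) (k::nat). a = of_int m / of_nat p ^ k) \<and>
                      \<alpha> - of_rat a \<in> int_ring)))"

definition add_char ::
    "nat \<Rightarrow> ('q::valued_field \<Rightarrow> 'k::valued_field) \<Rightarrow> 'k \<Rightarrow> nat \<Rightarrow> 'k \<Rightarrow> complex"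
  where "add_char p \<iota> \<pi> d \<alpha> = padic_char p (field_trace \<iota> (\<alpha> / \<pi> ^ d))"

definition gauss_sum ::
    "nat \<Rightarrow> ('q::valued_field \<Rightarrow> 'k::valued_field) \<Rightarrow> 'k \<Rightarrow> nat \<Rightarrow> complex"
  where "gauss_sum p \<iota> \<pi> d =
    (\<Sum>C\<in>residue_field. add_char p \<iota> \<pi> d ((SOME x. x \<in> C)\<^sup>2 / \<pi>))"

definition gauss_eps ::
    "nat \<Rightarrow> ('q::valued_field \<Rightarrow> 'k::valued_field) \<Rightarrow> 'k \<Rightarrow> nat \<Rightarrow> complex"
  where "gauss_eps p \<iota> \<pi> d =
    (THE e. e \<in> {1, - 1, \<i>, - \<i>} \<and>
            gauss_sum p \<iota> \<pi> d = e ^ 3 * of_real (sqrt (real (ideal_norm TYPE('k)))))"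


section \<open>Haar measure and local densities\<close>

definition normalized_haar :: "'k::valued_field measure \<Rightarrow> bool"
  where "normalized_haar \<mu> \<longleftrightarrow>
    sets \<mu> = sets borel \<and>
    (\<forall>a. \<forall>A\<in>sets borel. emeasure \<mu> ((\<lambda>x. a + x) ` A) = emeasure \<mu> A) \<and>
    (\<forall>C. compact C \<longrightarrow> emeasure \<mu> C < top) \<and>
    emeasure \<mu> int_ring = 1"

definition density_integrand ::
    "nat \<Rightarrow> ('q::valued_field \<Rightarrow> 'k::valued_field) \<Rightarrow> 'k \<Rightarrow> nat \<Rightarrow> 'k measure \<Rightarrow>
     nat \<Rightarrow> ((nat \<Rightarrow> 'k) \<Rightarrow> 'k) \<Rightarrow> 'k \<Rightarrow> 'k \<Rightarrow> complex"
  where "density_integrand p \<iota> \<pi> d \<mu> r Q n \<sigma> =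
    (LINT x:({1..r} \<rightarrow>\<^sub>E int_ring)|(Pi\<^sub>M {1..r} (\<lambda>_. \<mu>)). add_char p \<iota> \<pi> d (\<sigma> * (Q x - n)))"

text \<open>The outer integral over the field is improper, exhausting the field by the fractional ideals
  generated by \<open>\<pi> powi (- k)\<close>: for quadratic polynomials in at most two variables the integrand need not be absolutely
  integrable. Whenever it is, this is the Lebesgue integral over the field, see below.\<close>

definition density_partial ::
    "nat \<Rightarrow> ('q::valued_field \<Rightarrow> 'k::valued_field) \<Rightarrow> 'k \<Rightarrow> nat \<Rightarrow> 'k measure \<Rightarrow>
     nat \<Rightarrow> ((nat \<Rightarrow> 'k) \<Rightarrow> 'k) \<Rightarrow> 'k \<Rightarrow> nat \<Rightarrow> complex"
  where "density_partial p \<iota> \<pi> d \<mu> r Q n k =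
    (LINT \<sigma>:{\<sigma>. \<pi> ^ k * \<sigma> \<in> int_ring}|\<mu>. density_integrand p \<iota> \<pi> d \<mu> r Q n \<sigma>)"

definition local_density ::
    "nat \<Rightarrow> ('q::valued_field \<Rightarrow> 'k::valued_field) \<Rightarrow> 'k \<Rightarrow> nat \<Rightarrow> 'k measure \<Rightarrow>
     nat \<Rightarrow> ((nat \<Rightarrow> 'k) \<Rightarrow> 'k) \<Rightarrow> 'k \<Rightarrow> complex"
  where "local_density p \<iota> \<pi> d \<mu> r Q n = lim (density_partial p \<iota> \<pi> d \<mu> r Q n)"

lemma vabs_mult: "vabs (x * y) = vabs x * vabs y"
  by (simp add: vabs_def dist_mult_zero)

lemma vabs_one: "vabs (1::'k::valued_field) = 1"
proof -
  have "vabs (1::'k) * vabs (1::'k) = vabs (1::'k)"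
    using vabs_mult[of "1::'k" 1] by (simp only: mult_1)
  moreover have "vabs (1::'k) \<noteq> 0" by (simp add: vabs_def)
  ultimately show ?thesis by simp
qed

lemma vabs_power: "vabs (x ^ k) = vabs x ^ k"
  by (induction k) (simp_all add: vabs_mult vabs_one)

lemma uniformizer_vabs_less_1:
  fixes \<pi> :: "'k::valued_field"
  assumes "uniformizer \<pi>"
  shows "vabs \<pi> < 1"
proof -
  have "\<pi> * 1 \<in> max_ideal"
    unfolding assms[unfolded uniformizer_def] by (rule imageI) (simp add: int_ring_def vabs_one)
  then show ?thesis by (simp add: max_ideal_def)
qed

lemma density_partial_tendsto_integral:
  fixes \<pi> :: "'k::valued_field"
  assumes \<pi>: "uniformizer \<pi>" and \<mu>: "normalized_haar \<mu>"
    and int: "integrable \<mu> (density_integrand p \<iota> \<pi> d \<mu> r Q n)"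
  shows "density_partial p \<iota> \<pi> d \<mu> r Q n
           \<longlonglongrightarrow> (LINT \<sigma>|\<mu>. density_integrand p \<iota> \<pi> d \<mu> r Q n \<sigma>)"
proof -
  let ?F = "density_integrand p \<iota> \<pi> d \<mu> r Q n"
  let ?A = "\<lambda>k. {\<sigma>. \<pi> ^ k * \<sigma> \<in> int_ring}"
  have sets: "sets \<mu> = sets borel" using \<mu> by (simp add: normalized_haar_def)
  have A: "?A k \<in> sets \<mu>" for k
  proof -
    have "closed {\<sigma>::'k. vabs \<pi> ^ k * dist \<sigma> 0 \<le> 1}"
      by (intro closed_Collect_le continuous_intros)
    moreover have "?A k = {\<sigma>. vabs \<pi> ^ k * dist \<sigma> 0 \<le> 1}"
      by (simp add: int_ring_def vabs_mult vabs_power) (simp add: vabs_def)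
    ultimately show ?thesis using sets by simp
  qed
  have F: "?F \<in> borel_measurable \<mu>" using int by (rule borel_measurable_integrable)
  have lim: "(\<lambda>k. indicat_real (?A k) \<sigma> *\<^sub>R ?F \<sigma>) \<longlonglongrightarrow> ?F \<sigma>" for \<sigma>
  proof -
    have "(\<lambda>k. vabs \<pi> ^ k * vabs \<sigma>) \<longlonglongrightarrow> 0 * vabs \<sigma>"
      by (intro tendsto_mult LIMSEQ_power_zero tendsto_const)
        (use uniformizer_vabs_less_1[OF \<pi>] in \<open>simp add: vabs_def\<close>)
    then have "eventually (\<lambda>k. vabs \<pi> ^ k * vabs \<sigma> < 1) sequentially"
      by (intro order_tendstoD(2)) auto
    then have "eventually (\<lambda>k. ?F \<sigma> = indicat_real (?A k) \<sigma> *\<^sub>R ?F \<sigma>) sequentially"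
      by eventually_elim (simp add: int_ring_def vabs_mult vabs_power)
    then show ?thesis by (rule Lim_transform_eventually[OF tendsto_const])
  qed
  have "(\<lambda>k. LINT \<sigma>|\<mu>. indicat_real (?A k) \<sigma> *\<^sub>R ?F \<sigma>) \<longlonglongrightarrow> (LINT \<sigma>|\<mu>. ?F \<sigma>)"
  proof (rule integral_dominated_convergence[where w = "\<lambda>\<sigma>. norm (?F \<sigma>)"])
    show "(\<lambda>\<sigma>. indicat_real (?A k) \<sigma> *\<^sub>R ?F \<sigma>) \<in> borel_measurable \<mu>" for k
      using A F by (intro borel_measurable_scaleR borel_measurable_indicator)
    show "integrable \<mu> (\<lambda>\<sigma>. norm (?F \<sigma>))" using int by (rule integrable_norm)
    show "AE \<sigma> in \<mu>. (\<lambda>k. indicat_real (?A k) \<sigma> *\<^sub>R ?F \<sigma>) \<longlonglongrightarrow> ?F \<sigma>"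
      by (rule AE_I2) (rule lim)
    show "AE \<sigma> in \<mu>. norm (indicat_real (?A k) \<sigma> *\<^sub>R ?F \<sigma>) \<le> norm (?F \<sigma>)" for k
      by (rule AE_I2) (simp add: indicator_def)
  qed (rule F)
  moreover have "density_partial p \<iota> \<pi> d \<mu> r Q n =
      (\<lambda>k. LINT \<sigma>|\<mu>. indicat_real (?A k) \<sigma> *\<^sub>R ?F \<sigma>)"
    by (rule ext) (simp add: density_partial_def set_lebesgue_integral_def)
  ultimately show ?thesis by simp
qed

lemma local_density_eq_integral:
  assumes "uniformizer \<pi>" and "normalized_haar \<mu>"
    and "integrable \<mu> (density_integrand p \<iota> \<pi> d \<mu> r Q n)"
  shows "local_density p \<iota> \<pi> d \<mu> r Q n = (LINT \<sigma>|\<mu>. density_integrand p \<iota> \<pi> d \<mu> r Q n \<sigma>)"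
  unfolding local_density_def by (rule limI) (rule density_partial_tendsto_integral[OF assms])

end

theory Submission
  imports Defs
begin

text \<open>
  Write \<open>\<psi>\<close> for the additive character. It is trivial on the ring of integers but not on
  \<open>\<pi>\<^sup>-\<^sup>1\<close> times it, because the codifferent is generated by the inverse of \<open>\<pi> ^ d\<close>. The inner
  integral factors into one-dimensional integrals of \<open>\<psi> (\<sigma> (b x\<^sup>2 + c x))\<close>. If the linear
  coefficient dominates, a shift of \<open>x\<close> multiplies the integrand by a nontrivial constant as soon as
  \<open>\<sigma> c\<close> is not integral, so the integral is \<open>0\<close> or \<open>1\<close>. Otherwise one completes the square and
  reduces, two powers of \<open>\<pi>\<close> at a time, to the quadratic Gauss sum over the residue field. On the
  shell of all \<open>\<sigma>\<close> of valuation \<open>- t\<close> the product is therefore a constant times a power of the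
  quadratic residue symbol of \<open>\<sigma> \<pi> ^ t\<close> times \<open>\<psi> (- \<sigma> nn)\<close>, whose integral over the units is
  elementary: it vanishes once \<open>t\<close> exceeds the valuation of \<open>nn\<close> by more than one.
\<close>


section \<open>Non-archimedean absolute values\<close>

text \<open>The factor \<open>1 - 1 / Np\<close> is the mass of the units, collected on shells where
  the character of \<open>nn\<close> is trivial and the residue symbol enters to an even power. The
  term with \<open>\<omega>\<close> comes from the single shell \<open>t = tn + 1\<close>, where
  that character factors through the residue field: a full character sum without its term at zero in
  the even case, a Gauss sum in the odd case. If \<open>nn = 0\<close> and no linear coefficient
  dominates, nothing cuts the sum off and it may diverge; the proof therefore identifies partial
  integrals with partial sums, up to a term that is eventually constant, which settles convergence
  and value together. Finiteness of the residue field is not taken from compactness but extracted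
  from the Haar measure, which gives the ring of integers finite mass. For this the residue classes
  have to be countable; that follows from separability, supplied by the rational combinations of a
  basis. Separability also makes the balls generate the Borel sets, so that the scaling law of the
  measure need only be checked on balls.\<close>

lemma vabs_nonneg [simp]: "0 \<le> vabs x"
  by (simp add: vabs_def)

lemma vabs_eq_0_iff [simp]: "vabs x = 0 \<longleftrightarrow> x = 0"
  by (simp add: vabs_def)

lemma vabs_zero [simp]: "vabs 0 = 0"
  by simp

lemma vabs_pos_iff [simp]: "0 < vabs x \<longleftrightarrow> x \<noteq> 0"
  by (simp add: vabs_def)

lemma vabs_1 [simp]: "vabs 1 = 1"
  by (rule vabs_one)

lemma dist_eq_vabs: "dist x y = vabs (x - y)"
  using dist_add_right[of "x - y" y 0] by (simp add: vabs_def)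

lemma vabs_minus [simp]: "vabs (- x) = vabs x"
  using dist_eq_vabs[of 0 x] by (simp add: vabs_def dist_commute)

lemma vabs_minus_commute: "vabs (x - y) = vabs (y - x)"
  using vabs_minus[of "x - y"] by simp

lemma vabs_add_le_max: "vabs (x + y) \<le> max (vabs x) (vabs y)"
proof -
  have "dist (x + y) 0 \<le> max (dist (x + y) y) (dist y 0)"
    by (rule dist_ultrametric)
  then show ?thesis by (simp add: dist_eq_vabs)
qed

lemma vabs_add_le: "vabs x \<le> e \<Longrightarrow> vabs y \<le> e \<Longrightarrow> vabs (x + y) \<le> e"
  using vabs_add_le_max[of x y] by simp

lemma vabs_add_less: "vabs x < e \<Longrightarrow> vabs y < e \<Longrightarrow> vabs (x + y) < e"
  using vabs_add_le_max[of x y] by simp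

lemma vabs_diff_le: "vabs x \<le> e \<Longrightarrow> vabs y \<le> e \<Longrightarrow> vabs (x - y) \<le> e"
  using vabs_add_le[of x e "- y"] by simp

lemma vabs_diff_less: "vabs x < e \<Longrightarrow> vabs y < e \<Longrightarrow> vabs (x - y) < e"
  using vabs_add_less[of x e "- y"] by simp

lemma vabs_sum_le:
  assumes "\<And>i. i \<in> I \<Longrightarrow> vabs (f i) \<le> e" and "0 \<le> e"
  shows "vabs (\<Sum>i\<in>I. f i) \<le> e"
  using assms by (induction I rule: infinite_finite_induct) (auto intro: vabs_add_le)

lemma vabs_inverse: "vabs (inverse x) = inverse (vabs x)"
proof (cases "x = 0")
  case False
  then have "vabs x * vabs (inverse x) = 1"
    by (simp flip: vabs_mult)
  then show ?thesis
    using False by (simp add: field_simps)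
qed simp

lemma vabs_divide: "vabs (x / y) = vabs x / vabs y"
  by (simp add: divide_inverse vabs_mult vabs_inverse)

lemma vabs_powi: "vabs (x powi k) = vabs x powi k"
  by (auto simp: power_int_def vabs_power vabs_inverse)

lemma vabs_of_int_le_1: "vabs (of_int m) \<le> 1"
proof -
  have nat: "vabs (of_nat k :: 'a::valued_field) \<le> 1" for k
    by (induction k) (auto intro: vabs_add_le)
  show ?thesis
    by (cases m) (simp_all add: nat vabs_minus del: of_nat_Suc)
qed

lemma int_ring_iff: "x \<in> int_ring \<longleftrightarrow> vabs x \<le> 1"
  by (simp add: int_ring_def)

lemma max_ideal_iff: "x \<in> max_ideal \<longleftrightarrow> vabs x < 1"
  by (simp add: max_ideal_def)

section \<open>The standard character of the field of p-adic numbers\<close>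

lemma padic_vabs_of_int:
  assumes "padic_field p TYPE('q::{valued_field, complete_space})" and "m \<noteq> 0"
  shows "vabs (of_int m :: 'q) = real p powi (- int (multiplicity (int p) m))"
proof -
  have "vabs (of_rat (of_int m) :: 'q) = rat_padic_abs p (of_int m)"
    using assms by (simp only: padic_field_def)
  also have "\<dots> = real p powi (- int (multiplicity (int p) m))"
    using assms(2) quotient_of_int[of m] by (simp add: rat_padic_abs_def Rat.of_int_def)
  finally show ?thesis by simp
qed

text \<open>The property under the choice operator of \<open>padic_char\<close>. Naming it allows
  existence and uniqueness modulo the integers to be settled before the choice is unfolded.\<close>

definition padic_part :: "nat \<Rightarrow> 'q::valued_field \<Rightarrow> rat \<Rightarrow> bool"
  where "padic_part p \<alpha> a \<longleftrightarrow>
    (\<exists>(m::int) (k::nat). a = of_int m / of_nat p ^ k) \<and> \<alpha> - of_rat a \<in> int_ring"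

lemma complex_of_rat: "(of_rat a :: complex) = of_real (of_rat a)"
proof -
  obtain s t where "quotient_of a = (s, t)" by fastforce
  then have "a = of_int s / of_int t" by (rule quotient_of_div)
  then show ?thesis by (simp add: of_rat_divide)
qed

context
  fixes p :: nat
  assumes p: "prime p" and padic: "padic_field p TYPE('q::{valued_field, complete_space})"
begin

lemma padic_vabs_prime: "vabs (of_nat p :: 'q) = 1 / real p"
proof -
  have "multiplicity (int p) (int p) = 1"
    using p by (simp add: multiplicity_self prime_gt_0_nat)
  then show ?thesis
    using padic_vabs_of_int[OF padic, of "int p"] prime_gt_0_nat[OF p]
    by (simp add: power_int_minus field_simps)
qed

lemma padic_vabs_of_int_coprime:
  assumes "coprime (int p) m"
  shows "vabs (of_int m :: 'q) = 1"
proof -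
  have "\<not> int p dvd m"
    using assms p by (metis coprime_common_divisor dvd_refl not_prime_unit prime_nat_int_transfer)
  moreover from this have "m \<noteq> 0" by auto
  ultimately show ?thesis
    using padic_vabs_of_int[OF padic, of m] by (simp add: not_dvd_imp_multiplicity_0)
qed

text \<open>Density of the rationals gives a rational \<open>a\<close> with
  \<open>\<alpha> - a\<close> integral. Its denominator is \<open>p ^ k * t'\<close> with
  \<open>t'\<close> prime to \<open>p\<close>; partial fractions split off a summand with
  denominator \<open>t'\<close>, which is p-integral and can be discarded.\<close>

lemma padic_part_ex: "\<exists>a. padic_part p (\<alpha> :: 'q) a"
proof -
  have "\<alpha> \<in> closure \<rat>"
    using padic by (simp add: padic_field_def)
  then obtain x where "x \<in> \<rat>" "dist x \<alpha> < 1"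
    unfolding closure_approachable using zero_less_one by blast
  then obtain a where a: "vabs (\<alpha> - of_rat a) < 1"
    by (metis Rats_cases dist_eq_vabs vabs_minus_commute)
  obtain s t where "quotient_of a = (s, t)" by fastforce
  then have st: "a = of_int s / of_int t" "t > 0"
    by (auto dest: quotient_of_div quotient_of_denom_pos)
  have "\<not> is_unit (int p)" using p by (simp add: prime_nat_iff)
  then obtain t' where t': "t = int p ^ multiplicity (int p) t * t'" "\<not> int p dvd t'"
    using multiplicity_decompose'[of t "int p"] st(2) by auto
  define k where "k = multiplicity (int p) t"
  have cop: "coprime (int p) t'"
    using t'(2) p by (simp add: prime_imp_coprime)
  then have "coprime t' (int p ^ k)" by (simp add: coprime_commute)
  then obtain x y where xy: "x * t' + y * int p ^ k = 1"
    by (metis bezout_int coprime_iff_gcd_eq_1)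
  have t0: "t' \<noteq> 0" using t' st(2) by auto
  have p0: "(of_nat p :: rat) \<noteq> 0" using prime_gt_0_nat[OF p] by simp
  have rat1: "of_int x * of_int t' + of_int y * of_nat p ^ k = (1 :: rat)"
    using arg_cong[OF xy, of "of_int :: int \<Rightarrow> rat"] by simp
  have t_rat: "(of_int t :: rat) = of_nat p ^ k * of_int t'"
    using arg_cong[OF t'(1), of "of_int :: int \<Rightarrow> rat"] by (simp add: k_def)
  have "a = of_int s * (of_int x * of_int t' + of_int y * of_nat p ^ k) / (of_nat p ^ k * of_int t')"
    unfolding rat1 st(1) t_rat by simp
  also have "\<dots> = of_int (s * x) / of_nat p ^ k + of_int (s * y) / of_int t'"
    using p0 t0 by (simp add: field_simps)
  finally have decomp: "a = of_int (s * x) / of_nat p ^ k + of_int (s * y) / of_int t'" .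
  have "vabs (of_rat (of_int (s * y) / of_int t') :: 'q) \<le> 1"
    using padic_vabs_of_int_coprime[OF cop] vabs_of_int_le_1[of "s * y", where ?'a = 'q]
    by (simp add: of_rat_divide of_rat_mult vabs_divide)
  then have "vabs ((\<alpha> - of_rat a) + of_rat (of_int (s * y) / of_int t')) \<le> 1"
    using a by (intro vabs_add_le) auto
  moreover have "(\<alpha> - of_rat a) + of_rat (of_int (s * y) / of_int t') =
      \<alpha> - of_rat (of_int (s * x) / of_nat p ^ k)"
    by (subst decomp) (simp add: of_rat_add del: of_int_mult)
  ultimately have "padic_part p \<alpha> (of_int (s * x) / of_nat p ^ k)"
    unfolding padic_part_def int_ring_iff by metis
  then show ?thesis ..
qed

text \<open>Integrality of \<open>a\<close> means that the power of \<open>p\<close> dividing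
  \<open>m\<close> is at least \<open>k\<close>, so the denominator cancels.\<close>

lemma padic_part_integral:
  assumes a: "a = of_int m / of_nat p ^ k" and le: "vabs (of_rat a :: 'q) \<le> 1"
  shows "a \<in> \<int>"
proof (cases "m = 0")
  case False
  have p0: "0 < real p" "1 < real p" using prime_gt_1_nat[OF p] by auto
  have "vabs (of_rat a :: 'q) = vabs (of_int m :: 'q) * real p ^ k"
    by (simp add: a of_rat_divide of_rat_power vabs_divide vabs_power padic_vabs_prime field_simps)
  then have "real p powi (int k - int (multiplicity (int p) m)) \<le> 1"
    using le p0 unfolding padic_vabs_of_int[OF padic False]
    by (simp add: power_int_diff power_int_minus divide_inverse mult.commute)
  then have "k \<le> multiplicity (int p) m"
    using one_less_power_int[OF p0(2), of "int k - int (multiplicity (int p) m)"] by linarith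
  then have "int p ^ k dvd m"
    by (simp add: multiplicity_dvd')
  then obtain m' where "m = int p ^ k * m'" ..
  then have "a = of_int m'"
    using p0 by (simp add: a)
  then show ?thesis by simp
qed (simp add: a)

lemma exp_2pi_rat_eq_1_iff: "exp (- (2 * of_real pi * \<i> * of_rat a)) = 1 \<longleftrightarrow> a \<in> \<int>"
proof -
  have "exp (- (2 * of_real pi * \<i> * of_rat a)) = (1::complex) \<longleftrightarrow>
      (\<exists>n::int. - (2 * pi * of_rat a) = real_of_int (2 * n) * pi)"
    unfolding exp_eq_1 complex_of_rat by simp
  also have "\<dots> \<longleftrightarrow> (\<exists>n::int. real_of_rat a = real_of_rat (of_int (- n)))"
  proof (intro ex_cong1)
    fix n :: int
    have "- (2 * pi * of_rat a) = real_of_int (2 * n) * pi \<longleftrightarrow> 2 * pi * (- of_rat a) = 2 * pi * real_of_int n"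
      by (simp add: algebra_simps)
    also have "\<dots> \<longleftrightarrow> - real_of_rat a = real_of_int n"
      by (simp only: mult_cancel_left) simp
    also have "\<dots> \<longleftrightarrow> real_of_rat a = real_of_rat (of_int (- n))"
      unfolding of_rat_of_int_eq of_int_minus[of n] of_rat_minus by linarith
    finally show "- (2 * pi * of_rat a) = real_of_int (2 * n) * pi \<longleftrightarrow>
        real_of_rat a = real_of_rat (of_int (- n))" .
  qed
  also have "\<dots> \<longleftrightarrow> (\<exists>n::int. a = of_int (- n))"
    by (simp only: of_rat_eq_iff)
  also have "\<dots> \<longleftrightarrow> a \<in> \<int>"
    by (metis Ints_cases Ints_of_int minus_minus)
  finally show ?thesis .
qed

lemma exp_2pi_rat_cong:
  assumes "a - b \<in> \<int>"
  shows "exp (- (2 * of_real pi * \<i> * of_rat a)) = exp (- (2 * of_real pi * \<i> * of_rat b))"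
proof -
  have "exp (- (2 * of_real pi * \<i> * of_rat a)) =
      exp (- (2 * of_real pi * \<i> * of_rat (a - b))) * exp (- (2 * of_real pi * \<i> * of_rat b))"
    by (simp add: of_rat_diff algebra_simps flip: exp_add)
  then show ?thesis using assms exp_2pi_rat_eq_1_iff by simp
qed

lemma padic_part_unique:
  assumes "padic_part p (\<alpha> :: 'q) a" and "padic_part p \<beta> b" and "\<alpha> - \<beta> \<in> int_ring"
  shows "a - b \<in> \<int>"
proof -
  obtain m k m' k' where ab: "a = of_int m / of_nat p ^ k" "b = of_int m' / of_nat p ^ k'"
    using assms by (auto simp: padic_part_def)
  have p0: "(of_nat p :: rat) \<noteq> 0" using prime_gt_0_nat[OF p] by simp
  have "a - b = of_int (m * int p ^ k' - m' * int p ^ k) / of_nat p ^ (k + k')"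
    using p0 by (simp add: ab field_simps power_add)
  moreover have "vabs (of_rat (a - b) :: 'q) \<le> 1"
  proof -
    have "(of_rat (a - b) :: 'q) = (\<alpha> - \<beta>) + ((\<beta> - of_rat b) - (\<alpha> - of_rat a))"
      by (simp add: of_rat_diff)
    moreover have "vabs ((\<alpha> - \<beta>) + ((\<beta> - of_rat b) - (\<alpha> - of_rat a))) \<le> 1"
      using assms by (intro vabs_add_le vabs_diff_le[of "\<beta> - of_rat b"]) (simp_all add: padic_part_def int_ring_iff)
    ultimately show ?thesis by simp
  qed
  ultimately show ?thesis by (rule padic_part_integral)
qed

text \<open>Frees the character from the choice in its definition: two fractional parts of the same
  element differ by an integer.\<close>

lemma padic_char_eq:
  assumes "padic_part p (\<alpha> :: 'q) a"
  shows "padic_char p \<alpha> = exp (- (2 * of_real pi * \<i> * of_rat a))"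
proof -
  have "padic_part p \<alpha> (SOME a. padic_part p \<alpha> a)"
    using assms by (rule someI)
  then have "(SOME a. padic_part p \<alpha> a) - a \<in> \<int>"
    using assms by (rule padic_part_unique) (simp add: int_ring_iff)
  then show ?thesis
    unfolding padic_char_def padic_part_def by (rule exp_2pi_rat_cong)
qed

lemma padic_char_add: "padic_char p (\<alpha> + \<beta> :: 'q) = padic_char p \<alpha> * padic_char p \<beta>"
proof -
  obtain a b where ab: "padic_part p \<alpha> a" "padic_part p \<beta> b"
    using padic_part_ex by metis
  then obtain m k m' k' where eq: "a = of_int m / of_nat p ^ k" "b = of_int m' / of_nat p ^ k'"
    by (auto simp: padic_part_def)
  have p0: "(of_nat p :: rat) \<noteq> 0" using prime_gt_0_nat[OF p] by simp
  have "a + b = of_int (m * int p ^ k' + m' * int p ^ k) / of_nat p ^ (k + k')"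
    using p0 by (simp add: eq field_simps power_add)
  moreover have "\<alpha> + \<beta> - of_rat (a + b) = (\<alpha> - of_rat a) + (\<beta> - of_rat b)"
    by (simp add: of_rat_add)
  then have "\<alpha> + \<beta> - of_rat (a + b) \<in> int_ring"
    using ab unfolding padic_part_def int_ring_iff by (metis vabs_add_le)
  ultimately have "padic_part p (\<alpha> + \<beta>) (a + b)"
    unfolding padic_part_def by blast
  then show ?thesis
    using ab by (simp add: padic_char_eq of_rat_add algebra_simps flip: exp_add)
qed

lemma norm_padic_char: "norm (padic_char p (\<alpha> :: 'q)) = 1"
proof -
  obtain a where "padic_part p \<alpha> a"
    using padic_part_ex by metis
  then show ?thesis
    by (simp add: padic_char_eq complex_of_rat)
qed

text \<open>The two directions have different uses: one makes the character of the extension trivial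
  on its ring of integers, the other turns a nonintegral trace into a value different from
  1.\<close>

lemma padic_char_eq_1_iff: "padic_char p (\<alpha> :: 'q) = 1 \<longleftrightarrow> \<alpha> \<in> int_ring"
proof
  assume 1: "padic_char p \<alpha> = 1"
  obtain a where a: "padic_part p \<alpha> a"
    using padic_part_ex by metis
  with 1 have "a \<in> \<int>"
    by (simp add: padic_char_eq exp_2pi_rat_eq_1_iff)
  then obtain m where m: "a = of_int m" by (rule Ints_cases)
  have "vabs ((\<alpha> - of_rat a) + of_int m) \<le> 1"
    using a by (intro vabs_add_le vabs_of_int_le_1) (simp add: padic_part_def int_ring_iff)
  then show "\<alpha> \<in> int_ring" by (simp add: m int_ring_iff)
next
  assume "\<alpha> \<in> int_ring"
  then have "padic_part p \<alpha> 0"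
    unfolding padic_part_def
    by (auto intro!: exI[of _ "0::int"])
  then show "padic_char p \<alpha> = 1"
    by (simp add: padic_char_eq)
qed

end


section \<open>Haar measure on a discretely valued field\<close>

text \<open>Isolates the part of the argument that is independent of the base field and of the
  trace. A zero uniformizer would mean the trivial absolute value. Until \<open>finite_R\<close> is
  proved, \<open>q\<close> could be 0, the cardinality assigned to an infinite residue
  field.\<close>

locale haar_field =
  fixes \<pi> :: "'k::valued_field" and \<mu> :: "'k measure" and q :: real
  assumes unif: "uniformizer \<pi>" and unif_nonzero [simp]: "\<pi> \<noteq> 0"
    and separable: "\<exists>C :: 'k set. countable C \<and> closure C = UNIV"
    and haar: "normalized_haar \<mu>"
    and q_def: "q = real (ideal_norm TYPE('k))"
begin

abbreviation w :: real
  where "w \<equiv> vabs \<pi>"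

lemma w_pos: "0 < w" and w_less_1: "w < 1"
  using uniformizer_vabs_less_1[OF unif] by auto

lemma vabs_le_w:
  fixes x :: 'k
  assumes "vabs x < 1"
  shows "vabs x \<le> w"
proof -
  have "x \<in> (\<lambda>x. \<pi> * x) ` int_ring"
    using assms unif unfolding uniformizer_def by (metis max_ideal_iff)
  then obtain y where "x = \<pi> * y" "vabs y \<le> 1"
    by (auto simp: int_ring_iff)
  then show ?thesis
    using w_pos by (simp add: vabs_mult mult_left_le)
qed

lemma w_powi_less_iff: "w powi a < w powi b \<longleftrightarrow> b < a"
  by (metis linorder_less_linear order_less_asym order_less_irrefl power_int_strict_decreasing w_less_1 w_pos)

lemma w_powi_le_iff: "w powi a \<le> w powi b \<longleftrightarrow> b \<le> a"
  using w_powi_less_iff[of b a] by linarith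

lemma w_powi_eq_iff: "w powi a = w powi b \<longleftrightarrow> a = b"
  by (metis linorder_neqE order_less_irrefl w_powi_less_iff)

lemma w_powi_pos [simp]: "0 < w powi a" and w_powi_nonneg [simp]: "0 \<le> w powi a"
  using w_pos by auto

text \<open>The value group is generated by \<open>w\<close>: after division by the right power of
  \<open>\<pi>\<close> the absolute value lies in the interval \<open>(w, 1]\<close>, and
  \<open>vabs_le_w\<close> leaves only 1.\<close>

lemma vabs_eq_powi:
  fixes x :: 'k
  assumes "x \<noteq> 0"
  obtains k where "vabs x = w powi k"
proof -
  \<comment> \<open>The logarithm of \<open>w\<close> is negative, so the bounds defining the floor
    reverse into \<open>w powi (k + 1) < vabs x\<close> and
    \<open>vabs x \<le> w powi k\<close>.\<close>
  define k where "k = \<lfloor>ln (vabs x) / ln w\<rfloor>"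
  have ln_neg: "ln w < 0" using w_pos w_less_1 by simp
  have powi: "w powi j = exp (real_of_int j * ln w)" for j
    using w_pos by (simp add: powr_def flip: powr_real_of_int')
  have "real_of_int k \<le> ln (vabs x) / ln w" "ln (vabs x) / ln w < real_of_int k + 1"
    unfolding k_def by linarith+
  then have "ln (vabs x) \<le> real_of_int k * ln w" "real_of_int (k + 1) * ln w < ln (vabs x)"
    using ln_neg by (simp_all add: field_simps)
  then have "exp (ln (vabs x)) \<le> w powi k" "w powi (k + 1) < exp (ln (vabs x))"
    unfolding powi by (simp_all only: exp_le_cancel_iff exp_less_cancel_iff)
  then have le: "vabs x \<le> w powi k" and less: "w powi (k + 1) < vabs x"
    using assms by simp_all
  have "vabs (x / \<pi> powi k) = vabs x / w powi k"
    by (simp add: vabs_divide vabs_powi)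
  moreover have "w < vabs x / w powi k"
    using less w_pos by (simp add: power_int_add field_simps)
  ultimately have "\<not> vabs (x / \<pi> powi k) < 1"
    using vabs_le_w[of "x / \<pi> powi k"] by auto
  then have "vabs x = w powi k"
    using le w_pos by (auto simp: vabs_divide vabs_powi field_simps)
  then show ?thesis by (rule that)
qed

text \<open>Discreteness turns open balls into closed balls of the next radius, so that closed balls
  suffice throughout.\<close>

lemma vabs_less_powi_iff: "vabs (x::'k) < w powi m \<longleftrightarrow> vabs x \<le> w powi (m + 1)"
proof (cases "x = 0")
  case False
  then obtain k where k: "vabs x = w powi k" by (rule vabs_eq_powi)
  show ?thesis unfolding k w_powi_less_iff w_powi_le_iff by linarith
qed simp

subsection \<open>Representatives of the residue field\<close>

text \<open>The representatives are picked by the same choice as in \<open>gauss_sum\<close>, so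
  that sums over \<open>R\<close> reproduce that definition without an argument about independence
  of representatives.\<close>

definition R :: "'k set"
  where "R = (\<lambda>C. SOME x. x \<in> C) ` residue_field"

definition rep :: "'k \<Rightarrow> 'k"
  where "rep x = (THE r. r \<in> R \<and> vabs (x - r) < 1)"

abbreviation res_rel :: "('k \<times> 'k) set"
  where "res_rel \<equiv> {(x, y). x \<in> int_ring \<and> y \<in> int_ring \<and> x - y \<in> max_ideal}"

lemma equiv_res_rel: "equiv int_ring res_rel"
proof (rule equivI)
  show "sym res_rel"
    by (auto simp: sym_def max_ideal_iff vabs_minus_commute)
  show "trans res_rel"
  proof (rule transI)
    fix x y z assume "(x, y) \<in> res_rel" "(y, z) \<in> res_rel"
    then show "(x, z) \<in> res_rel"
      using vabs_add_less[of "x - y" 1 "y - z"] by (auto simp: max_ideal_iff)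
  qed
qed (auto simp: refl_on_def max_ideal_iff)

lemma residue_class_some:
  fixes C :: "'k set"
  assumes "C \<in> residue_field"
  shows "(SOME x. x \<in> C) \<in> C"
proof -
  have "C \<noteq> {}"
    using assms in_quotient_imp_non_empty[OF equiv_res_rel] by (auto simp: residue_field_def)
  then show ?thesis by (simp add: some_in_eq)
qed

lemma residue_class_subset: "(C::'k set) \<in> residue_field \<Longrightarrow> C \<subseteq> int_ring"
  unfolding residue_field_def by (rule in_quotient_imp_subset[OF equiv_res_rel])

lemma inj_on_some_residue: "inj_on (\<lambda>C. SOME x. x \<in> C) (residue_field :: 'k set set)"
proof (rule inj_onI)
  fix C D :: "'k set"
  assume CD: "C \<in> residue_field" "D \<in> residue_field" and eq: "(SOME x. x \<in> C) = (SOME x. x \<in> D)"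
  have "C \<inter> D \<noteq> {}"
    using residue_class_some[OF CD(1)] residue_class_some[OF CD(2)] eq by auto
  then show "C = D"
    using quotient_disj[OF equiv_res_rel, of C D] CD by (auto simp: residue_field_def)
qed

lemma card_R: "real (card R) = q"
  unfolding R_def q_def ideal_norm_def by (simp add: card_image[OF inj_on_some_residue])

lemma R_integral: "r \<in> R \<Longrightarrow> vabs r \<le> 1"
  using residue_class_some residue_class_subset by (fastforce simp: R_def int_ring_iff)

lemma R_ex:
  fixes x :: 'k
  assumes "vabs x \<le> 1"
  shows "\<exists>r\<in>R. vabs (x - r) < 1"
proof -
  let ?C = "res_rel `` {x}"
  have C: "?C \<in> residue_field"
    using assms unfolding residue_field_def by (intro quotientI) (simp add: int_ring_iff)
  define y where "y = (SOME y. y \<in> ?C)"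
  have "y \<in> ?C"
    unfolding y_def using C by (rule residue_class_some)
  then have "vabs (x - y) < 1"
    by (simp add: max_ideal_iff)
  moreover have "y \<in> R"
    using C unfolding R_def y_def by blast
  ultimately show ?thesis by blast
qed

lemma R_unique:
  assumes "r \<in> R" and "s \<in> R" and "vabs (r - s) < 1"
  shows "r = s"
proof -
  obtain C D where CD: "C \<in> residue_field" "D \<in> residue_field"
    and rs: "r = (SOME x. x \<in> C)" "s = (SOME x. x \<in> D)"
    using assms by (auto simp: R_def)
  have "r \<in> C" "s \<in> D" "(r, s) \<in> res_rel"
    using CD residue_class_some assms(3) R_integral[OF assms(1)] R_integral[OF assms(2)]
    by (auto simp: rs int_ring_iff max_ideal_iff)
  then have "C = D"
    using quotient_eqI[OF equiv_res_rel, of C D r s] CD by (auto simp: residue_field_def)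
  then show ?thesis by (simp add: rs)
qed

lemma rep_eqI:
  assumes "r \<in> R" and "vabs (x - r) < 1"
  shows "rep x = r"
  unfolding rep_def
proof (rule the_equality)
  fix s assume s: "s \<in> R \<and> vabs (x - s) < 1"
  have "vabs ((x - r) - (x - s)) < 1"
    by (rule vabs_diff_less) (use assms(2) s in auto)
  then show "s = r"
    using R_unique[of s r] assms(1) s by simp
qed (use assms in auto)

lemma rep:
  assumes "vabs x \<le> 1"
  shows "rep x \<in> R" and "vabs (x - rep x) < 1"
proof -
  obtain r where "r \<in> R" "vabs (x - r) < 1"
    using R_ex[OF assms] by blast
  with rep_eqI[of r x] show "rep x \<in> R" "vabs (x - rep x) < 1" by auto
qed

lemma rep_R: "r \<in> R \<Longrightarrow> rep r = r"
  by (rule rep_eqI) auto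

lemma rep_eq_iff:
  assumes "vabs x \<le> 1" and "vabs y \<le> 1"
  shows "rep x = rep y \<longleftrightarrow> vabs (x - y) < 1"
proof
  assume "rep x = rep y"
  then have "x - y = (x - rep x) - (y - rep y)" by simp
  then show "vabs (x - y) < 1"
    using assms rep vabs_diff_less by metis
next
  assume "vabs (x - y) < 1"
  then have "vabs ((x - y) + (y - rep y)) < 1"
    using rep[OF assms(2)] by (intro vabs_add_less)
  then show "rep x = rep y"
    using rep[OF assms(2)] by (intro rep_eqI) auto
qed

text \<open>Distinct representatives are at distance at least 1, so points of the dense set closer
  than 1 to them are distinct as well; this injects \<open>R\<close> into a countable set.\<close>

lemma countable_R: "countable R"
proof -
  obtain C :: "'k set" where C: "countable C" "closure C = UNIV"
    using separable by blast
  have "\<exists>c\<in>C. vabs (r - c) < 1" for r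
  proof -
    have "r \<in> closure C" using C by simp
    then obtain c where "c \<in> C" "dist c r < 1"
      unfolding closure_approachable using zero_less_one by blast
    then show ?thesis by (auto simp: dist_eq_vabs vabs_minus_commute)
  qed
  then obtain g where g: "\<And>r. g r \<in> C" "\<And>r. vabs (r - g r) < 1" by metis
  have "inj_on g R"
  proof (rule inj_onI)
    fix r s assume "r \<in> R" "s \<in> R" "g r = g s"
    moreover have "vabs ((r - g r) - (s - g s)) < 1"
      by (rule vabs_diff_less) (rule g)+
    ultimately show "r = s" by (intro R_unique) auto
  qed
  moreover have "g ` R \<subseteq> C" using g by auto
  ultimately show ?thesis
    using C(1) by (metis countable_image_inj_on countable_subset)
qed

subsection \<open>The measure of balls\<close>

lemma sets_haar: "sets \<mu> = sets borel"
  using haar by (simp add: normalized_haar_def)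

lemma space_haar: "space \<mu> = UNIV"
  using sets_eq_imp_space_eq[OF sets_haar] by simp

lemma measurable_haar: "borel_measurable \<mu> = borel_measurable borel"
  by (rule measurable_cong_sets) (simp_all add: sets_haar)

lemma cball_in_sets [simp]: "cball (a::'k) e \<in> sets \<mu>"
  by (simp add: sets_haar)

lemma mem_cball_vabs: "x \<in> cball a e \<longleftrightarrow> vabs (x - a) \<le> e"
  by (simp add: dist_eq_vabs vabs_minus_commute)

lemma int_ring_cball: "int_ring = cball (0::'k) 1"
  by (auto simp: int_ring_iff mem_cball_vabs simp del: mem_cball)

lemma emeasure_translate:
  assumes "A \<in> sets borel"
  shows "emeasure \<mu> ((\<lambda>x. a + x) ` A) = emeasure \<mu> A"
  using haar assms by (simp add: normalized_haar_def)

lemma emeasure_cball_translate: "emeasure \<mu> (cball a e) = emeasure \<mu> (cball 0 e)"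
proof -
  have "cball a e = (\<lambda>x. a + x) ` cball 0 e"
  proof
    show "cball a e \<subseteq> (\<lambda>x. a + x) ` cball 0 e"
    proof
      fix x assume "x \<in> cball a e"
      then show "x \<in> (\<lambda>x. a + x) ` cball 0 e"
        by (intro image_eqI[of _ _ "x - a"]) (auto simp: mem_cball_vabs simp del: mem_cball)
    qed
  qed (auto simp: mem_cball_vabs simp del: mem_cball)
  then show ?thesis by (simp add: emeasure_translate)
qed

lemma emeasure_int_ring: "emeasure \<mu> (cball 0 1) = 1"
  using haar by (simp add: normalized_haar_def int_ring_cball)

lemma cball_cosets:
  "cball 0 (w powi m) = (\<Union>r\<in>R. cball (\<pi> powi m * r) (w powi (m + 1)))"
proof (intro equalityI subsetI)
  fix x :: 'k assume "x \<in> cball 0 (w powi m)"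
  then have "vabs (x / \<pi> powi m) \<le> 1"
    by (simp add: mem_cball_vabs vabs_divide vabs_powi field_simps del: mem_cball)
  then obtain r where r: "r \<in> R" "vabs (x / \<pi> powi m - r) < 1"
    using R_ex by blast
  have "x - \<pi> powi m * r = \<pi> powi m * (x / \<pi> powi m - r)"
    by (simp add: field_simps)
  then have "vabs (x - \<pi> powi m * r) < w powi m"
    using r(2) by (simp add: vabs_mult vabs_powi)
  then show "x \<in> (\<Union>r\<in>R. cball (\<pi> powi m * r) (w powi (m + 1)))"
    using r(1) by (auto simp: mem_cball_vabs vabs_less_powi_iff simp del: mem_cball)
next
  fix x :: 'k assume "x \<in> (\<Union>r\<in>R. cball (\<pi> powi m * r) (w powi (m + 1)))"
  then obtain r where r: "r \<in> R" "vabs (x - \<pi> powi m * r) < w powi m"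
    by (auto simp: mem_cball_vabs vabs_less_powi_iff simp del: mem_cball)
  have "vabs ((x - \<pi> powi m * r) + \<pi> powi m * r) \<le> w powi m"
    using r R_integral[OF r(1)] by (intro vabs_add_le) (simp_all add: vabs_mult vabs_powi mult_left_le)
  then show "x \<in> cball 0 (w powi m)"
    by (simp add: mem_cball_vabs del: mem_cball)
qed

lemma disjoint_cosets:
  "disjoint_family_on (\<lambda>r. cball (\<pi> powi m * r) (w powi (m + 1))) R"
proof (unfold disjoint_family_on_def, intro ballI impI)
  fix r s assume rs: "r \<in> R" "s \<in> R" "r \<noteq> s"
  show "cball (\<pi> powi m * r) (w powi (m + 1)) \<inter> cball (\<pi> powi m * s) (w powi (m + 1)) = {}"
  proof (rule ccontr)
    assume "\<not> ?thesis"
    then obtain x where "vabs (x - \<pi> powi m * r) < w powi m" "vabs (x - \<pi> powi m * s) < w powi m"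
      by (auto simp: mem_cball_vabs vabs_less_powi_iff simp del: mem_cball)
    then have "vabs ((x - \<pi> powi m * s) - (x - \<pi> powi m * r)) < w powi m"
      by (rule vabs_diff_less[rotated])
    also have "(x - \<pi> powi m * s) - (x - \<pi> powi m * r) = \<pi> powi m * (r - s)"
      by (simp add: algebra_simps)
    finally have "vabs (r - s) < 1"
      by (simp add: vabs_mult vabs_powi)
    with rs R_unique show False by blast
  qed
qed

text \<open>At this point \<open>R\<close> is only known to be countable, so additivity is used in
  its countable form and the number of cosets is recorded as the counting measure of
  \<open>R\<close>, which may still be infinite.\<close>

lemma emeasure_cosets:
  "emeasure \<mu> (cball 0 (w powi m)) = emeasure \<mu> (cball 0 (w powi (m + 1))) * emeasure (count_space R) R"
proof -
  have "emeasure \<mu> (cball 0 (w powi m)) =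
      (\<integral>\<^sup>+ r. emeasure \<mu> (cball (\<pi> powi m * r) (w powi (m + 1))) \<partial>count_space R)"
    by (subst cball_cosets, rule emeasure_UN_countable[OF _ countable_R disjoint_cosets]) simp
  also have "\<dots> = (\<integral>\<^sup>+ r. emeasure \<mu> (cball 0 (w powi (m + 1))) \<partial>count_space R)"
    by (intro nn_integral_cong emeasure_cball_translate)
  finally show ?thesis by simp
qed

text \<open>A countably infinite disjoint union of translates cannot have measure 1.\<close>

lemma finite_R: "finite R"
proof (rule ccontr)
  assume inf: "infinite R"
  have "1 = emeasure \<mu> (cball 0 w) * \<infinity>"
    using emeasure_cosets[of 0] emeasure_int_ring inf by (simp add: emeasure_count_space_infinite)
  then show False
    by (cases "emeasure \<mu> (cball 0 w) = 0") (auto simp: ennreal_mult_top)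
qed

lemma q_gt_1: "1 < q"
proof -
  have "rep 0 \<noteq> rep 1"
    by (simp add: rep_eq_iff)
  moreover have "{rep 0, rep 1} \<subseteq> R"
    by (simp add: rep)
  ultimately have "2 \<le> card R"
    using card_mono[OF finite_R, of "{rep 0, rep 1}"] by simp
  then show ?thesis using card_R by linarith
qed

text \<open>Passing to the next smaller radius divides the measure by \<open>q\<close>. The
  normalization at radius 1 is the start, and the induction runs in both directions over the
  integers.\<close>

lemma emeasure_cball: "emeasure \<mu> (cball a (w powi m)) = ennreal (q powi (- m))"
proof -
  let ?E = "\<lambda>m. emeasure \<mu> (cball 0 (w powi m))"
  have rec: "?E m = ?E (m + 1) * ennreal q" for m
    using emeasure_cosets[of m] finite_R card_R by (simp add: ennreal_of_nat_eq_real_of_nat)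
  have q: "q \<noteq> 0" "0 \<le> q" using q_gt_1 by auto
  have "?E m = ennreal (q powi (- m))"
  proof (induction m rule: int_induct[where k = 0])
    case base
    then show ?case by (simp add: emeasure_int_ring)
  next
    case (step1 i)
    have "?E (i + 1) = ?E (i + 1) * (ennreal q * ennreal (inverse q))"
      using q by (simp flip: ennreal_mult)
    also have "\<dots> = ennreal (q powi (- i)) * ennreal (inverse q)"
      by (simp only: mult.assoc[symmetric] rec[symmetric] step1.IH)
    also have "\<dots> = ennreal (q powi (- i) * inverse q)"
      using q by (intro ennreal_mult[symmetric]) auto
    also have "q powi (- i) * inverse q = q powi (- (i + 1))"
      using q by (simp add: power_int_minus power_int_add power_int_diff field_simps)
    finally show ?case .
  next
    case (step2 i)
    have "?E (i - 1) = ennreal (q powi (- i)) * ennreal q"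
      using rec[of "i - 1"] step2.IH by simp
    also have "\<dots> = ennreal (q powi (- i) * q)"
      using q by (intro ennreal_mult[symmetric]) auto
    also have "q powi (- i) * q = q powi (- (i - 1))"
      using q power_int_add_1[of q "- i"] by simp
    finally show ?case .
  qed
  then show ?thesis by (subst emeasure_cball_translate)
qed

lemma UN_cball: "(\<Union>i::nat. cball (0::'k) (w powi (- int i))) = UNIV"
proof (intro equalityI subset_UNIV subsetI)
  fix x :: 'k
  have pos: "0 < vabs x + 1" by (simp add: add_nonneg_pos)
  obtain i :: nat where "w ^ i < inverse (vabs x + 1)"
    using real_arch_pow_inv[of "inverse (vabs x + 1)" w] w_less_1 pos by auto
  then have "inverse (inverse (vabs x + 1)) < inverse (w ^ i)"
    using w_pos by (intro less_imp_inverse_less) auto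
  then have "vabs x + 1 < w powi (- int i)"
    by (simp add: power_int_minus)
  then show "x \<in> (\<Union>i::nat. cball (0::'k) (w powi (- int i)))"
    by (auto simp: mem_cball_vabs simp del: mem_cball intro!: exI[of _ i])
qed

sublocale sigma_finite_measure \<mu>
proof
  show "\<exists>A. countable A \<and> A \<subseteq> sets \<mu> \<and> \<Union>A = space \<mu> \<and> (\<forall>a\<in>A. emeasure \<mu> a \<noteq> \<infinity>)"
    using UN_cball
    by (intro exI[of _ "range (\<lambda>i::nat. cball (0::'k) (w powi (- int i)))"])
      (auto simp: space_haar emeasure_cball)
qed

subsection \<open>Change of variables\<close>

text \<open>The empty set is included so that disjoint balls do not spoil closure under
  intersection: the family is to be a generating pi-system.\<close>

definition balls :: "'k set set"
  where "balls = insert {} (range (\<lambda>(a, m). cball a (w powi m)))"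

lemma ballsE:
  assumes "A \<in> balls" and "A \<noteq> {}"
  obtains a m where "A = cball a (w powi m)"
  using assms by (auto simp: balls_def)

lemma cball_in_balls: "cball a (w powi m) \<in> balls"
  unfolding balls_def by (rule insertI2) (rule range_eqI[of _ _ "(a, m)"], simp)

lemma cball_center:
  assumes "b \<in> cball (a::'k) e"
  shows "cball b e = cball a e"
proof (intro equalityI subsetI)
  fix x assume "x \<in> cball b e"
  then have "vabs ((x - b) + (b - a)) \<le> e"
    using assms by (intro vabs_add_le) (simp_all add: mem_cball_vabs del: mem_cball)
  then show "x \<in> cball a e" by (simp add: mem_cball_vabs del: mem_cball)
next
  fix x assume "x \<in> cball a e"
  then have "vabs ((x - a) - (b - a)) \<le> e"
    using assms by (intro vabs_diff_le[of "x - a"]) (simp_all add: mem_cball_vabs del: mem_cball)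
  then show "x \<in> cball b e" by (simp add: mem_cball_vabs del: mem_cball)
qed

text \<open>Every point of an ultrametric ball is a centre of it, so two balls that meet can be
  recentred at a common point and are then nested.\<close>

lemma Int_stable_balls: "Int_stable balls"
proof (rule Int_stableI)
  fix A B assume AB: "A \<in> balls" "B \<in> balls"
  show "A \<inter> B \<in> balls"
  proof (cases "A \<inter> B = {}")
    case False
    then obtain x where x: "x \<in> A" "x \<in> B" by blast
    then obtain a m b n where "A = cball a (w powi m)" "B = cball b (w powi n)"
      using AB by (metis ballsE empty_iff)
    with x have "A = cball x (w powi m)" "B = cball x (w powi n)"
      using cball_center by blast+
    then have "A \<inter> B = cball x (w powi m) \<or> A \<inter> B = cball x (w powi n)"
      by (cases "w powi m \<le> w powi n") auto
    then show ?thesis by (auto simp: balls_def)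
  qed (simp add: balls_def)
qed

lemma small_powi:
  assumes "0 < e"
  obtains m :: nat where "w powi (int m) < e"
  using real_arch_pow_inv[OF assms w_less_1] by auto

text \<open>An open set is the union of the balls inside it with a centre in the countable dense set
  and a power of \<open>w\<close> as radius. No radius has to be halved, because a ball around
  \<open>x\<close> is also a ball around each of its points.\<close>

lemma borel_eq_balls: "sets borel = sigma_sets UNIV balls"
proof
  have "sigma_sets UNIV balls \<subseteq> sigma_sets UNIV (sets borel)"
    by (rule sigma_sets_mono') (auto simp: balls_def)
  also have "\<dots> = sets borel"
    using sets.sigma_sets_eq[of "borel :: 'k measure"] by simp
  finally show "sigma_sets UNIV balls \<subseteq> sets borel" .
next
  obtain C :: "'k set" where C: "countable C" "closure C = UNIV"
    using separable by blast
  have "U \<in> sigma_sets UNIV balls" if "open U" for U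
  proof -
    define F where "F = {(c, m :: nat). c \<in> C \<and> cball c (w powi int m) \<subseteq> U}"
    have "F \<subseteq> C \<times> UNIV" by (auto simp: F_def)
    then have "countable F"
      by (rule countable_subset) (intro countable_SIGMA C(1) countableI_type)
    have "U = (\<Union>(c, m)\<in>F. cball c (w powi int m))"
    proof (intro equalityI subsetI)
      fix x assume "x \<in> U"
      then obtain e where e: "0 < e" "cball x e \<subseteq> U"
        using \<open>open U\<close> open_contains_cball by blast
      obtain m :: nat where m: "w powi int m < e"
        using small_powi[OF e(1)] by blast
      have "x \<in> closure C" using C by simp
      then obtain c where c: "c \<in> C" "dist c x < w powi int m"
        unfolding closure_approachable using w_powi_pos by blast
      then have "c \<in> cball x (w powi int m)" by (simp add: dist_commute)
      then have "cball c (w powi int m) = cball x (w powi int m)" by (rule cball_center)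
      moreover have "cball x (w powi int m) \<subseteq> cball x e" using m by auto
      ultimately have "(c, m) \<in> F" "x \<in> cball c (w powi int m)"
        using c e by (auto simp: F_def)
      then show "x \<in> (\<Union>(c, m)\<in>F. cball c (w powi int m))" by blast
    qed (auto simp: F_def)
    moreover have "(\<Union>(c, m)\<in>F. cball c (w powi int m)) \<in> sigma_sets UNIV balls"
    proof -
      interpret sigma_algebra UNIV "sigma_sets UNIV balls"
        by (rule sigma_algebra_sigma_sets) simp
      show ?thesis
        using \<open>countable F\<close>
        by (intro countable_UN')
          (auto intro!: sigma_sets.Basic cball_in_balls simp del: power_int_of_nat)
    qed
    ultimately show ?thesis by simp
  qed
  then have "sigma_sets UNIV {U. open U} \<subseteq> sigma_sets UNIV balls"
    by (intro sigma_sets_mono) auto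
  then show "sets borel \<subseteq> sigma_sets UNIV balls"
    by (simp add: borel_def)
qed

lemma measurable_mult_left: "(\<lambda>x. a * x) \<in> borel_measurable (borel :: 'k measure)"
proof (cases "a = 0")
  case False
  have "continuous_on UNIV (\<lambda>x. a * x)"
  proof (rule continuous_onI)
    fix x :: 'k and e :: real assume "0 < e"
    then show "\<exists>d>0. \<forall>x'\<in>UNIV. dist x' x < d \<longrightarrow> dist (a * x') (a * x) \<le> e"
      using False
      by (intro exI[of _ "e / vabs a"])
        (auto simp: dist_eq_vabs vabs_mult pos_less_divide_eq mult.commute[of _ "vabs a"]
          simp flip: right_diff_distrib)
  qed
  then show ?thesis by (rule borel_measurable_continuous_onI)
qed simp

lemma measurable_translate: "(\<lambda>x. a + x) \<in> borel_measurable (borel :: 'k measure)"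
proof -
  have "continuous_on UNIV (\<lambda>x. a + x)"
  proof (rule continuous_onI)
    fix x :: 'k and e :: real assume "0 < e"
    then show "\<exists>d>0. \<forall>x'\<in>UNIV. dist x' x < d \<longrightarrow> dist (a + x') (a + x) \<le> e"
      by (intro exI[of _ e]) (auto simp: dist_eq_vabs)
  qed
  then show ?thesis by (rule borel_measurable_continuous_onI)
qed

lemma distr_translate: "distr \<mu> borel (\<lambda>x. a + x) = \<mu>"
proof (rule measure_eqI)
  fix A assume "A \<in> sets (distr \<mu> borel (\<lambda>x. a + x))"
  then have A: "A \<in> sets borel" by simp
  have "(\<lambda>x. a + x) -` A = (\<lambda>x. - a + x) ` A"
    by (auto intro!: image_eqI[of _ _ "a + _"])
  then show "emeasure (distr \<mu> borel (\<lambda>x. a + x)) A = emeasure \<mu> A"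
    using A emeasure_translate[OF A, of "- a"] measurable_translate[of a] sets_haar
    by (simp add: emeasure_distr space_haar measurable_cong_sets[OF sets_haar refl])
qed (simp add: sets_haar)

text \<open>Both measures are compared on the pi-system of balls. The preimage of a ball under
  multiplication by \<open>a\<close> has its radius exponent lowered by \<open>k\<close>, which
  accounts for the factor \<open>q powi k\<close>.\<close>

lemma distr_mult:
  assumes a: "vabs a = w powi k"
  shows "distr \<mu> borel (\<lambda>x. a * x) = density \<mu> (\<lambda>_. ennreal (q powi k))"
proof -
  have a0: "a \<noteq> 0" using a w_powi_pos[of k] by auto
  have meas: "(\<lambda>x. a * x) \<in> measurable \<mu> borel"
    using measurable_mult_left by (simp add: measurable_cong_sets[OF sets_haar refl])
  have vimage: "(\<lambda>x. a * x) -` cball b (w powi m) = cball (b / a) (w powi (m - k))" for b m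
  proof -
    have "vabs (a * x - b) = w powi k * vabs (x - b / a)" for x
      using a0 by (simp add: right_diff_distrib flip: a vabs_mult)
    then show ?thesis
      using w_pos by (auto simp: mem_cball_vabs power_int_diff field_simps simp del: mem_cball)
  qed
  have eq: "emeasure (distr \<mu> borel (\<lambda>x. a * x)) X =
      emeasure (density \<mu> (\<lambda>_. ennreal (q powi k))) X" if X_balls: "X \<in> balls" for X
  proof (cases "X = {}")
    case False
    with X_balls obtain b m where X: "X = cball b (w powi m)"
      by (rule ballsE)
    have "emeasure (distr \<mu> borel (\<lambda>x. a * x)) X = ennreal (q powi (- (m - k)))"
      using meas by (simp add: X emeasure_distr space_haar vimage emeasure_cball)
    also have "q powi (- (m - k)) = q powi k * q powi (- m)"
      using q_gt_1 by (simp flip: power_int_add)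
    finally show ?thesis
      using q_gt_1 by (simp add: X emeasure_density nn_integral_cmult_indicator emeasure_cball ennreal_mult)
  qed simp
  show ?thesis
  proof (rule measure_eqI_generator_eq[OF Int_stable_balls _ eq])
    show "range (\<lambda>i. cball 0 (w powi (- int i))) \<subseteq> balls"
      by (auto simp: balls_def)
    show "emeasure (distr \<mu> borel (\<lambda>x. a * x)) (cball 0 (w powi (- int i))) \<noteq> \<infinity>" for i
      using meas by (simp add: emeasure_distr space_haar vimage emeasure_cball)
    show "sets (distr \<mu> borel (\<lambda>x. a * x)) = sigma_sets UNIV balls"
      by (simp add: borel_eq_balls)
    show "sets (density \<mu> (\<lambda>_. ennreal (q powi k))) = sigma_sets UNIV balls"
      by (simp add: sets_haar borel_eq_balls)
  qed (simp_all only: UN_cball Pow_UNIV subset_UNIV)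
qed

lemma integral_translate:
  fixes f :: "'k \<Rightarrow> complex"
  assumes "f \<in> borel_measurable borel"
  shows "(LINT x|\<mu>. f (a + x)) = (LINT x|\<mu>. f x)"
  using integral_distr[of "\<lambda>x. a + x" \<mu> borel f] assms measurable_translate[of a]
  by (simp add: distr_translate measurable_cong_sets[OF sets_haar refl])

lemma integral_mult:
  fixes f :: "'k \<Rightarrow> complex"
  assumes "f \<in> borel_measurable borel" and "vabs a = w powi k"
  shows "(LINT x|\<mu>. f (a * x)) = q powi k * (LINT x|\<mu>. f x)"
proof -
  have "(LINT x|\<mu>. f (a * x)) = (LINT x|density \<mu> (\<lambda>_. ennreal (q powi k)). f x)"
    using integral_distr[of "\<lambda>x. a * x" \<mu> borel f] assms measurable_mult_left[of a]
    by (simp add: distr_mult measurable_cong_sets[OF sets_haar refl])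
  also have "\<dots> = (LINT x|\<mu>. (q powi k) *\<^sub>R f x)"
    using assms(1) q_gt_1 by (intro integral_density) (auto simp: measurable_haar)
  finally show ?thesis by (simp add: scaleR_conv_of_real)
qed

end


context haar_field
begin

subsection \<open>Integration of locally constant functions\<close>

text \<open>The integrands are of this kind on each piece of the field over which they are
  integrated. The class is closed under products, translations and scaling, and it yields
  measurability, and integrability on sets of finite measure. Local constancy is pointwise, with no
  uniform radius.\<close>

definition lc_bounded :: "('k \<Rightarrow> complex) \<Rightarrow> bool"
  where "lc_bounded f \<longleftrightarrow>
    (\<forall>x. \<exists>e>0. \<forall>y. vabs (y - x) < e \<longrightarrow> f y = f x) \<and> (\<exists>B. \<forall>x. norm (f x) \<le> B)"

lemma lc_bounded_measurable:
  assumes "lc_bounded f"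
  shows "f \<in> borel_measurable borel"
proof (rule borel_measurable_continuous_onI, rule continuous_onI)
  fix x :: 'k and e :: real assume "0 < e"
  obtain d where "d > 0" and d: "\<And>y. vabs (y - x) < d \<Longrightarrow> f y = f x"
    using assms unfolding lc_bounded_def by meson
  have "dist (f y) (f x) \<le> e" if "dist y x < d" for y
    using d[of y] that \<open>0 < e\<close> by (simp add: dist_eq_vabs)
  then show "\<exists>d>0. \<forall>y\<in>UNIV. dist y x < d \<longrightarrow> dist (f y) (f x) \<le> e"
    using \<open>d > 0\<close> by blast
qed

lemma lc_bounded_const: "lc_bounded (\<lambda>_. c)"
  unfolding lc_bounded_def by (auto intro: exI[of _ 1])

lemma lc_bounded_mult:
  assumes f: "lc_bounded f" and g: "lc_bounded g"
  shows "lc_bounded (\<lambda>x. f x * g x)"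
  unfolding lc_bounded_def
proof (intro conjI allI)
  fix x
  obtain d e where "d > 0" "\<forall>y. vabs (y - x) < d \<longrightarrow> f y = f x"
    "e > 0" "\<forall>y. vabs (y - x) < e \<longrightarrow> g y = g x"
    using f g unfolding lc_bounded_def by meson
  then show "\<exists>e>0. \<forall>y. vabs (y - x) < e \<longrightarrow> f y * g y = f x * g x"
    by (intro exI[of _ "min d e"]) (metis min_less_iff_conj)
next
  obtain A B where "\<And>x. norm (f x) \<le> A" "\<And>x. norm (g x) \<le> B"
    using f g unfolding lc_bounded_def by meson
  then have "norm (f x * g x) \<le> A * B" for x
    unfolding norm_mult by (intro mult_mono) (auto intro: order_trans[OF norm_ge_zero])
  then show "\<exists>B. \<forall>x. norm (f x * g x) \<le> B" by blast
qed

lemma lc_bounded_power: "lc_bounded f \<Longrightarrow> lc_bounded (\<lambda>x. f x ^ n)"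
  by (induction n) (auto intro: lc_bounded_const lc_bounded_mult)

lemma lc_bounded_translate:
  assumes "lc_bounded f"
  shows "lc_bounded (\<lambda>x. f (a + x))"
  unfolding lc_bounded_def
proof (intro conjI allI)
  fix x
  obtain d where "d > 0" "\<forall>y. vabs (y - (a + x)) < d \<longrightarrow> f y = f (a + x)"
    using assms unfolding lc_bounded_def by meson
  then show "\<exists>e>0. \<forall>y. vabs (y - x) < e \<longrightarrow> f (a + y) = f (a + x)"
    by (intro exI[of _ d]) (metis add_diff_cancel_left)
qed (use assms in \<open>unfold lc_bounded_def, blast\<close>)

lemma lc_bounded_scale:
  assumes "lc_bounded f"
  shows "lc_bounded (\<lambda>x. f (a * x))"
proof (cases "a = 0")
  case False
  show ?thesis
    unfolding lc_bounded_def
  proof (intro conjI allI)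
    fix x
    obtain d where d: "d > 0" "\<And>y. vabs (y - a * x) < d \<Longrightarrow> f y = f (a * x)"
      using assms unfolding lc_bounded_def by meson
    have "f (a * y) = f (a * x)" if "vabs (y - x) < d / vabs a" for y
    proof (rule d(2))
      have "vabs (a * y - a * x) = vabs a * vabs (y - x)"
        by (simp flip: vabs_mult right_diff_distrib)
      also have "\<dots> < d"
        using that False by (simp add: field_simps)
      finally show "vabs (a * y - a * x) < d" .
    qed
    moreover have "d / vabs a > 0" using False d(1) by simp
    ultimately show "\<exists>e>0. \<forall>y. vabs (y - x) < e \<longrightarrow> f (a * y) = f (a * x)" by blast
  qed (use assms in \<open>unfold lc_bounded_def, blast\<close>)
qed (simp add: lc_bounded_const)

lemma lc_bounded_of_bool_unit: "lc_bounded (\<lambda>x. of_bool (vabs x = 1))"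
  unfolding lc_bounded_def
proof (intro conjI allI)
  fix x :: 'k
  have eq: "vabs y = 1" if "vabs (y - x) < 1" "vabs x = 1" for x y :: 'k
  proof (rule antisym)
    show "vabs y \<le> 1"
      using vabs_add_le[of "y - x" 1 x] that by simp
    show "1 \<le> vabs y"
      using vabs_diff_less[of y 1 "y - x"] that by fastforce
  qed
  have "(of_bool (vabs y = 1) :: complex) = of_bool (vabs x = 1)" if "vabs (y - x) < 1" for y
  proof -
    have "vabs y = 1 \<longleftrightarrow> vabs x = 1"
      using eq[of y x] eq[of x y] that vabs_minus_commute[of x y] by argo
    then show ?thesis by simp
  qed
  then show "\<exists>e>0. \<forall>y. vabs (y - x) < e \<longrightarrow> (of_bool (vabs y = 1) :: complex) = of_bool (vabs x = 1)"
    using zero_less_one by blast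
qed (auto intro!: exI[of _ 1])

lemma lc_bounded_set_integrable:
  assumes "lc_bounded f" and "A \<in> sets \<mu>" and "emeasure \<mu> A < \<infinity>"
  shows "set_integrable \<mu> A f"
proof -
  obtain B where "\<And>x. norm (f x) \<le> B"
    using assms(1) unfolding lc_bounded_def by meson
  then show ?thesis
    unfolding set_integrable_def
    using assms lc_bounded_measurable[OF assms(1)]
    by (intro integrableI_bounded_set_indicator[where B = B]) (auto simp: measurable_haar)
qed

lemma measurable_indicator_lc:
  assumes "lc_bounded f" and "A \<in> sets \<mu>"
  shows "(\<lambda>x. indicat_real A x *\<^sub>R f x) \<in> borel_measurable borel"
  using assms lc_bounded_measurable[OF assms(1)]
  by (intro borel_measurable_scaleR borel_measurable_indicator) (auto simp: sets_haar)

definition J :: "('k \<Rightarrow> complex) \<Rightarrow> complex"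
  where "J f = (LINT x:cball 0 1|\<mu>. f x)"

lemma J_cong:
  assumes "\<And>x. vabs x \<le> 1 \<Longrightarrow> f x = g x"
  shows "J f = J g"
  unfolding J_def using assms
  by (intro set_lebesgue_integral_cong) (auto simp: mem_cball_vabs simp del: mem_cball)

lemma J_cmult: "J (\<lambda>x. a * f x) = a * J f"
  by (simp add: J_def)

lemma J_const: "J (\<lambda>_. a) = a"
  by (simp add: J_def set_lebesgue_integral_def emeasure_int_ring measure_def scaleR_conv_of_real)

lemma J_translate:
  assumes f: "lc_bounded f" and y: "vabs y \<le> 1"
  shows "J (\<lambda>x. f (y + x)) = J f"
proof -
  have "indicat_real (cball 0 1) x = indicat_real (cball 0 1) (y + x)" for x
    using y vabs_add_le[of y 1 x] vabs_diff_le[of "y + x" 1 y]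
    by (auto simp: indicator_def mem_cball_vabs simp del: mem_cball)
  then show ?thesis
    using integral_translate[OF measurable_indicator_lc[OF f], of "cball 0 1" y]
    by (simp add: J_def set_lebesgue_integral_def)
qed

text \<open>The basic recursion: the ring of integers is the disjoint union of the cosets
  \<open>r + \<pi> * z\<close>, and each is mapped back to the whole ring by a substitution with
  Jacobian \<open>1 / q\<close>.\<close>

lemma J_cosets:
  assumes f: "lc_bounded f"
  shows "J f = (1 / q) * (\<Sum>r\<in>R. J (\<lambda>z. f (r + \<pi> * z)))"
proof -
  have ind: "indicat_real (cball 0 1) x = (\<Sum>r\<in>R. indicat_real (cball r w) x)" for x
  proof -
    have "indicat_real (cball 0 1) x = indicator (\<Union>r\<in>R. cball r w) x"
      using cball_cosets[of 0] by simp
    also have "\<dots> = (\<Sum>r\<in>R. indicat_real (cball r w) x)"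
      using disjoint_cosets[of 0] by (intro indicator_UN_disjoint finite_R) simp
    finally show ?thesis .
  qed
  have fin: "emeasure \<mu> (cball a w) < \<infinity>" for a
    using emeasure_cball[of a 1] by simp
  have "J f = (LINT x|\<mu>. (\<Sum>r\<in>R. indicat_real (cball r w) x *\<^sub>R f x))"
    by (simp add: J_def set_lebesgue_integral_def ind scaleR_sum_left)
  also have "\<dots> = (\<Sum>r\<in>R. LINT x|\<mu>. indicat_real (cball r w) x *\<^sub>R f x)"
    using lc_bounded_set_integrable[OF f _ fin]
    by (intro Bochner_Integration.integral_sum) (simp add: set_integrable_def)
  also have "\<dots> = (\<Sum>r\<in>R. (1 / q) * J (\<lambda>z. f (r + \<pi> * z)))"
  proof (rule sum.cong[OF refl])
    fix r
    have "(LINT x|\<mu>. indicat_real (cball r w) x *\<^sub>R f x) =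
        (LINT x|\<mu>. indicat_real (cball r w) (r + x) *\<^sub>R f (r + x))"
      by (rule integral_translate[OF measurable_indicator_lc[OF f], symmetric]) simp
    also have "\<dots> = (LINT x|\<mu>. indicat_real (cball 0 w) x *\<^sub>R f (r + x))"
      by (intro Bochner_Integration.integral_cong)
        (auto simp: indicator_def mem_cball_vabs simp del: mem_cball)
    finally have 1: "(LINT x|\<mu>. indicat_real (cball r w) x *\<^sub>R f x) =
        (LINT x|\<mu>. indicat_real (cball 0 w) x *\<^sub>R f (r + x))" .
    have "J (\<lambda>z. f (r + \<pi> * z)) =
        (LINT x|\<mu>. indicat_real (cball 0 w) (\<pi> * x) *\<^sub>R f (r + \<pi> * x))"
      unfolding J_def set_lebesgue_integral_def
      using w_pos by (intro Bochner_Integration.integral_cong)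
        (auto simp: indicator_def mem_cball_vabs vabs_mult simp del: mem_cball)
    also have "\<dots> = q powi 1 * (LINT x|\<mu>. indicat_real (cball 0 w) x *\<^sub>R f (r + x))"
      by (rule integral_mult[OF measurable_indicator_lc[OF lc_bounded_translate[OF f]]]) auto
    finally show "(LINT x|\<mu>. indicat_real (cball r w) x *\<^sub>R f x) = (1 / q) * J (\<lambda>z. f (r + \<pi> * z))"
      using q_gt_1 by (simp add: 1)
  qed
  finally show ?thesis by (simp add: sum_distrib_left)
qed

lemma J_periodic:
  fixes f :: "'k \<Rightarrow> complex"
  assumes "lc_bounded f" and "\<And>x y. vabs x \<le> 1 \<Longrightarrow> vabs (y - x) < 1 \<Longrightarrow> f y = f x"
  shows "J f = (1 / q) * (\<Sum>r\<in>R. f r)"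
proof -
  have "J (\<lambda>z. f (r + \<pi> * z)) = f r" if "r \<in> R" for r
  proof -
    have "J (\<lambda>z. f (r + \<pi> * z)) = J (\<lambda>_. f r)"
    proof (rule J_cong, rule assms(2))
      show "vabs r \<le> 1" using that by (rule R_integral)
      fix z :: 'k assume "vabs z \<le> 1"
      then have "w * vabs z \<le> w" using w_pos by (simp add: mult_left_le)
      then have "vabs (\<pi> * z) < 1" using w_less_1 unfolding vabs_mult by linarith
      then show "vabs (r + \<pi> * z - r) < 1" by simp
    qed
    then show ?thesis by (simp add: J_const)
  qed
  then show ?thesis by (simp add: J_cosets[OF assms(1)])
qed

text \<open>The sign makes the shells of positive index lie outside the ring of integers; the index
  is then the summation variable of the density formula.\<close>

definition shell :: "int \<Rightarrow> 'k set"
  where "shell t = {x. vabs x = w powi (- t)}"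

lemma cball_shell: "cball 0 (w powi (- (t + 1))) = cball 0 (w powi (- t)) \<union> shell (t + 1)"
proof -
  have "vabs (x::'k) \<le> w powi (- (t + 1)) \<longleftrightarrow> vabs x \<le> w powi (- t) \<or> vabs x = w powi (- (t + 1))" for x
    using vabs_less_powi_iff[of x "- (t + 1)"] by auto
  then show ?thesis
    by (auto simp: shell_def mem_cball_vabs simp del: mem_cball)
qed

lemma cball_Int_shell: "cball 0 (w powi (- t)) \<inter> shell (t + 1) = {}"
  using w_powi_less_iff[of "- t" "- (t + 1)"] by (auto simp: shell_def mem_cball_vabs simp del: mem_cball)

lemma shell_eq_Diff: "shell t = cball 0 (w powi (- t)) - cball 0 (w powi (- (t - 1)))"
  using cball_shell[of "t - 1"] cball_Int_shell[of "t - 1"] by auto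

lemma shell_in_sets: "shell t \<in> sets \<mu>"
  unfolding shell_eq_Diff by (intro sets.Diff cball_in_sets)

lemma emeasure_shell: "emeasure \<mu> (shell t) < \<infinity>"
proof -
  have "emeasure \<mu> (shell t) \<le> emeasure \<mu> (cball 0 (w powi (- t)))"
    by (intro emeasure_mono) (auto simp: shell_eq_Diff)
  also have "\<dots> < \<infinity>" by (simp add: emeasure_cball)
  finally show ?thesis .
qed

text \<open>The substitution \<open>x = \<pi> powi (- t) * v\<close> with a unit \<open>v\<close>
  has Jacobian \<open>q powi t\<close>.\<close>

lemma integral_shell:
  assumes f: "lc_bounded f"
  shows "(LINT x:shell t|\<mu>. f x) = q powi t * J (\<lambda>v. of_bool (vabs v = 1) * f (\<pi> powi (- t) * v))"
proof -
  have "J (\<lambda>v. of_bool (vabs v = 1) * f (\<pi> powi (- t) * v)) =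
      (LINT x|\<mu>. indicat_real (shell t) (\<pi> powi (- t) * x) *\<^sub>R f (\<pi> powi (- t) * x))"
    unfolding J_def set_lebesgue_integral_def
    by (intro Bochner_Integration.integral_cong)
      (auto simp: indicator_def mem_cball_vabs shell_def vabs_mult vabs_powi simp del: mem_cball)
  also have "\<dots> = q powi (- t) * (LINT x|\<mu>. indicat_real (shell t) x *\<^sub>R f x)"
    by (rule integral_mult[OF measurable_indicator_lc[OF f shell_in_sets]]) (simp add: vabs_powi)
  finally show ?thesis
    using q_gt_1 by (simp add: set_lebesgue_integral_def power_int_minus field_simps)
qed

text \<open>Integrability is carried through the induction because adding one more shell by
  additivity of the set integral requires it on the ball already reached.\<close>

lemma integral_cball_shells:
  assumes "set_integrable \<mu> (cball 0 1) f" and "\<And>t. t \<ge> 1 \<Longrightarrow> set_integrable \<mu> (shell t) f"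
  shows "set_integrable \<mu> (cball 0 (w powi (- int k))) f \<and>
    (LINT x:cball 0 (w powi (- int k))|\<mu>. f x) = J f + (\<Sum>t=1..k. LINT x:shell (int t)|\<mu>. f x)"
proof (induction k)
  case 0
  then show ?case using assms(1) by (simp add: J_def)
next
  case (Suc k)
  have eq: "cball 0 (w powi (- int (Suc k))) = cball 0 (w powi (- int k)) \<union> shell (int (Suc k))"
    using cball_shell[of "int k"] by (simp add: add.commute)
  have disj: "cball 0 (w powi (- int k)) \<inter> shell (int (Suc k)) = {}"
    using cball_Int_shell[of "int k"] by (simp add: add.commute)
  have sh: "set_integrable \<mu> (shell (int (Suc k))) f"
    using assms(2) by simp
  have "(LINT x:cball 0 (w powi (- int (Suc k)))|\<mu>. f x) =
      (LINT x:cball 0 (w powi (- int k))|\<mu>. f x) + (LINT x:shell (int (Suc k))|\<mu>. f x)"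
    unfolding eq by (rule set_integral_Un[OF disj]) (use Suc sh in auto)
  moreover have "set_integrable \<mu> (cball 0 (w powi (- int (Suc k)))) f"
    unfolding eq by (rule set_integrable_Un) (use Suc sh in \<open>auto intro: shell_in_sets\<close>)
  ultimately show ?case using Suc by (simp del: of_nat_Suc)
qed

end


section \<open>Quadratic residues and Gauss sums\<close>

lemma vabs_eq_of_close:
  assumes "vabs (y - x) < vabs x"
  shows "vabs y = vabs x"
proof (rule antisym)
  show "vabs y \<le> vabs x"
    using vabs_add_le[of "y - x" "vabs x" x] assms by simp
  show "vabs x \<le> vabs y"
    using vabs_diff_less[of y "vabs x" "y - x"] assms by fastforce
qed

text \<open>Applied to absolute values of integral elements, it says that the maximal ideal is
  prime.\<close>

lemma mult_less_1_iff:
  fixes a b :: real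
  assumes "0 \<le> a" "a \<le> 1" "0 \<le> b" "b \<le> 1"
  shows "a * b < 1 \<longleftrightarrow> a < 1 \<or> b < 1"
proof (cases "a = 1")
  case False
  then have "a * b < 1"
    using mult_left_le[of b a] assms by linarith
  then show ?thesis using False assms by auto
qed simp

text \<open>What remains of the arithmetic: 2 is a unit, and there is a unitary additive character
  whose conductor is the ring of integers. The last two assumptions pin the conductor from both
  sides.\<close>

locale gauss_field = haar_field \<pi> \<mu> q for \<pi> :: "'k::valued_field" and \<mu> q +
  fixes \<psi> :: "'k \<Rightarrow> complex"
  assumes vabs_2: "vabs (2::'k) = 1"
    and char_add: "\<psi> (x + y) = \<psi> x * \<psi> y"
    and norm_char: "norm (\<psi> x) = 1"
    and char_integral: "vabs x \<le> 1 \<Longrightarrow> \<psi> x = 1"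
    and char_nontrivial: "\<exists>y. vabs y \<le> 1 \<and> \<psi> (y / \<pi>) \<noteq> 1"
begin

abbreviation \<eta> :: "'k \<Rightarrow> complex"
  where "\<eta> \<equiv> residue_symbol"

section \<open>Functions of the residue class and sums over the residue field\<close>

definition periodic :: "('k \<Rightarrow> complex) \<Rightarrow> bool"
  where "periodic F \<longleftrightarrow> (\<forall>x y. vabs x \<le> 1 \<longrightarrow> vabs (y - x) < 1 \<longrightarrow> F y = F x)"

lemma periodicD: "periodic F \<Longrightarrow> vabs x \<le> 1 \<Longrightarrow> vabs (y - x) < 1 \<Longrightarrow> F y = F x"
  unfolding periodic_def by blast

lemma periodicI: "(\<And>x y. vabs x \<le> 1 \<Longrightarrow> vabs (y - x) < 1 \<Longrightarrow> F y = F x) \<Longrightarrow> periodic F"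
  unfolding periodic_def by blast

lemma char_cong: "vabs (x - y) \<le> 1 \<Longrightarrow> \<psi> x = \<psi> y"
  using char_add[of "x - y" y] char_integral[of "x - y"] by simp

lemma char_0 [simp]: "\<psi> 0 = 1"
  by (rule char_integral) simp

lemma char_sum: "\<psi> (\<Sum>i\<in>I. f i) = (\<Prod>i\<in>I. \<psi> (f i))"
  by (induction I rule: infinite_finite_induct) (auto simp: char_add)

text \<open>The conditions on \<open>g\<close> make \<open>r \<mapsto> rep (g r)\<close> an
  injective self-map of the finite set \<open>R\<close>, hence a permutation.\<close>

lemma sum_R_reindex:
  assumes F: "periodic F"
    and g: "\<And>x. vabs x \<le> 1 \<Longrightarrow> vabs (g x) \<le> 1"
    and inj: "\<And>x y. vabs x \<le> 1 \<Longrightarrow> vabs y \<le> 1 \<Longrightarrow> vabs (g x - g y) < 1 \<Longrightarrow> vabs (x - y) < 1"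
  shows "(\<Sum>r\<in>R. F (g r)) = (\<Sum>r\<in>R. F r)"
proof -
  have "inj_on (\<lambda>r. rep (g r)) R"
  proof (rule inj_onI)
    fix r s assume rs: "r \<in> R" "s \<in> R" "rep (g r) = rep (g s)"
    then have "vabs (g r - g s) < 1"
      using rep_eq_iff g R_integral by blast
    then show "r = s"
      using rs inj R_integral R_unique by blast
  qed
  moreover have "(\<lambda>r. rep (g r)) ` R \<subseteq> R"
    using rep(1) g R_integral by blast
  ultimately have "bij_betw (\<lambda>r. rep (g r)) R R"
    using finite_R by (simp add: bij_betw_def endo_inj_surj)
  then have "(\<Sum>r\<in>R. F r) = (\<Sum>r\<in>R. F (rep (g r)))"
    by (rule sum.reindex_bij_betw[symmetric])
  also have "\<dots> = (\<Sum>r\<in>R. F (g r))"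
  proof (rule sum.cong[OF refl])
    fix r assume "r \<in> R"
    then have "vabs (g r) \<le> 1" using g R_integral by blast
    then show "F (rep (g r)) = F (g r)"
      using rep(2)[of "g r"] vabs_minus_commute[of "g r"] by (intro periodicD[OF F]) auto
  qed
  finally show ?thesis by simp
qed

lemma sum_R_translate:
  assumes "periodic F" and "vabs a \<le> 1"
  shows "(\<Sum>r\<in>R. F (a + r)) = (\<Sum>r\<in>R. F r)"
  using assms by (intro sum_R_reindex) (auto intro: vabs_add_le)

lemma sum_R_mult:
  assumes "periodic F" and "vabs u = 1"
  shows "(\<Sum>r\<in>R. F (u * r)) = (\<Sum>r\<in>R. F r)"
  using assms by (intro sum_R_reindex) (auto simp: vabs_mult simp flip: right_diff_distrib)

lemma periodic_const: "periodic (\<lambda>_. a)"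
  by (simp add: periodic_def)

lemma periodic_mult: "periodic F \<Longrightarrow> periodic G \<Longrightarrow> periodic (\<lambda>x. F x * G x)"
  unfolding periodic_def by metis

lemma vabs_divide_unif: "vabs x < 1 \<Longrightarrow> vabs (x / \<pi>) \<le> 1"
  using vabs_le_w[of x] w_pos by (simp add: vabs_divide)

lemma periodic_char:
  assumes "vabs u \<le> 1"
  shows "periodic (\<lambda>x. \<psi> (u * x / \<pi>))"
proof (rule periodicI, rule char_cong)
  fix x y :: 'k assume "vabs (y - x) < 1"
  then have "vabs (u * (y - x)) < 1"
    using assms by (simp add: vabs_mult) (metis mult_left_le_one_le order_le_less_trans vabs_nonneg)
  then have "vabs (u * (y - x) / \<pi>) \<le> 1" by (rule vabs_divide_unif)
  then show "vabs (u * y / \<pi> - u * x / \<pi>) \<le> 1"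
    by (simp add: right_diff_distrib diff_divide_distrib)
qed

lemma periodic_square:
  assumes F: "periodic F"
  shows "periodic (\<lambda>x. F (x\<^sup>2))"
proof (rule periodicI)
  fix x y :: 'k assume xy: "vabs x \<le> 1" "vabs (y - x) < 1"
  then have "vabs y \<le> 1" using vabs_add_le[of "y - x" 1 x] by simp
  then have "vabs (y + x) \<le> 1" using xy by (intro vabs_add_le)
  then have "vabs (y - x) * vabs (y + x) < 1"
    using xy(2) by (subst mult_less_1_iff) auto
  then have "vabs (y\<^sup>2 - x\<^sup>2) < 1"
    by (simp add: power2_eq_square square_diff_square_factored mult.commute flip: vabs_mult)
  moreover have "vabs (x\<^sup>2) \<le> 1"
    using xy by (simp add: vabs_power power_le_one)
  ultimately show "F (y\<^sup>2) = F (x\<^sup>2)" by (intro periodicD[OF F])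
qed

section \<open>The quadratic residue symbol and its multiplicativity\<close>

lemma symbol_cong:
  assumes "vabs (y - x) < 1"
  shows "\<eta> y = \<eta> x"
proof -
  have aux: "vabs (b - c) < 1" if "vabs (a - b) < 1" "vabs (a - c) < 1" for a b c :: 'k
    using vabs_diff_less[OF that(2) that(1)] by simp
  have "y \<in> max_ideal \<longleftrightarrow> x \<in> max_ideal"
    using aux[of y x 0] aux[of x y 0] assms vabs_minus_commute[of x y] by (auto simp: max_ideal_iff)
  moreover have "y - z\<^sup>2 \<in> max_ideal \<longleftrightarrow> x - z\<^sup>2 \<in> max_ideal" for z
    using aux[of y x "z\<^sup>2"] aux[of x y "z\<^sup>2"] assms vabs_minus_commute[of x y]
    by (auto simp: max_ideal_iff)
  ultimately show ?thesis by (simp add: residue_symbol_def)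
qed

lemma periodic_symbol: "periodic \<eta>"
  by (rule periodicI) (rule symbol_cong)

lemma symbol_0: "vabs x < 1 \<Longrightarrow> \<eta> x = 0"
  by (simp add: residue_symbol_def max_ideal_iff)

lemma symbol_square:
  assumes "vabs y = 1" and "vabs (x - y\<^sup>2) < 1"
  shows "\<eta> x = 1"
proof -
  have "vabs x = 1"
    using vabs_eq_of_close[of x "y\<^sup>2"] assms by (simp add: vabs_power)
  then show ?thesis
    using assms by (auto simp: residue_symbol_def max_ideal_iff int_ring_iff)
qed

lemma symbol_cases:
  assumes "vabs x = 1"
  obtains (square) y where "vabs y = 1" "vabs (x - y\<^sup>2) < 1" "\<eta> x = 1"
  | (nonsquare) "\<And>y. vabs y \<le> 1 \<Longrightarrow> \<not> vabs (x - y\<^sup>2) < 1" "\<eta> x = - 1"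
proof (cases "\<exists>y\<in>int_ring. x - y\<^sup>2 \<in> max_ideal")
  case True
  then obtain y where y: "vabs (x - y\<^sup>2) < 1"
    by (auto simp: max_ideal_iff)
  then have "vabs (y\<^sup>2) = 1"
    using vabs_eq_of_close[of "y\<^sup>2" x] assms by (simp add: vabs_minus_commute)
  then have "vabs y = 1"
    by (simp add: vabs_power power2_eq_1_iff) (metis vabs_nonneg neg_0_le_iff_le not_one_le_zero)
  with y symbol_square square show ?thesis by blast
next
  case False
  then show ?thesis
    using assms by (intro nonsquare) (auto simp: residue_symbol_def max_ideal_iff int_ring_iff)
qed

lemma symbol_values: "\<eta> x \<in> {0, 1, - 1}"
  by (simp add: residue_symbol_def)

lemma symbol_unit_sq: "vabs x = 1 \<Longrightarrow> \<eta> x * \<eta> x = 1"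
  by (erule symbol_cases) auto

text \<open>The zero class has itself as its only root, a square unit has the two roots
  \<open>y\<close> and \<open>- y\<close>, and a nonsquare has none.\<close>

lemma card_square_roots:
  assumes s: "s \<in> R"
  shows "of_nat (card {r \<in> R. rep (r\<^sup>2) = s}) = 1 + \<eta> s"
proof -
  have sq_le: "vabs (r\<^sup>2) \<le> 1" if "r \<in> R" for r
    using R_integral[OF that] by (simp add: vabs_power power_le_one)
  have mem: "rep (r\<^sup>2) = s \<longleftrightarrow> vabs (s - r\<^sup>2) < 1" if "r \<in> R" for r
    using rep_eq_iff[OF sq_le[OF that] R_integral[OF s]] rep_R[OF s] vabs_minus_commute[of s] by simp
  consider "vabs s < 1" | "vabs s = 1" using R_integral[OF s] by linarith
  then show ?thesis
  proof cases
    case 1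
    have "rep (r\<^sup>2) = s \<longleftrightarrow> r = s" if "r \<in> R" for r
    proof -
      have "vabs (s - r\<^sup>2) < 1 \<longleftrightarrow> vabs (r\<^sup>2) < 1"
        using 1 vabs_diff_less[of s 1 "r\<^sup>2"] vabs_diff_less[of s 1 "s - r\<^sup>2"] by auto
      also have "\<dots> \<longleftrightarrow> vabs r < 1"
        using power_less_one_iff[of "vabs r" 2] by (simp add: vabs_power)
      also have "\<dots> \<longleftrightarrow> vabs (r - s) < 1"
        using 1 vabs_diff_less[of r 1 s] vabs_add_less[of "r - s" 1 s] by auto
      also have "\<dots> \<longleftrightarrow> r = s"
        using R_unique[OF that s] by auto
      finally show ?thesis using mem[OF that] by simp
    qed
    then have "{r \<in> R. rep (r\<^sup>2) = s} = {s}" using s by auto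
    then show ?thesis using 1 by (simp add: symbol_0)
  next
    case 2
    then show ?thesis
    proof (cases rule: symbol_cases)
      case (square y)
      have yr: "vabs y \<le> 1" "vabs (- y) \<le> 1" using square by auto
      have "rep (r\<^sup>2) = s \<longleftrightarrow> r = rep y \<or> r = rep (- y)" if r: "r \<in> R" for r
      proof -
        have "vabs (s - r\<^sup>2) < 1 \<longleftrightarrow> vabs (r\<^sup>2 - y\<^sup>2) < 1"
          using vabs_diff_less[of "s - y\<^sup>2" 1 "s - r\<^sup>2"] vabs_diff_less[of "s - y\<^sup>2" 1 "r\<^sup>2 - y\<^sup>2"] square
          by auto
        also have "\<dots> \<longleftrightarrow> vabs (r - y) * vabs (r + y) < 1"
          by (simp add: power2_eq_square square_diff_square_factored mult.commute flip: vabs_mult)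
        also have "\<dots> \<longleftrightarrow> vabs (r - y) < 1 \<or> vabs (r + y) < 1"
        proof -
          have "vabs (r - y) \<le> 1" "vabs (r + y) \<le> 1"
            using R_integral[OF r] yr by (auto intro: vabs_diff_le vabs_add_le)
          then show ?thesis
            by (intro mult_less_1_iff) auto
        qed
        also have "\<dots> \<longleftrightarrow> r = rep y \<or> r = rep (- y)"
          using rep_eq_iff[OF R_integral[OF r] yr(1)] rep_eq_iff[OF R_integral[OF r] yr(2)] rep_R[OF r]
          by simp
        finally show ?thesis using mem[OF r] by simp
      qed
      then have "{r \<in> R. rep (r\<^sup>2) = s} = {rep y, rep (- y)}"
        using rep(1)[OF yr(1)] rep(1)[OF yr(2)] by auto
      \<comment> \<open>The two roots differ by \<open>2 * y\<close>, which is a unit because 2 is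
        one.\<close>
      moreover have "rep y \<noteq> rep (- y)"
        using rep_eq_iff[OF yr] vabs_2 square(1) vabs_mult[of 2 y] by (simp flip: mult_2)
      ultimately show ?thesis using square(3) by simp
    next
      case nonsquare
      then have "{r \<in> R. rep (r\<^sup>2) = s} = {}"
        using mem R_integral by auto
      then show ?thesis using nonsquare(2) by (simp only: card.empty) simp
    qed
  qed
qed

text \<open>Grouping the terms by the class of the square, the fibre over \<open>s\<close> has
  \<open>1 + \<eta> s\<close> elements.\<close>

lemma sum_squares:
  assumes F: "periodic F"
  shows "(\<Sum>r\<in>R. F (r\<^sup>2)) = (\<Sum>s\<in>R. (1 + \<eta> s) * F s)"
proof -
  have sq_le: "vabs (r\<^sup>2) \<le> 1" if "r \<in> R" for r
    using R_integral[OF that] by (simp add: vabs_power power_le_one)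
  have "(\<Sum>r\<in>R. F (r\<^sup>2)) = (\<Sum>s\<in>R. \<Sum>r | r \<in> R \<and> rep (r\<^sup>2) = s. F (r\<^sup>2))"
    using rep(1)[OF sq_le] by (intro sum.group[symmetric] finite_R) auto
  also have "\<dots> = (\<Sum>s\<in>R. \<Sum>r | r \<in> R \<and> rep (r\<^sup>2) = s. F s)"
  proof (intro sum.cong refl)
    fix s r assume "r \<in> {r \<in> R. rep (r\<^sup>2) = s}"
    then show "F (r\<^sup>2) = F s"
      using periodicD[OF F, of s "r\<^sup>2"] rep[OF sq_le, of r] R_integral by auto
  qed
  also have "\<dots> = (\<Sum>s\<in>R. (1 + \<eta> s) * F s)"
    by (intro sum.cong refl) (simp add: card_square_roots)
  finally show ?thesis .
qed

text \<open>The constant function 1 in \<open>sum_squares\<close> counts the residue field on the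
  left, and on the right counts it once more and adds the symbols.\<close>

lemma sum_symbol: "(\<Sum>s\<in>R. \<eta> s) = 0"
  using sum_squares[OF periodic_const[of 1]] by (simp add: sum.distrib)

text \<open>For a nonsquare unit \<open>u\<close> no term of \<open>\<Sum>s. \<eta> (u s) + \<eta> s\<close> is positive, but the sum
  vanishes.\<close>

lemma symbol_mult_nonsquare:
  assumes u: "vabs u = 1" "\<eta> u = - 1" and v: "vabs v = 1"
  shows "\<eta> (u * v) = - \<eta> v"
proof -
  have le: "Re (\<eta> (u * s) + \<eta> s) \<le> 0" if s: "vabs s \<le> 1" for s
  proof (cases "vabs s = 1")
    case True
    then show ?thesis
    proof (cases rule: symbol_cases)
      case (square y)
      have "\<eta> (u * s) \<noteq> 1"
      proof
        assume 1: "\<eta> (u * s) = 1"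
        have "vabs (u * s) = 1" using u True by (simp add: vabs_mult)
        then obtain z where z: "vabs z = 1" "vabs (u * s - z\<^sup>2) < 1"
          using 1 by (cases rule: symbol_cases) auto
        have "vabs (u * (s - y\<^sup>2)) < 1"
          using u square by (simp add: vabs_mult)
        then have "vabs ((u * s - z\<^sup>2) - u * (s - y\<^sup>2)) < 1"
          by (rule vabs_diff_less[OF z(2)])
        also have "(u * s - z\<^sup>2) - u * (s - y\<^sup>2) = u * y\<^sup>2 - z\<^sup>2"
          by (simp add: algebra_simps)
        finally have "vabs (u * y\<^sup>2 - z\<^sup>2) < 1" .
        moreover have "u * y\<^sup>2 - z\<^sup>2 = y\<^sup>2 * (u - (z / y)\<^sup>2)"
          using square(1) by (auto simp: power_divide right_diff_distrib mult.commute)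
        ultimately have "vabs (u - (z / y)\<^sup>2) < 1"
          using square(1) by (simp add: vabs_mult vabs_power)
        moreover have "vabs (z / y) = 1" using z square by (simp add: vabs_divide)
        ultimately have "\<eta> u = 1" using symbol_square by blast
        then show False using u by simp
      qed
      moreover have "vabs (u * s) = 1" using u True by (simp add: vabs_mult)
      ultimately have "\<eta> (u * s) = - 1"
        by (metis symbol_cases)
      then show ?thesis using square(3) by simp
    next
      case nonsquare
      then show ?thesis using symbol_values[of "u * s"] by auto
    qed
  next
    case False
    then have "vabs s < 1" using s by simp
    then show ?thesis using u by (simp add: symbol_0 vabs_mult)
  qed
  have "(\<Sum>s\<in>R. \<eta> (u * s) + \<eta> s) = 0"
    using sum_R_mult[OF periodic_symbol u(1)] sum_symbol by (simp add: sum.distrib)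
  then have "(\<Sum>s\<in>R. - Re (\<eta> (u * s) + \<eta> s)) = 0"
    by (metis Re_sum neg_equal_0_iff_equal sum_negf zero_complex.simps(1))
  then have 0: "- Re (\<eta> (u * s) + \<eta> s) = 0" if "s \<in> R" for s
    using sum_nonneg_eq_0_iff[OF finite_R, of "\<lambda>s. - Re (\<eta> (u * s) + \<eta> s)"] le R_integral that
    by fastforce
  have v1: "vabs v \<le> 1" using v by simp
  have "vabs (u * (v - rep v)) < 1"
    using rep[OF v1] u by (simp add: vabs_mult)
  then have "\<eta> (u * v) = \<eta> (u * rep v)" "\<eta> v = \<eta> (rep v)"
    using symbol_cong[of v "rep v"] rep[OF v1] by (auto intro!: symbol_cong simp: algebra_simps)
  then have "Re (\<eta> (u * v)) = - Re (\<eta> v)"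
    using 0[OF rep(1)[OF v1]] by simp
  then show ?thesis
    using symbol_values[of "u * v"] symbol_values[of v] by (auto simp: complex_eq_iff)
qed

text \<open>A nonsquare unit in either place is handled by \<open>symbol_mult_nonsquare\<close>, two
  square units by multiplying their roots, and a nonunit makes both sides vanish.\<close>

lemma symbol_mult:
  assumes u: "vabs u \<le> 1" and v: "vabs v \<le> 1"
  shows "\<eta> (u * v) = \<eta> u * \<eta> v"
proof (cases "vabs u = 1 \<and> vabs v = 1")
  case True
  then have u: "vabs u = 1" and v: "vabs v = 1" by auto
  from u show ?thesis
  proof (cases rule: symbol_cases)
    case (square y)
    note y = square
    from v have "\<eta> (u * v) = \<eta> v"
    proof (cases rule: symbol_cases)
      case (square z)
      have "vabs (u * (v - z\<^sup>2)) < 1" "vabs ((u - y\<^sup>2) * z\<^sup>2) < 1"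
        using u y square by (simp_all add: vabs_mult vabs_power)
      then have "vabs (u * (v - z\<^sup>2) + (u - y\<^sup>2) * z\<^sup>2) < 1" by (rule vabs_add_less)
      then have "vabs (u * v - (y * z)\<^sup>2) < 1" by (simp add: algebra_simps power_mult_distrib)
      moreover have "vabs (y * z) = 1" using y square by (simp add: vabs_mult)
      ultimately show ?thesis using symbol_square square(3) by metis
    next
      case nonsquare
      have "\<eta> (v * u) = - 1"
        using symbol_mult_nonsquare[OF v nonsquare(2) u] y(3) by simp
      then show ?thesis using nonsquare(2) by (simp add: mult.commute)
    qed
    then show ?thesis using y(3) by simp
  next
    case nonsquare
    then show ?thesis using symbol_mult_nonsquare[OF u nonsquare(2) v] by simp
  qed
next
  case False
  then have "vabs u < 1 \<or> vabs v < 1" using assms by auto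
  moreover from this have "vabs (u * v) < 1"
    unfolding vabs_mult using assms
    by (metis mult.commute mult_left_le_one_le order_le_less_trans vabs_nonneg)
  ultimately show ?thesis by (auto simp: symbol_0)
qed

subsection \<open>The quadratic Gauss sum\<close>

text \<open>Translating by \<open>y / u\<close> multiplies the sum by
  \<open>\<psi> (y / \<pi>)\<close>, which is not 1 for a suitable \<open>y\<close>.\<close>

lemma sum_char:
  assumes u: "vabs u = 1"
  shows "(\<Sum>r\<in>R. \<psi> (u * r / \<pi>)) = 0"
proof -
  obtain y where y: "vabs y \<le> 1" "\<psi> (y / \<pi>) \<noteq> 1"
    using char_nontrivial by blast
  have u0: "u \<noteq> 0" using u by auto
  have "(\<Sum>r\<in>R. \<psi> (u * r / \<pi>)) = (\<Sum>r\<in>R. \<psi> (u * (y / u + r) / \<pi>))"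
    using u y by (intro sum_R_translate[symmetric] periodic_char) (auto simp: vabs_divide)
  also have "\<dots> = \<psi> (y / \<pi>) * (\<Sum>r\<in>R. \<psi> (u * r / \<pi>))"
    using u0 by (simp add: sum_distrib_left distrib_left add_divide_distrib char_add)
  finally show ?thesis using y(2) by (simp add: mult_cancel_right1)
qed

definition gs :: "'k \<Rightarrow> complex"
  where "gs u = (\<Sum>r\<in>R. \<psi> (u * r\<^sup>2 / \<pi>))"

text \<open>Squares are counted with weight \<open>1 + \<eta> s\<close>, and the part with weight 1
  vanishes by \<open>sum_char\<close>.\<close>

lemma gs_eq:
  assumes u: "vabs u = 1"
  shows "gs u = (\<Sum>s\<in>R. \<eta> s * \<psi> (u * s / \<pi>))"
  using sum_squares[OF periodic_char, of u] u sum_char[OF u]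
  by (simp add: gs_def distrib_right sum.distrib)

lemma gs_symbol:
  assumes u: "vabs u = 1"
  shows "gs u = \<eta> u * gs 1"
proof -
  have "gs u = (\<Sum>s\<in>R. \<eta> u * (\<eta> (u * s) * \<psi> (1 * (u * s) / \<pi>)))"
    unfolding gs_eq[OF u] using u symbol_unit_sq[OF u]
    by (intro sum.cong refl) (simp add: symbol_mult R_integral flip: mult.assoc)
  also have "\<dots> = \<eta> u * (\<Sum>s\<in>R. \<eta> (u * s) * \<psi> (1 * (u * s) / \<pi>))"
    by (simp only: sum_distrib_left)
  also have "(\<Sum>s\<in>R. \<eta> (u * s) * \<psi> (1 * (u * s) / \<pi>)) = (\<Sum>s\<in>R. \<eta> s * \<psi> (1 * s / \<pi>))"
    by (rule sum_R_mult[OF _ u]) (intro periodic_mult periodic_symbol periodic_char, simp)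
  finally show ?thesis by (simp add: gs_eq)
qed

text \<open>After the shift of \<open>x\<close> by \<open>y\<close> the squares of \<open>y\<close>
  cancel, and \<open>y\<close> occurs only in the linear term \<open>2 * x * y\<close>. Summing over
  \<open>y\<close> first kills every unit \<open>x\<close>, since 2 is a unit; the zero class is
  left, with \<open>q\<close> values of \<open>y\<close>.\<close>

lemma gs_mult_gs_minus: "gs 1 * gs (- 1) = q"
proof -
  have per: "periodic (\<lambda>x. \<psi> (x\<^sup>2 / \<pi>))"
    using periodic_square[OF periodic_char[of 1]] by simp
  have r0: "rep 0 \<in> R" "vabs (rep 0) < 1" using rep[of 0] by auto
  have small: "vabs r < 1 \<longleftrightarrow> r = rep 0" if "r \<in> R" for r
    using rep_eq_iff[of r 0] R_integral[OF that] rep_R[OF that] by simp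
  have "gs 1 * gs (- 1) = (\<Sum>y\<in>R. (\<Sum>x\<in>R. \<psi> (x\<^sup>2 / \<pi>)) * \<psi> (- (y\<^sup>2 / \<pi>)))"
    by (simp add: gs_def sum_distrib_left)
  also have "\<dots> = (\<Sum>y\<in>R. (\<Sum>x\<in>R. \<psi> ((y + x)\<^sup>2 / \<pi>)) * \<psi> (- (y\<^sup>2 / \<pi>)))"
    by (intro sum.cong refl arg_cong2[where f = "(*)"] sum_R_translate[OF per, symmetric] R_integral)
  also have "\<dots> = (\<Sum>y\<in>R. \<Sum>x\<in>R. \<psi> (x\<^sup>2 / \<pi>) * \<psi> ((2 * x) * y / \<pi>))"
  proof (intro sum.cong refl, unfold sum_distrib_right, intro sum.cong refl)
    fix y x :: 'k
    have "(y + x)\<^sup>2 / \<pi> + - (y\<^sup>2 / \<pi>) = x\<^sup>2 / \<pi> + (2 * x) * y / \<pi>"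
      by (simp add: power2_sum add_divide_distrib mult_ac)
    then show "\<psi> ((y + x)\<^sup>2 / \<pi>) * \<psi> (- (y\<^sup>2 / \<pi>)) = \<psi> (x\<^sup>2 / \<pi>) * \<psi> ((2 * x) * y / \<pi>)"
      by (simp only: char_add[symmetric])
  qed
  also have "\<dots> = (\<Sum>x\<in>R. \<psi> (x\<^sup>2 / \<pi>) * (\<Sum>y\<in>R. \<psi> ((2 * x) * y / \<pi>)))"
    by (subst sum.swap) (simp only: sum_distrib_left)
  also have "\<dots> = (\<Sum>x\<in>R. if x = rep 0 then of_real q else 0)"
  proof (rule sum.cong[OF refl])
    fix x assume x: "x \<in> R"
    show "\<psi> (x\<^sup>2 / \<pi>) * (\<Sum>y\<in>R. \<psi> ((2 * x) * y / \<pi>)) = (if x = rep 0 then of_real q else 0)"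
    proof (cases "x = rep 0")
      case True
      then have x1: "vabs x < 1" using r0 by simp
      have "vabs (x\<^sup>2) < 1" using x1 by (simp add: vabs_power power_less_one_iff)
      then have "\<psi> (x\<^sup>2 / \<pi>) = 1" by (intro char_integral vabs_divide_unif)
      moreover have "\<psi> ((2 * x) * y / \<pi>) = 1" if "y \<in> R" for y
      proof (intro char_integral vabs_divide_unif)
        show "vabs (2 * x * y) < 1"
          using x1 R_integral[OF that] vabs_2
          by (simp add: vabs_mult) (metis mult.commute mult_left_le_one_le order_le_less_trans vabs_nonneg)
      qed
      then have "(\<Sum>y\<in>R. \<psi> ((2 * x) * y / \<pi>)) = of_nat (card R)" by simp
      moreover have "(of_nat (card R) :: complex) = of_real q"
        by (simp flip: card_R)
      ultimately show ?thesis using True by simp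
    next
      case False
      then have "vabs (2 * x) = 1"
        using small[OF x] R_integral[OF x] vabs_2 by (simp add: vabs_mult)
      then show ?thesis using sum_char False by simp
    qed
  qed
  also have "\<dots> = q" using r0 finite_R by simp
  finally show ?thesis .
qed

lemma gs_square: "(gs 1)\<^sup>2 = \<eta> (- 1) * q"
proof -
  have 1: "vabs (- 1 :: 'k) = 1" by simp
  have "\<eta> (- 1) * (gs 1 * gs (- 1)) = (\<eta> (- 1) * \<eta> (- 1)) * (gs 1)\<^sup>2"
    unfolding gs_symbol[OF 1] by (simp add: power2_eq_square)
  then show ?thesis
    using symbol_unit_sq[OF 1] gs_mult_gs_minus by simp
qed

definition eps :: complex
  where "eps = (THE e. e \<in> {1, - 1, \<i>, - \<i>} \<and> gs 1 = e ^ 3 * of_real (sqrt q))"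

text \<open>The square of the normalized sum \<open>g\<close> is the sign
  \<open>\<eta> (- 1)\<close>, so \<open>g\<close> is a fourth root of unity. Cubing is an
  involution on these, so \<open>g ^ 3\<close> is the only solution and the definite description is
  meaningful.\<close>

lemma eps: "eps \<in> {1, - 1, \<i>, - \<i>}" "gs 1 = eps ^ 3 * of_real (sqrt q)"
proof -
  define g where "g = gs 1 / of_real (sqrt q)"
  have q0: "q > 0" using q_gt_1 by simp
  then have sq: "(complex_of_real (sqrt q))\<^sup>2 = of_real q"
    by (simp flip: of_real_power)
  have gs: "gs 1 = g * of_real (sqrt q)"
    using q0 by (simp add: g_def)
  have "g\<^sup>2 = \<eta> (- 1)"
    using q0 by (simp add: g_def power_divide sq gs_square)
  moreover have "\<eta> (- 1) * \<eta> (- 1) = 1"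
    by (rule symbol_unit_sq) simp
  ultimately have "g\<^sup>2 * g\<^sup>2 = 1" by simp
  moreover have "(g - 1) * (g + 1) * (g - \<i>) * (g + \<i>) = g\<^sup>2 * g\<^sup>2 - 1"
    by (simp add: algebra_simps power2_eq_square)
  ultimately have "(g - 1) * (g + 1) * (g - \<i>) * (g + \<i>) = 0" by simp
  then have g: "g = 1 \<or> g = - 1 \<or> g = \<i> \<or> g = - \<i>"
    by (auto simp: eq_neg_iff_add_eq_0)
  have cube_cube: "(e ^ 3) ^ 3 = e" if "e \<in> {1, - 1, \<i>, - \<i>}" for e :: complex
    using that unfolding power3_eq_cube by auto
  have "\<exists>!e. e \<in> {1, - 1, \<i>, - \<i>} \<and> e ^ 3 = g"
  proof (rule ex1I[of _ "g ^ 3"])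
    show "g ^ 3 \<in> {1, - 1, \<i>, - \<i>} \<and> (g ^ 3) ^ 3 = g"
      using g unfolding power3_eq_cube by auto
    show "e = g ^ 3" if "e \<in> {1, - 1, \<i>, - \<i>} \<and> e ^ 3 = g" for e
      using that cube_cube[of e] by metis
  qed
  moreover have "gs 1 = e ^ 3 * of_real (sqrt q) \<longleftrightarrow> e ^ 3 = g" for e
    using q0 by (auto simp: gs)
  ultimately have "\<exists>!e. e \<in> {1, - 1, \<i>, - \<i>} \<and> gs 1 = e ^ 3 * of_real (sqrt q)" by simp
  from theI'[OF this] show "eps \<in> {1, - 1, \<i>, - \<i>}" "gs 1 = eps ^ 3 * of_real (sqrt q)"
    unfolding eps_def by blast+
qed

lemma eps_fourth_power: "eps ^ 4 = 1"
  using eps(1) by (auto simp: power4_eq_xxxx)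

text \<open>Squaring \<open>gs 1\<close> produces \<open>eps ^ 6\<close>, and
  \<open>eps ^ 4 = 1\<close>. This later turns a sign inside the residue symbol into a power of
  \<open>eps\<close>.\<close>

lemma eps_square: "eps\<^sup>2 = \<eta> (- 1)"
proof -
  have "(eps ^ 3 * of_real (sqrt q))\<^sup>2 = \<eta> (- 1) * q"
    using gs_square eps(2) by simp
  then have "eps ^ 6 * of_real q = \<eta> (- 1) * of_real q"
    using q_gt_1 by (simp add: power_mult_distrib flip: power_mult of_real_power)
  then have "eps ^ 6 = \<eta> (- 1)" using q_gt_1 by simp
  moreover have "eps ^ 6 = eps ^ 4 * eps\<^sup>2" by (simp flip: power_add)
  ultimately show ?thesis by (simp add: eps_fourth_power)
qed

end


section \<open>Integrals of quadratic characters\<close>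

context gauss_field
begin

lemma lc_bounded_char_quadratic: "lc_bounded (\<lambda>x. \<psi> (\<alpha> * x\<^sup>2 + \<beta> * x + \<gamma>))"
  unfolding lc_bounded_def
proof (intro conjI allI)
  fix x :: 'k
  \<comment> \<open>\<open>M\<close> bounds the cofactor \<open>\<alpha> * (x + y) + \<beta>\<close>
    of \<open>y - x\<close> in the difference of the two arguments, as long as \<open>y\<close> is
    closer than 1 to \<open>x\<close>; the summand 1 keeps it positive.\<close>
  define M where "M = vabs \<alpha> * max (vabs x) 1 + vabs \<beta> + 1"
  have M: "M > 0" by (auto simp: M_def intro!: add_nonneg_pos)
  have "\<psi> (\<alpha> * y\<^sup>2 + \<beta> * y + \<gamma>) = \<psi> (\<alpha> * x\<^sup>2 + \<beta> * x + \<gamma>)" if y: "vabs (y - x) < min 1 (1 / M)" for y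
  proof (rule char_cong)
    have eq: "\<alpha> * y\<^sup>2 + \<beta> * y + \<gamma> - (\<alpha> * x\<^sup>2 + \<beta> * x + \<gamma>) = (y - x) * (\<alpha> * (2 * x + (y - x)) + \<beta>)"
      by (simp add: algebra_simps power2_eq_square)
    have "vabs (2 * x + (y - x)) \<le> max (vabs x) 1"
      using y vabs_2 by (intro vabs_add_le) (auto simp: vabs_mult)
    then have "vabs \<alpha> * vabs (2 * x + (y - x)) \<le> vabs \<alpha> * max (vabs x) 1"
      by (intro mult_left_mono) auto
    moreover have "0 \<le> vabs \<alpha> * max (vabs x) 1" by simp
    ultimately have "vabs (\<alpha> * (2 * x + (y - x)) + \<beta>) \<le> M"
    proof (intro vabs_add_le)
      show "vabs (\<alpha> * (2 * x + (y - x))) \<le> M"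
        unfolding M_def vabs_mult[of \<alpha>]
        using \<open>vabs \<alpha> * vabs (2 * x + (y - x)) \<le> _\<close> vabs_nonneg[of \<beta>] by linarith
      show "vabs \<beta> \<le> M"
        unfolding M_def using \<open>0 \<le> vabs \<alpha> * max (vabs x) 1\<close> by linarith
    qed
    then have "vabs (y - x) * vabs (\<alpha> * (2 * x + (y - x)) + \<beta>) \<le> 1 / M * M"
      using y M by (intro mult_mono) auto
    then show "vabs (\<alpha> * y\<^sup>2 + \<beta> * y + \<gamma> - (\<alpha> * x\<^sup>2 + \<beta> * x + \<gamma>)) \<le> 1"
      using M unfolding eq vabs_mult by simp
  qed
  moreover have "min 1 (1 / M) > 0" using M by simp
  ultimately show "\<exists>e>0. \<forall>y. vabs (y - x) < e \<longrightarrow>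
      \<psi> (\<alpha> * y\<^sup>2 + \<beta> * y + \<gamma>) = \<psi> (\<alpha> * x\<^sup>2 + \<beta> * x + \<gamma>)" by blast
qed (simp add: norm_char, blast)

lemma lc_bounded_char_square: "lc_bounded (\<lambda>x. \<psi> (\<alpha> * x\<^sup>2))"
  using lc_bounded_char_quadratic[of \<alpha> 0 0] by simp

lemma lc_bounded_char_linear: "lc_bounded (\<lambda>x. \<psi> (\<beta> * x))"
  using lc_bounded_char_quadratic[of 0 \<beta> 0] by simp

lemma lc_bounded_symbol: "lc_bounded \<eta>"
  unfolding lc_bounded_def
proof (intro conjI allI)
  show "\<exists>e>0. \<forall>y. vabs (y - x) < e \<longrightarrow> \<eta> y = \<eta> x" for x :: 'k
    using symbol_cong zero_less_one by blast
  show "\<exists>B. \<forall>x::'k. norm (\<eta> x) \<le> B"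
    using symbol_values by (intro exI[of _ 1] allI) (metis insert_iff norm_minus_cancel norm_one norm_zero
        order_refl singletonD zero_le_one)
qed

text \<open>A shift by \<open>y / (\<pi> \<beta>)\<close> multiplies the integrand by a nontrivial constant.\<close>

lemma J_char_vanish:
  assumes "1 < vabs \<beta>" and "vabs \<alpha> < vabs \<beta>"
  shows "J (\<lambda>x. \<psi> (\<alpha> * x\<^sup>2 + \<beta> * x)) = 0"
proof -
  obtain y0 where y0: "vabs y0 \<le> 1" "\<psi> (y0 / \<pi>) \<noteq> 1"
    using char_nontrivial by blast
  have b0: "\<beta> \<noteq> 0" "0 < vabs \<beta>" using assms(1) by auto
  define y where "y = y0 / (\<pi> * \<beta>)"
  have "vabs (1 / \<beta>) < 1" "vabs (\<alpha> / \<beta>) < 1"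
    using assms b0 by (simp_all add: vabs_divide)
  then have le: "vabs (1 / \<beta> / \<pi>) \<le> 1" "vabs (\<alpha> / \<beta> / \<pi>) \<le> 1"
    using vabs_divide_unif by blast+
  have y_le: "vabs y \<le> 1"
  proof -
    have "vabs y = vabs y0 * vabs (1 / \<beta> / \<pi>)" by (simp add: y_def vabs_divide vabs_mult mult.commute)
    then show ?thesis using le y0 by (simp only: mult_le_one vabs_nonneg)
  qed
  \<comment> \<open>The strict inequality between \<open>vabs \<alpha>\<close> and
    \<open>vabs \<beta>\<close> compensates the \<open>\<pi>\<close> in the denominator of
    \<open>y\<close>; hence the quadratic error \<open>\<alpha> * y * (2 * x + y)\<close> of the
    shift is integral.\<close>
  have ay_le: "vabs (\<alpha> * y) \<le> 1"
  proof -
    have "vabs (\<alpha> * y) = vabs y0 * vabs (\<alpha> / \<beta> / \<pi>)" by (simp add: y_def vabs_divide vabs_mult mult.commute)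
    then show ?thesis using le y0 by (simp only: mult_le_one vabs_nonneg)
  qed
  let ?f = "\<lambda>x. \<psi> (\<alpha> * x\<^sup>2 + \<beta> * x)"
  have f: "lc_bounded ?f"
    using lc_bounded_char_quadratic[of \<alpha> \<beta> 0] by simp
  have "J ?f = J (\<lambda>x. ?f (y + x))"
    by (rule J_translate[OF f y_le, symmetric])
  also have "\<dots> = J (\<lambda>x. \<psi> (y0 / \<pi>) * ?f x)"
  proof (rule J_cong)
    fix x :: 'k assume x: "vabs x \<le> 1"
    have "\<alpha> * (y + x)\<^sup>2 + \<beta> * (y + x) - (\<beta> * y + (\<alpha> * x\<^sup>2 + \<beta> * x)) = \<alpha> * y * (2 * x + y)"
      by (simp add: algebra_simps power2_eq_square)
    moreover have "vabs (2 * x + y) \<le> 1"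
      using x y_le vabs_2 by (intro vabs_add_le) (auto simp: vabs_mult)
    then have "vabs (\<alpha> * y * (2 * x + y)) \<le> 1"
      using ay_le unfolding vabs_mult[of "\<alpha> * y"] by (intro mult_le_one) auto
    ultimately have "?f (y + x) = \<psi> (\<beta> * y + (\<alpha> * x\<^sup>2 + \<beta> * x))"
      by (intro char_cong) simp
    moreover have "\<beta> * y = y0 / \<pi>" using b0 by (simp add: y_def)
    ultimately show "?f (y + x) = \<psi> (y0 / \<pi>) * ?f x" by (simp only: char_add)
  qed
  also have "\<dots> = \<psi> (y0 / \<pi>) * J ?f" by (rule J_cmult)
  finally show ?thesis using y0(2) by (simp add: mult_cancel_right1)
qed

lemma J_char_linear_vanish: "1 < vabs \<beta> \<Longrightarrow> J (\<lambda>x. \<psi> (\<beta> * x)) = 0"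
  using J_char_vanish[of \<beta> 0] by (cases "\<beta> = 0") simp_all

lemma J_char_trivial:
  assumes "\<And>x. vabs x \<le> 1 \<Longrightarrow> vabs (f x) \<le> 1"
  shows "J (\<lambda>x. \<psi> (f x)) = 1"
proof -
  have "J (\<lambda>x. \<psi> (f x)) = J (\<lambda>_. 1)"
    by (rule J_cong) (simp add: char_integral assms)
  then show ?thesis by (simp add: J_const)
qed

text \<open>On the coset of a unit \<open>r\<close> the linear term
  \<open>2 * a * r * \<pi> * z\<close> has a nonintegral coefficient, as \<open>s\<close> is at
  least 2, and dominates the quadratic term, so the integral vanishes. Only the zero class
  contributes.\<close>

lemma J_char_square_rec:
  assumes a: "vabs a = w powi (- s)" and s: "2 \<le> s"
  shows "J (\<lambda>x. \<psi> (a * x\<^sup>2)) = 1 / q * J (\<lambda>x. \<psi> (a * \<pi>\<^sup>2 * x\<^sup>2))"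
proof -
  let ?J = "J (\<lambda>x. \<psi> (a * \<pi>\<^sup>2 * x\<^sup>2))"
  have r0: "rep 0 \<in> R" "vabs (rep 0) < 1" using rep[of 0] by auto
  have "J (\<lambda>z. \<psi> (a * (r + \<pi> * z)\<^sup>2)) = (if r = rep 0 then ?J else 0)" if r: "r \<in> R" for r
  proof (cases "r = rep 0")
    case True
    then have r1: "vabs (r / \<pi>) \<le> 1" using r0 by (intro vabs_divide_unif) simp
    \<comment> \<open>The chosen representative of the zero class need not be 0, but it is
      \<open>\<pi>\<close> times an integral element, which a translation absorbs.\<close>
    have "r + \<pi> * z = \<pi> * (r / \<pi> + z)" for z by (simp add: field_simps)
    then have "J (\<lambda>z. \<psi> (a * (r + \<pi> * z)\<^sup>2)) = J (\<lambda>z. \<psi> (a * \<pi>\<^sup>2 * (r / \<pi> + z)\<^sup>2))"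
      by (simp add: power_mult_distrib mult.assoc)
    also have "\<dots> = ?J"
      by (rule J_translate[OF lc_bounded_char_square r1])
    finally show ?thesis using True by simp
  next
    case False
    then have r1: "vabs r = 1"
      using rep_eq_iff[of r 0] R_integral[OF r] rep_R[OF r] by simp
    have "a * (r + \<pi> * z)\<^sup>2 = a * r\<^sup>2 + (a * \<pi>\<^sup>2 * z\<^sup>2 + 2 * a * r * \<pi> * z)" for z
      by (simp add: algebra_simps power2_eq_square)
    then have "J (\<lambda>z. \<psi> (a * (r + \<pi> * z)\<^sup>2)) = \<psi> (a * r\<^sup>2) * J (\<lambda>z. \<psi> (a * \<pi>\<^sup>2 * z\<^sup>2 + 2 * a * r * \<pi> * z))"
      by (simp only: char_add[of "a * r\<^sup>2"] J_cmult)
    also have "J (\<lambda>z. \<psi> (a * \<pi>\<^sup>2 * z\<^sup>2 + 2 * a * r * \<pi> * z)) = 0"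
    proof (rule J_char_vanish)
      have 1: "vabs (2 * a * r * \<pi>) = w powi (- s + 1)"
        using w_pos power_int_add_1[of w "- s"] by (simp only: vabs_mult vabs_2 r1 a) simp
      have 2: "vabs (a * \<pi>\<^sup>2) = w powi (- s + 2)"
        using w_pos by (subst power_int_add) (simp_all add: vabs_mult vabs_power a)
      show "1 < vabs (2 * a * r * \<pi>)"
        unfolding 1 using w_powi_less_iff[of 0 "- s + 1"] s by simp
      show "vabs (a * \<pi>\<^sup>2) < vabs (2 * a * r * \<pi>)"
        unfolding 1 2 w_powi_less_iff by simp
    qed
    finally show ?thesis using False by simp
  qed
  then show ?thesis
    using r0 finite_R by (simp add: J_cosets[OF lc_bounded_char_square])
qed

text \<open>The case \<open>s = 1\<close> is a Gauss sum divided by \<open>q\<close>, and each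
  double step contributes \<open>1 / q\<close>. The argument \<open>a * \<pi> ^ s\<close> of the
  symbol is the unit part of \<open>a\<close>; it does not change when \<open>a\<close> is
  multiplied by \<open>\<pi>\<^sup>2\<close> and \<open>s\<close> is lowered by 2.\<close>

lemma J_char_square:
  assumes "vabs a = w powi (- int s)"
  shows "J (\<lambda>x. \<psi> (a * x\<^sup>2)) =
    of_real (q powr (- real s / 2)) * (if odd s then \<eta> (a * \<pi> ^ s) * eps ^ 3 else 1)"
  using assms
proof (induction s arbitrary: a rule: induct_nat_012)
  case 0
  then have "J (\<lambda>x. \<psi> (a * x\<^sup>2)) = 1"
    by (intro J_char_trivial) (simp add: vabs_mult vabs_power power_le_one)
  then show ?case using q_gt_1 by simp
next
  case 1
  have q: "q > 0" using q_gt_1 by simp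
  define u where "u = a * \<pi>"
  have u: "vabs u = 1" and a: "a = u / \<pi>"
    using 1 w_pos by (simp_all add: u_def vabs_mult power_int_minus)
  have "J (\<lambda>x. \<psi> (a * x\<^sup>2)) = 1 / q * (\<Sum>r\<in>R. \<psi> (a * r\<^sup>2))"
  proof (rule J_periodic[OF lc_bounded_char_square])
    show "\<psi> (a * y\<^sup>2) = \<psi> (a * x\<^sup>2)" if "vabs x \<le> 1" "vabs (y - x) < 1" for x y
      using periodicD[OF periodic_square[OF periodic_char[of u]] that] u by (simp add: a)
  qed
  also have "(\<Sum>r\<in>R. \<psi> (a * r\<^sup>2)) = gs u"
    by (simp add: gs_def a)
  also have "gs u = \<eta> u * (eps ^ 3 * of_real (sqrt q))"
    using gs_symbol[OF u] eps(2) by simp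
  finally have "J (\<lambda>x. \<psi> (a * x\<^sup>2)) = of_real (sqrt q / q) * (\<eta> u * eps ^ 3)"
    by simp
  also have "sqrt q / q = q powr (- 1 / 2)"
    using q by (simp add: powr_minus powr_half_sqrt real_div_sqrt field_simps)
  finally show ?case by (simp add: u_def)
next
  case (ge2 s)
  have "vabs (a * \<pi>\<^sup>2) = w powi (- int s)"
  proof -
    have "vabs (a * \<pi>\<^sup>2) = w powi (- int (Suc (Suc s))) * w powi 2"
      by (simp only: vabs_mult vabs_power ge2(3) power_int_numeral)
    also have "\<dots> = w powi (- int s)"
      using w_pos by (subst power_int_add[symmetric]) simp_all
    finally show ?thesis .
  qed
  then have IH: "J (\<lambda>x. \<psi> (a * \<pi>\<^sup>2 * x\<^sup>2)) =
      of_real (q powr (- real s / 2)) * (if odd s then \<eta> (a * \<pi>\<^sup>2 * \<pi> ^ s) * eps ^ 3 else 1)"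
    by (rule ge2(1))
  have "1 / q * q powr (- real s / 2) = q powr (- 1) * q powr (- real s / 2)"
    using q_gt_1 by (simp add: powr_minus field_simps)
  also have "\<dots> = q powr (- 1 + - real s / 2)"
    by (rule powr_add[symmetric])
  also have "- 1 + - real s / 2 = - real (Suc (Suc s)) / 2"
    by (simp add: field_simps)
  finally have pw: "1 / q * q powr (- real s / 2) = q powr (- real (Suc (Suc s)) / 2)" .
  have "J (\<lambda>x. \<psi> (a * x\<^sup>2)) = of_real (1 / q) * J (\<lambda>x. \<psi> (a * \<pi>\<^sup>2 * x\<^sup>2))"
    using J_char_square_rec[OF ge2(3)] by simp
  also have "\<dots> = of_real (1 / q * q powr (- real s / 2)) *
      (if odd s then \<eta> (a * \<pi>\<^sup>2 * \<pi> ^ s) * eps ^ 3 else 1)"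
    unfolding IH by (simp only: of_real_mult mult.assoc)
  finally show ?case
    unfolding pw by (simp add: power2_eq_square mult.assoc)
qed

text \<open>The hypothesis \<open>vabs c \<le> vabs b\<close> makes the shift
  \<open>c / (2 * b)\<close> integral, so that it preserves the ring of integers. The unit part of
  \<open>\<sigma> * b\<close> is written as that of \<open>\<sigma>\<close> times that of
  \<open>b\<close>, since only the former varies over a shell.\<close>

lemma J_char_completed_square:
  assumes b: "vabs b = w powi tb" and c: "vabs c \<le> vabs b" and \<sigma>: "vabs \<sigma> = w powi (- t)"
  shows "J (\<lambda>x. \<psi> (\<sigma> * (b * x\<^sup>2 + c * x))) = \<psi> (- \<sigma> * (c\<^sup>2 / (4 * b))) *
    (if tb < t then of_real (q powr (of_int (tb - t) / 2)) *
       (if odd (tb - t) then \<eta> (\<sigma> * \<pi> powi t * (\<pi> powi (- tb) * b)) * eps ^ 3 else 1) else 1)"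
proof -
  have b0: "b \<noteq> 0" using b w_powi_pos[of tb] by auto
  have y: "vabs (c / (2 * b)) \<le> 1"
    using c b0 vabs_2 by (simp add: vabs_divide vabs_mult)
  have "\<sigma> * (b * x\<^sup>2 + c * x) = - \<sigma> * (c\<^sup>2 / (4 * b)) + \<sigma> * b * (c / (2 * b) + x)\<^sup>2" for x
    using b0 by (simp add: power2_eq_square field_simps)
  then have "J (\<lambda>x. \<psi> (\<sigma> * (b * x\<^sup>2 + c * x))) =
      \<psi> (- \<sigma> * (c\<^sup>2 / (4 * b))) * J (\<lambda>x. \<psi> (\<sigma> * b * (c / (2 * b) + x)\<^sup>2))"
    by (simp only: char_add J_cmult)
  also have "J (\<lambda>x. \<psi> (\<sigma> * b * (c / (2 * b) + x)\<^sup>2)) = J (\<lambda>x. \<psi> (\<sigma> * b * x\<^sup>2))"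
    by (rule J_translate[OF lc_bounded_char_square y])
  also have "\<dots> = (if tb < t then of_real (q powr (of_int (tb - t) / 2)) *
       (if odd (tb - t) then \<eta> (\<sigma> * \<pi> powi t * (\<pi> powi (- tb) * b)) * eps ^ 3 else 1) else 1)"
  proof (cases "tb < t")
    case True
    define s where "s = nat (t - tb)"
    have s: "int s = t - tb" using True by (simp add: s_def)
    have "vabs (\<sigma> * b) = w powi (- int s)"
      using b \<sigma> w_pos by (simp add: vabs_mult s flip: power_int_add)
    note J_char_square[OF this]
    moreover have "- real s / 2 = of_int (tb - t) / 2"
      using s by (metis minus_diff_eq of_int_minus of_int_of_nat_eq)
    moreover have "odd s \<longleftrightarrow> odd (tb - t)"
      using s by (metis dvd_minus_iff even_of_nat minus_diff_eq)
    moreover have "\<pi> ^ s = \<pi> powi t * \<pi> powi (- tb)"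
      by (simp add: s flip: power_int_of_nat power_int_add)
    ultimately have "J (\<lambda>x. \<psi> (\<sigma> * b * x\<^sup>2)) = of_real (q powr (of_int (tb - t) / 2)) *
        (if odd (tb - t) then \<eta> (\<sigma> * b * (\<pi> powi t * \<pi> powi (- tb))) * eps ^ 3 else 1)"
      by (simp only:)
    moreover have "\<sigma> * b * (\<pi> powi t * \<pi> powi (- tb)) = \<sigma> * \<pi> powi t * (\<pi> powi (- tb) * b)"
      by (simp only: mult_ac)
    ultimately show ?thesis using True by (simp only: if_True)
  next
    case False
    then have "w powi (- t + tb) \<le> w powi 0"
      by (intro w_powi_le_iff[THEN iffD2]) simp
    moreover have "vabs (\<sigma> * b) = w powi (- t + tb)"
      using b \<sigma> w_pos by (subst power_int_add) (simp_all add: vabs_mult)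
    ultimately have "vabs (\<sigma> * b) \<le> 1" by simp
    then have "J (\<lambda>x. \<psi> (\<sigma> * b * x\<^sup>2)) = 1"
      by (intro J_char_trivial) (metis mult_le_one power_le_one vabs_mult vabs_nonneg vabs_power)
    then show ?thesis using False by simp
  qed
  finally show ?thesis .
qed

lemma J_char_dominant_linear:
  assumes c: "vabs c = w powi tc" and b: "vabs b < vabs c" and \<sigma>: "vabs \<sigma> = w powi (- t)"
  shows "J (\<lambda>x. \<psi> (\<sigma> * (b * x\<^sup>2 + c * x))) = of_bool (t \<le> tc)"
proof -
  have eq: "\<sigma> * (b * x\<^sup>2 + c * x) = \<sigma> * b * x\<^sup>2 + \<sigma> * c * x" for x
    by (simp add: algebra_simps)
  have sc: "vabs (\<sigma> * c) = w powi (tc - t)"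
    using w_pos by (simp add: vabs_mult c \<sigma> flip: power_int_add)
  have sb: "vabs (\<sigma> * b) < vabs (\<sigma> * c)"
    using b \<sigma> w_pos by (simp add: vabs_mult)
  show ?thesis
  proof (cases "t \<le> tc")
    case True
    then have "vabs (\<sigma> * c) \<le> 1"
      unfolding sc using w_powi_le_iff[of "tc - t" 0] by simp
    moreover from this have "vabs (\<sigma> * b) \<le> 1" using sb by simp
    ultimately have "J (\<lambda>x. \<psi> (\<sigma> * b * x\<^sup>2 + \<sigma> * c * x)) = 1"
      by (intro J_char_trivial vabs_add_le)
        (metis mult_le_one power_le_one vabs_mult vabs_nonneg vabs_power)+
    then show ?thesis using True by (simp add: eq)
  next
    case False
    then have "1 < vabs (\<sigma> * c)"
      unfolding sc using w_powi_less_iff[of 0 "tc - t"] by simp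
    then show ?thesis using False J_char_vanish[OF _ sb] by (simp add: eq)
  qed
qed

subsection \<open>Integrals over the units\<close>

text \<open>The part of a shell integral that depends on \<open>nn\<close>: \<open>m\<close> will be
  the number of indices in \<open>L\<close>, and \<open>a\<close> the rescaled negative of
  \<open>nn\<close>.\<close>

definition unit_integral :: "nat \<Rightarrow> 'k \<Rightarrow> complex"
  where "unit_integral m a = J (\<lambda>v. of_bool (vabs v = 1) * (\<eta> v ^ m * \<psi> (a * v)))"

lemma lc_bounded_unit_integrand: "lc_bounded (\<lambda>v. of_bool (vabs v = 1) * (\<eta> v ^ m * \<psi> (a * v)))"
  by (intro lc_bounded_mult lc_bounded_of_bool_unit lc_bounded_power lc_bounded_symbol
      lc_bounded_char_linear)

lemma unit_close: "vabs (y - x) < 1 \<Longrightarrow> vabs y = 1 \<longleftrightarrow> vabs x = 1"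
  using vabs_eq_of_close[of y x] vabs_eq_of_close[of x y] vabs_minus_commute[of x y] by auto

lemma unit_symbol_power:
  "of_bool (vabs v = 1) * \<eta> v ^ m = (if even m then of_bool (vabs v = 1) else of_bool (vabs v = 1) * \<eta> v)"
proof (cases "vabs v = 1")
  case True
  then have "\<eta> v = 1 \<or> \<eta> v = - 1" by (rule symbol_cases) auto
  then show ?thesis by auto
qed simp

text \<open>Up to this bound on \<open>a\<close> the integrand depends only on the residue class.
  Restriction to the units removes the zero class: this is the \<open>- 1\<close> of the even case,
  while in the odd case the symbol vanishes there anyway.\<close>

lemma unit_integral_periodic:
  assumes "vabs a \<le> 1 / w"
  shows "unit_integral m a = 1 / q * (if even m then (\<Sum>r\<in>R. \<psi> (a * r)) - 1 else (\<Sum>r\<in>R. \<eta> r * \<psi> (a * r)))"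
proof -
  define u where "u = a * \<pi>"
  have u: "vabs u \<le> 1" and a: "a = u / \<pi>"
    using assms w_pos by (simp_all add: u_def vabs_mult field_simps)
  have r0: "rep 0 \<in> R" "vabs (rep 0) < 1" using rep[of 0] by auto
  have small: "vabs r = 1 \<longleftrightarrow> r \<noteq> rep 0" if "r \<in> R" for r
    using rep_eq_iff[of r 0] R_integral[OF that] rep_R[OF that] by auto
  have "unit_integral m a = 1 / q * (\<Sum>r\<in>R. of_bool (vabs r = 1) * (\<eta> r ^ m * \<psi> (a * r)))"
    unfolding unit_integral_def
  proof (rule J_periodic[OF lc_bounded_unit_integrand])
    fix x y :: 'k assume xy: "vabs x \<le> 1" "vabs (y - x) < 1"
    show "of_bool (vabs y = 1) * (\<eta> y ^ m * \<psi> (a * y)) = of_bool (vabs x = 1) * (\<eta> x ^ m * \<psi> (a * x))"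
      using periodicD[OF periodic_char[OF u] xy] symbol_cong[OF xy(2)] unit_close[OF xy(2)]
      by (simp add: a)
  qed
  also have "(\<Sum>r\<in>R. of_bool (vabs r = 1) * (\<eta> r ^ m * \<psi> (a * r))) =
      (\<Sum>r\<in>R. (of_bool (vabs r = 1) * \<eta> r ^ m) * \<psi> (a * r))"
    by (simp only: mult.assoc)
  also have "\<dots> = (if even m then (\<Sum>r\<in>R. \<psi> (a * r)) - 1 else (\<Sum>r\<in>R. \<eta> r * \<psi> (a * r)))"
  proof (cases "even m")
    case True
    have "vabs (u * rep 0) < 1"
      using u r0(2) by (simp add: vabs_mult mult_less_1_iff)
    then have "\<psi> (a * rep 0) = 1"
      using char_integral[OF vabs_divide_unif] by (simp add: a)
    moreover have "(\<Sum>r\<in>R. (of_bool (vabs r = 1) * \<eta> r ^ m) * \<psi> (a * r)) =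
        (\<Sum>r\<in>R - {rep 0}. \<psi> (a * r))"
      unfolding unit_symbol_power using True small finite_R
      by (intro sum.mono_neutral_cong_right) auto
    ultimately show ?thesis
      using True r0 finite_R by (simp add: sum_diff1)
  next
    case False
    have "of_bool (vabs r = 1) * \<eta> r = \<eta> r" if "r \<in> R" for r
      using R_integral[OF that] by (cases "vabs r = 1") (auto simp: symbol_0)
    then show ?thesis
      unfolding unit_symbol_power using False by (auto intro!: sum.cong)
  qed
  finally show ?thesis .
qed

lemma unit_integral_trivial:
  assumes "vabs a \<le> 1"
  shows "unit_integral m a = (if even m then 1 - 1 / q else 0)"
proof -
  have "w \<le> 1" using w_less_1 by simp
  then have "1 \<le> 1 / w" using w_pos by simp
  then have "vabs a \<le> 1 / w" using assms by linarith
  note 1 = unit_integral_periodic[OF this, of m]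
  have char_1: "\<psi> (a * r) = 1" if "r \<in> R" for r
    using R_integral[OF that] assms by (intro char_integral) (simp add: vabs_mult mult_le_one)
  have "(of_nat (card R) :: complex) = of_real q" by (simp flip: card_R)
  then have "(\<Sum>r\<in>R. \<psi> (a * r)) = of_real q" using char_1 by simp
  moreover have "(\<Sum>r\<in>R. \<eta> r * \<psi> (a * r)) = 0" using char_1 sum_symbol by simp
  ultimately show ?thesis
    unfolding 1 using q_gt_1 by (simp add: diff_divide_distrib)
qed

text \<open>Here \<open>eps\<close> appears to the first power although \<open>gs 1\<close> carries
  its cube: the sign of \<open>- u\<close> contributes \<open>\<eta> (- 1) = eps\<^sup>2\<close>,
  and \<open>eps ^ 5 = eps\<close>.\<close>

lemma unit_integral_conductor:
  assumes u: "vabs u = 1"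
  shows "unit_integral m (- u / \<pi>) =
    (if even m then - (1 / q) else eps * \<eta> u * of_real (q powr (- 1 / 2)))"
proof -
  have mu: "vabs (- u) = 1" using u by simp
  have "vabs (- u / \<pi>) \<le> 1 / w" using u by (simp add: vabs_divide)
  note 1 = unit_integral_periodic[OF this, of m]
  have even: "(\<Sum>r\<in>R. \<psi> (- u / \<pi> * r)) = 0"
    using sum_char[OF mu] by simp
  have odd: "(\<Sum>r\<in>R. \<eta> r * \<psi> (- u / \<pi> * r)) = gs (- u)"
    using gs_eq[OF mu] by simp
  have "\<eta> (- u) = \<eta> (- 1) * \<eta> u"
    using symbol_mult[of "- 1" u] u by simp
  then have "gs (- u) = eps\<^sup>2 * \<eta> u * (eps ^ 3 * of_real (sqrt q))"
    using gs_symbol[OF mu] eps(2) by (simp add: eps_square)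
  also have "\<dots> = (eps ^ 4 * eps) * \<eta> u * of_real (sqrt q)"
    by (simp add: power_numeral_reduce)
  finally have gs: "gs (- u) = eps * \<eta> u * of_real (sqrt q)"
    by (simp add: eps_fourth_power)
  have "sqrt q / q = q powr (- 1 / 2)"
    using q_gt_1 by (simp add: powr_minus powr_half_sqrt real_div_sqrt field_simps)
  then have "of_real (sqrt q) / of_real q = complex_of_real (q powr (- 1 / 2))"
    by (metis of_real_divide)
  moreover have "1 / of_real q * (eps * \<eta> u * of_real (sqrt q)) =
      eps * \<eta> u * (of_real (sqrt q) / of_real q)" by simp
  ultimately show ?thesis
    unfolding 1 even odd gs by simp
qed

text \<open>On each coset \<open>r + \<pi> * z\<close> the symbol and the unit condition are
  constant, while \<open>\<psi> (a * \<pi> * z)\<close> is still nontrivial in \<open>z\<close> and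
  integrates to 0.\<close>

lemma unit_integral_vanish:
  assumes a: "1 / w < vabs a"
  shows "unit_integral m a = 0"
proof -
  have "vabs (a * \<pi>) > 1"
    using a w_pos by (simp add: vabs_mult field_simps)
  note 0 = J_char_linear_vanish[OF this]
  have "J (\<lambda>z. of_bool (vabs (r + \<pi> * z) = 1) * (\<eta> (r + \<pi> * z) ^ m * \<psi> (a * (r + \<pi> * z)))) = 0"
    if "r \<in> R" for r
  proof -
    have "J (\<lambda>z. of_bool (vabs (r + \<pi> * z) = 1) * (\<eta> (r + \<pi> * z) ^ m * \<psi> (a * (r + \<pi> * z)))) =
        J (\<lambda>z. (of_bool (vabs r = 1) * \<eta> r ^ m * \<psi> (a * r)) * \<psi> (a * \<pi> * z))"
    proof (rule J_cong)
      fix z :: 'k assume "vabs z \<le> 1"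
      then have "vabs (\<pi> * z) < 1"
        using w_less_1 w_pos by (simp add: vabs_mult mult_less_1_iff)
      then have close: "vabs (r + \<pi> * z - r) < 1" by simp
      have "a * (r + \<pi> * z) = a * r + a * \<pi> * z" by (simp add: algebra_simps)
      then show "of_bool (vabs (r + \<pi> * z) = 1) * (\<eta> (r + \<pi> * z) ^ m * \<psi> (a * (r + \<pi> * z))) =
          (of_bool (vabs r = 1) * \<eta> r ^ m * \<psi> (a * r)) * \<psi> (a * \<pi> * z)"
        using symbol_cong[OF close] unit_close[OF close] by (simp add: char_add)
    qed
    also have "\<dots> = 0" by (simp only: J_cmult 0 mult_zero_right)
    finally show ?thesis .
  qed
  then show ?thesis
    unfolding unit_integral_def by (simp add: J_cosets[OF lc_bounded_unit_integrand])
qed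

subsection \<open>Integration over a product\<close>

lemma integral_PiE_prod:
  assumes "finite I" and f: "\<And>i. i \<in> I \<Longrightarrow> lc_bounded (f i)"
  shows "(LINT x:(I \<rightarrow>\<^sub>E int_ring)|(Pi\<^sub>M I (\<lambda>_. \<mu>)). \<Prod>i\<in>I. f i (x i)) = (\<Prod>i\<in>I. J (f i))"
proof -
  interpret product_sigma_finite "\<lambda>_. \<mu>"
    by (rule product_sigma_finite.intro) (rule sigma_finite_measure_axioms)
  let ?g = "\<lambda>i x. indicat_real (cball 0 1) x *\<^sub>R f i x"
  have "indicat_real (I \<rightarrow>\<^sub>E int_ring) x *\<^sub>R (\<Prod>i\<in>I. f i (x i)) = (\<Prod>i\<in>I. ?g i (x i))"
    if "x \<in> space (Pi\<^sub>M I (\<lambda>_. \<mu>))" for x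
  proof (cases "x \<in> I \<rightarrow>\<^sub>E int_ring")
    case True
    then have "\<forall>i\<in>I. x i \<in> cball 0 1" by (auto simp: int_ring_cball)
    then show ?thesis using True by simp
  next
    case False
    \<comment> \<open>Points of the product space are extensional, so one outside the box must leave
      it at a coordinate in \<open>I\<close>.\<close>
    moreover have "x \<in> extensional I" using that by (simp add: space_PiM PiE_def)
    ultimately obtain i where "i \<in> I" "x i \<notin> cball 0 1"
      by (auto simp: PiE_def Pi_def int_ring_cball)
    then have "(\<Prod>i\<in>I. ?g i (x i)) = 0"
      using assms(1) by (intro prod_zero bexI[of _ i]) (simp_all add: indicator_def)
    then show ?thesis using False by simp
  qed
  then have "(LINT x:(I \<rightarrow>\<^sub>E int_ring)|(Pi\<^sub>M I (\<lambda>_. \<mu>)). \<Prod>i\<in>I. f i (x i)) =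
      (LINT x|(Pi\<^sub>M I (\<lambda>_. \<mu>)). (\<Prod>i\<in>I. ?g i (x i)))"
    unfolding set_lebesgue_integral_def by (intro Bochner_Integration.integral_cong) auto
  also have "\<dots> = (\<Prod>i\<in>I. LINT x|\<mu>. ?g i x)"
    using lc_bounded_set_integrable[OF f, of _ "cball 0 1"] emeasure_int_ring
    by (intro product_integral_prod assms(1)) (auto simp: set_integrable_def)
  finally show ?thesis by (simp add: J_def set_lebesgue_integral_def)
qed

end


context gauss_field
begin

section \<open>The contribution of a shell to the local density\<close>

lemma ord_eq_Fin:
  assumes "x \<noteq> 0" and "vabs x = w powi k"
  shows "ord \<pi> x = Fin k"
  using assms by (simp add: ord_def w_powi_eq_iff)

lemma ord_cases:
  obtains (zero) "x = 0" "ord \<pi> x = Pinf"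
  | (Fin) k where "x \<noteq> 0" "vabs x = w powi k" "ord \<pi> x = Fin k"
proof (cases "x = 0")
  case True
  then show ?thesis using zero by (simp add: ord_def)
next
  case False
  then obtain k where "vabs x = w powi k" by (rule vabs_eq_powi)
  then show ?thesis using False Fin ord_eq_Fin by blast
qed

lemma ord_le_iff: "ord \<pi> x \<le> ord \<pi> y \<longleftrightarrow> vabs y \<le> vabs x"
proof (cases x rule: ord_cases)
  case zero
  note x = zero
  show ?thesis
  proof (cases y rule: ord_cases)
    case (Fin k)
    have "\<not> vabs y \<le> 0" using Fin(1) by (simp add: not_le)
    then show ?thesis using x Fin(3) by simp
  qed (use x in simp)
next
  case (Fin k)
  note x = Fin
  show ?thesis
  proof (cases y rule: ord_cases)
    case zero
    then show ?thesis by simp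
  next
    case (Fin j)
    then show ?thesis unfolding x(2,3) by (simp only: Fin less_eq_extended.simps w_powi_le_iff)
  qed
qed

lemma ord_Fin_imp: "ord \<pi> x = Fin k \<Longrightarrow> vabs x = w powi k"
  by (cases x rule: ord_cases) auto

text \<open>The indices in \<open>D\<close> give the cutoff, each index of \<open>N\<close> with
  \<open>t i < s\<close> a power of \<open>q\<close>, and those of odd exponent, which form
  \<open>L\<close>, also an \<open>eps ^ 3\<close> and a symbol. The symbol splits into a factor
  depending on \<open>\<sigma>\<close>, collected to the power \<open>card L\<close>, and the
  constant \<open>\<eta> (u i)\<close>. The characters left over from completing the squares are
  absorbed into the one of \<open>n\<close>.\<close>

lemma integrand_on_shell:
  fixes b c :: "nat \<Rightarrow> 'k" and t :: "nat \<Rightarrow> int"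
  assumes fin: "finite D" "finite N" and disj: "D \<inter> N = {}"
    and N: "\<And>i. i \<in> N \<Longrightarrow> vabs (b i) = w powi t i" "\<And>i. i \<in> N \<Longrightarrow> vabs (c i) \<le> vabs (b i)"
    and D: "\<And>i. i \<in> D \<Longrightarrow> vabs (c i) = w powi t i" "\<And>i. i \<in> D \<Longrightarrow> vabs (b i) < vabs (c i)"
    and u: "\<And>i. i \<in> N \<Longrightarrow> u i = \<pi> powi (- t i) * b i"
    and L: "L = {i \<in> N. t i - s < 0 \<and> odd (t i - s)}"
    and \<sigma>: "vabs \<sigma> = w powi (- s)"
  shows "\<psi> (- \<sigma> * n) * (\<Prod>i\<in>D \<union> N. J (\<lambda>x. \<psi> (\<sigma> * (b i * x\<^sup>2 + c i * x)))) =
    of_bool (\<forall>i\<in>D. s \<le> t i) * of_real (q powr (\<Sum>i | i \<in> N \<and> t i < s. of_int (t i - s) / 2)) *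
    (eps ^ (3 * card L) * (\<Prod>i\<in>L. \<eta> (u i))) *
    (\<eta> (\<sigma> * \<pi> powi s) ^ card L * \<psi> (- \<sigma> * (n + (\<Sum>i\<in>N. (c i)\<^sup>2 / (4 * b i)))))"
proof -
  define v where "v = \<sigma> * \<pi> powi s"
  have v: "vabs v = 1"
    using w_pos by (simp add: v_def vabs_mult vabs_powi \<sigma> flip: power_int_add)
  let ?P = "\<lambda>i. J (\<lambda>x. \<psi> (\<sigma> * (b i * x\<^sup>2 + c i * x)))"
  let ?A = "\<lambda>i. complex_of_real (q powr (of_int (t i - s) / 2))"
  let ?B = "\<lambda>i. \<eta> (v * u i) * eps ^ 3"
  have prod_D: "(\<Prod>i\<in>D. ?P i) = of_bool (\<forall>i\<in>D. s \<le> t i)"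
  proof -
    have "(\<Prod>i\<in>D. ?P i) = (\<Prod>i\<in>D. of_bool (s \<le> t i))"
      by (intro prod.cong refl J_char_dominant_linear D \<sigma>)
    also have "\<dots> = of_bool (\<forall>i\<in>D. s \<le> t i)"
      using fin(1) by (induction D rule: finite_induct) auto
    finally show ?thesis .
  qed
  have "(\<Prod>i\<in>N. ?P i) = (\<Prod>i\<in>N. \<psi> (- \<sigma> * ((c i)\<^sup>2 / (4 * b i))) *
      (if t i < s then ?A i * (if odd (t i - s) then ?B i else 1) else 1))"
  proof (intro prod.cong refl)
    fix i assume i: "i \<in> N"
    show "?P i = \<psi> (- \<sigma> * ((c i)\<^sup>2 / (4 * b i))) *
      (if t i < s then ?A i * (if odd (t i - s) then ?B i else 1) else 1)"
      unfolding v_def u[OF i] by (rule J_char_completed_square[OF N(1)[OF i] N(2)[OF i] \<sigma>])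
  qed
  also have "\<dots> = (\<Prod>i\<in>N. \<psi> (- \<sigma> * ((c i)\<^sup>2 / (4 * b i)))) *
      ((\<Prod>i\<in>N. if t i < s then ?A i else 1) * (\<Prod>i\<in>N. if t i - s < 0 \<and> odd (t i - s) then ?B i else 1))"
    unfolding prod.distrib[symmetric] by (intro prod.cong refl) auto
  also have "(\<Prod>i\<in>N. \<psi> (- \<sigma> * ((c i)\<^sup>2 / (4 * b i)))) = \<psi> (- \<sigma> * (\<Sum>i\<in>N. (c i)\<^sup>2 / (4 * b i)))"
    unfolding sum_distrib_left by (rule char_sum[symmetric])
  also have "(\<Prod>i\<in>N. if t i < s then ?A i else 1) =
      of_real (q powr (\<Sum>i | i \<in> N \<and> t i < s. of_int (t i - s) / 2))"
    using fin(2) q_gt_1 by (simp add: prod.inter_filter[symmetric] powr_sum)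
  also have "(\<Prod>i\<in>N. if t i - s < 0 \<and> odd (t i - s) then ?B i else 1) = (\<Prod>i\<in>L. ?B i)"
    unfolding L by (rule prod.inter_filter[OF fin(2), symmetric])
  also have "(\<Prod>i\<in>L. ?B i) = (\<Prod>i\<in>L. \<eta> v * eps ^ 3 * \<eta> (u i))"
  proof (intro prod.cong refl)
    fix i assume "i \<in> L"
    then have "i \<in> N" by (simp add: L)
    then have "vabs (u i) = 1"
      using w_pos by (simp add: u N(1) vabs_mult vabs_powi flip: power_int_add)
    then show "?B i = \<eta> v * eps ^ 3 * \<eta> (u i)"
      using v by (simp add: symbol_mult)
  qed
  also have "\<dots> = \<eta> v ^ card L * eps ^ (3 * card L) * (\<Prod>i\<in>L. \<eta> (u i))"
    by (simp add: prod.distrib power_mult_distrib power_mult)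
  finally have prod_N: "(\<Prod>i\<in>N. ?P i) = \<psi> (- \<sigma> * (\<Sum>i\<in>N. (c i)\<^sup>2 / (4 * b i))) *
      (of_real (q powr (\<Sum>i | i \<in> N \<and> t i < s. of_int (t i - s) / 2)) *
       (\<eta> v ^ card L * eps ^ (3 * card L) * (\<Prod>i\<in>L. \<eta> (u i))))" .
  show ?thesis
    unfolding prod.union_disjoint[OF fin disj] prod_D prod_N distrib_left[of "- \<sigma>"] char_add[of "- \<sigma> * n"] v_def
    by (simp only: mult_ac)
qed

lemma integral_shell_character:
  "(LINT \<sigma>:shell s|\<mu>. C * (\<eta> (\<sigma> * \<pi> powi s) ^ m * \<psi> (- \<sigma> * a))) =
    C * of_real (q powi s) * unit_integral m (- (\<pi> powi (- s) * a))"
  and lc_bounded_shell_character: "lc_bounded (\<lambda>\<sigma>. C * (\<eta> (\<sigma> * \<pi> powi s) ^ m * \<psi> (- \<sigma> * a)))"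
proof -
  have "lc_bounded (\<lambda>\<sigma>. C * (\<eta> (\<pi> powi s * \<sigma>) ^ m * \<psi> (- a * \<sigma>)))"
    by (intro lc_bounded_mult lc_bounded_const lc_bounded_power lc_bounded_scale[OF lc_bounded_symbol]
        lc_bounded_char_linear)
  then show lc: "lc_bounded (\<lambda>\<sigma>. C * (\<eta> (\<sigma> * \<pi> powi s) ^ m * \<psi> (- \<sigma> * a)))"
    by (simp add: mult.commute)
  have "of_bool (vabs v = 1) * (C * (\<eta> (\<pi> powi (- s) * v * \<pi> powi s) ^ m * \<psi> (- (\<pi> powi (- s) * v) * a))) =
      C * (of_bool (vabs v = 1) * (\<eta> v ^ m * \<psi> (- (\<pi> powi (- s) * a) * v)))" for v
    by (simp add: power_int_minus mult_ac)
  then show "(LINT \<sigma>:shell s|\<mu>. C * (\<eta> (\<sigma> * \<pi> powi s) ^ m * \<psi> (- \<sigma> * a))) =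
      C * of_real (q powi s) * unit_integral m (- (\<pi> powi (- s) * a))"
    unfolding integral_shell[OF lc] unit_integral_def by (simp only: J_cmult mult_ac)
qed

text \<open>With \<open>a\<close> in the role of \<open>nn\<close>, the argument has valuation
  \<open>tn - s\<close>; the branches are a trivial character, one that factors through the residue
  field, and the vanishing range. For \<open>a = 0\<close> the value \<open>Pinf\<close> of
  \<open>tn\<close> selects the first branch.\<close>

lemma unit_integral_eval:
  assumes "a = 0 \<and> tn = Pinf \<or> (\<exists>j. tn = Fin j \<and> u \<in> int_ring - max_ideal \<and> a = u * \<pi> powi j)"
  shows "unit_integral m (- (\<pi> powi (- s) * a)) =
    (if Fin s \<le> tn then if even m then 1 - 1 / q else 0
     else if tn = Fin (s - 1)
       then if even m then - (1 / q) else eps * \<eta> u * of_real (q powr (- 1 / 2))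
     else 0)"
  using assms
proof (elim disjE exE conjE)
  assume "a = 0" "tn = Pinf"
  then show ?thesis using unit_integral_trivial[of 0 m] by simp
next
  fix j assume tn: "tn = Fin j" and u: "u \<in> int_ring - max_ideal" and a: "a = u * \<pi> powi j"
  have u1: "vabs u = 1" using u by (auto simp: int_ring_iff max_ideal_iff)
  have va: "vabs (- (\<pi> powi (- s) * a)) = w powi (j - s)"
    using w_pos by (simp add: a vabs_mult vabs_powi u1 flip: power_int_add)
  consider "s \<le> j" | "s = j + 1" | "j + 1 < s" by linarith
  then show ?thesis
  proof cases
    case 1
    then have "vabs (- (\<pi> powi (- s) * a)) \<le> 1"
      unfolding va using w_powi_le_iff[of "j - s" 0] by simp
    then show ?thesis using 1 tn unit_integral_trivial by simp
  next
    case 2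
    have "\<pi> powi (- s) * \<pi> powi j = 1 / \<pi>"
      by (simp add: 2 power_int_minus divide_inverse flip: power_int_add)
    then have "- (\<pi> powi (- s) * a) = - u / \<pi>"
      by (simp add: a mult.left_commute)
    then show ?thesis using 2 tn unit_integral_conductor[OF u1, of m] by simp
  next
    case 3
    then have "1 / w < vabs (- (\<pi> powi (- s) * a))"
      unfolding va using w_powi_less_iff[of "- 1" "j - s"] by (simp add: power_int_minus divide_inverse)
    then show ?thesis using 3 tn unit_integral_vanish by simp
  qed
qed

end

section \<open>Finite extensions of the field of p-adic numbers\<close>

context
  fixes p :: nat and \<iota> :: "'q::{valued_field, complete_space} \<Rightarrow> 'k::valued_field"
  assumes p: "prime p" and ext: "padic_finite_extension p \<iota>"
begin

lemma padic_base: "padic_field p TYPE('q)"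
  and emb_add: "\<iota> (x + y) = \<iota> x + \<iota> y"
  and emb_mult: "\<iota> (x * y) = \<iota> x * \<iota> y"
  and emb_1: "\<iota> 1 = 1"
  and vabs_emb: "vabs (\<iota> x) = vabs x"
  using ext by (simp_all add: padic_finite_extension_def)

lemma emb_diff: "\<iota> (x - y) = \<iota> x - \<iota> y"
  using emb_add[of "x - y" y] by simp

lemma emb_of_nat: "\<iota> (of_nat n) = of_nat n"
proof (induction n)
  case 0
  then show ?case using emb_add[of 0 0] by simp
qed (simp add: emb_add emb_1)

lemma vabs_of_nat_ext: "vabs (of_nat n :: 'k) = vabs (of_nat n :: 'q)"
  using vabs_emb[of "of_nat n"] by (simp add: emb_of_nat)

lemma vector_space_ext: "vector_space (ext_scale \<iota>)"
  by unfold_locales (simp_all add: ext_scale_def emb_add emb_mult emb_1 algebra_simps)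

text \<open>All traces are computed in the one basis picked by the choice operator, so this is
  additivity of coordinates.\<close>

lemma field_trace_add: "field_trace \<iota> (\<alpha> + \<beta>) = field_trace \<iota> \<alpha> + field_trace \<iota> \<beta>"
proof -
  interpret vector_space "ext_scale \<iota>" by (rule vector_space_ext)
  define B where "B = (SOME B. ext_basis \<iota> B)"
  have "\<exists>B. ext_basis \<iota> B" using ext by (simp add: padic_finite_extension_def)
  then have "ext_basis \<iota> B" unfolding B_def by (rule someI_ex)
  then have "independent B" "span B = UNIV" by (auto simp: ext_basis_def)
  then have "representation B ((\<alpha> + \<beta>) * b) b = representation B (\<alpha> * b) b + representation B (\<beta> * b) b" for b
    using representation_add[of B "\<beta> * b" "\<alpha> * b"] by (simp add: distrib_right)
  then show ?thesis
    by (simp add: field_trace_def Let_def flip: B_def sum.distrib)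
qed

text \<open>The coordinates in a basis are approximated by rationals; the ultrametric inequality
  bounds the total error by the largest single one.\<close>

lemma separable_ext: "\<exists>C :: 'k set. countable C \<and> closure C = UNIV"
proof -
  interpret vector_space "ext_scale \<iota>" by (rule vector_space_ext)
  obtain B where B: "finite B" "span B = UNIV"
    using ext by (auto simp: padic_finite_extension_def ext_basis_def)
  define g where "g = (\<lambda>f :: 'k \<Rightarrow> rat. \<Sum>b\<in>B. \<iota> (of_rat (f b)) * b)"
  \<comment> \<open>Coefficient families are taken extensional on the finite set \<open>B\<close>,
    which keeps the set of combinations countable.\<close>
  define C where "C = g ` (B \<rightarrow>\<^sub>E UNIV)"
  have "countable C"
    unfolding C_def using B(1) by (intro countable_image countable_PiE) auto
  moreover have "x \<in> closure C" for x
    unfolding closure_approachable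
  proof (intro allI impI)
    fix e :: real assume e: "0 < e"
    have "x \<in> span B" using B by simp
    then obtain a where a: "x = (\<Sum>b\<in>B. \<iota> (a b) * b)"
      using span_finite[OF B(1)] by (auto simp: ext_scale_def)
    \<comment> \<open>\<open>X\<close> is a positive bound for the absolute values of all basis
      vectors; the 2 in \<open>h\<close> leaves room for a strict inequality.\<close>
    define X where "X = 1 + (\<Sum>b\<in>B. vabs b)"
    define h where "h = e / 2 / X"
    have pos: "0 < X" unfolding X_def by (intro add_pos_nonneg sum_nonneg) auto
    then have h: "0 < h" using e by (simp add: h_def)
    have "\<exists>f. vabs (of_rat f - a b) < h" for b
    proof -
      have "a b \<in> closure \<rat>" using padic_base by (simp add: padic_field_def)
      then obtain y where "y \<in> \<rat>" "dist y (a b) < h"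
        unfolding closure_approachable using h by blast
      then show ?thesis by (metis Rats_cases dist_eq_vabs)
    qed
    then obtain f where f: "\<And>b. vabs (of_rat (f b) - a b) < h" by metis
    have "g (restrict f B) - x = (\<Sum>b\<in>B. \<iota> (of_rat (f b) - a b) * b)"
      by (simp add: g_def a emb_diff left_diff_distrib flip: sum_subtractf)
    moreover have "vabs (\<Sum>b\<in>B. \<iota> (of_rat (f b) - a b) * b) \<le> e / 2"
    proof (rule vabs_sum_le)
      fix b assume b: "b \<in> B"
      have "vabs b \<le> (\<Sum>b\<in>B. vabs b)" using b B(1) by (intro member_le_sum) auto
      then have "vabs (of_rat (f b) - a b) * vabs b \<le> h * X"
        using f[of b] h by (intro mult_mono) (auto simp: X_def)
      then show "vabs (\<iota> (of_rat (f b) - a b) * b) \<le> e / 2"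
        using pos by (simp add: vabs_mult vabs_emb h_def)
    qed (use e in simp)
    ultimately have "dist (g (restrict f B)) x < e" using e by (simp add: dist_eq_vabs)
    moreover have "g (restrict f B) \<in> C" unfolding C_def by (intro imageI) auto
    ultimately show "\<exists>y\<in>C. dist y x < e" by blast
  qed
  ultimately show ?thesis by blast
qed

section \<open>The different and the conductor of the additive character\<close>

context
  fixes \<pi> :: 'k and d :: nat
  assumes unif: "uniformizer \<pi>" and diff: "different \<iota> = (\<lambda>x. \<pi> ^ d * x) ` int_ring"
begin

text \<open>The prime \<open>p\<close> is a nonzero element of the maximal ideal.\<close>

lemma uniformizer_nonzero: "\<pi> \<noteq> 0"
proof
  assume "\<pi> = 0"
  then have "max_ideal \<subseteq> {0::'k}" using unif by (auto simp: uniformizer_def)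
  moreover have "vabs (of_nat p :: 'k) < 1"
    using padic_vabs_prime[OF p padic_base] vabs_of_nat_ext[of p] prime_gt_1_nat[OF p] by simp
  ultimately show False
    using prime_gt_0_nat[OF p] by (auto simp: max_ideal_iff)
qed

lemma vabs_le_uniformizer: "vabs x < 1 \<Longrightarrow> vabs (x / \<pi>) \<le> 1"
proof -
  assume "vabs x < 1"
  then have "x \<in> (\<lambda>x. \<pi> * x) ` int_ring"
    using unif unfolding uniformizer_def by (metis max_ideal_iff)
  then show ?thesis using uniformizer_nonzero by (auto simp: int_ring_iff)
qed

lemma inverse_uniformizer_not_integral: "\<not> vabs (1 / \<pi>) \<le> 1"
  using uniformizer_vabs_less_1[OF unif] uniformizer_nonzero by (simp add: vabs_divide field_simps)

lemma codifferent_mult: "x \<in> codifferent \<iota> \<Longrightarrow> vabs z \<le> 1 \<Longrightarrow> x * z \<in> codifferent \<iota>"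
  by (auto simp: codifferent_def int_ring_iff vabs_mult mult_le_one mult.assoc)

text \<open>With each element the codifferent contains everything of at most the same absolute
  value. If \<open>1 / \<pi> ^ d\<close> were missing, all elements would be strictly smaller, so
  \<open>\<pi> ^ d / \<pi>\<close> would still multiply them into the ring of integers, and the
  different would exceed the ideal generated by \<open>\<pi> ^ d\<close>.\<close>

lemma inverse_different_in_codifferent: "1 / \<pi> ^ d \<in> codifferent \<iota>"
proof (rule ccontr)
  assume notin: "1 / \<pi> ^ d \<notin> codifferent \<iota>"
  have "vabs (\<pi> ^ d * x) < 1" if x: "x \<in> codifferent \<iota>" for x
  proof (rule ccontr)
    assume "\<not> vabs (\<pi> ^ d * x) < 1"
    moreover from this have "\<pi> ^ d * x \<noteq> 0" by (metis vabs_zero zero_less_one)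
    ultimately have "vabs (1 / (\<pi> ^ d * x)) \<le> 1" by (simp add: vabs_divide)
    then have "x * (1 / (\<pi> ^ d * x)) \<in> codifferent \<iota>"
      by (rule codifferent_mult[OF x])
    then show False using notin \<open>\<pi> ^ d * x \<noteq> 0\<close> by simp
  qed
  then have "vabs (\<pi> ^ d * x / \<pi>) \<le> 1" if "x \<in> codifferent \<iota>" for x
    using that by (intro vabs_le_uniformizer)
  then have "\<pi> ^ d / \<pi> \<in> different \<iota>"
    by (auto simp: different_def int_ring_iff)
  then obtain y where "\<pi> ^ d / \<pi> = \<pi> ^ d * y" "vabs y \<le> 1"
    unfolding diff by (metis imageE int_ring_iff)
  then have "1 / \<pi> = y" using uniformizer_nonzero by (simp add: field_simps)
  then show False using \<open>vabs y \<le> 1\<close> inverse_uniformizer_not_integral by simp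
qed

text \<open>The different contains \<open>\<pi> ^ d\<close> and multiplies the codifferent into the
  ring of integers.\<close>

lemma not_in_codifferent: "1 / \<pi> ^ d / \<pi> \<notin> codifferent \<iota>"
proof
  assume C: "1 / \<pi> ^ d / \<pi> \<in> codifferent \<iota>"
  have "\<pi> ^ d * 1 \<in> different \<iota>"
    unfolding diff by (rule imageI) (simp add: int_ring_iff)
  then have "\<pi> ^ d * 1 * (1 / \<pi> ^ d / \<pi>) \<in> int_ring"
    using C unfolding different_def by blast
  then show False
    using inverse_uniformizer_not_integral uniformizer_nonzero by (simp add: int_ring_iff)
qed

text \<open>Through the kernel of the character on the base field, the two statements about the
  codifferent become its triviality and nontriviality; oddness of \<open>p\<close> becomes
  \<open>vabs 2 = 1\<close>.\<close>

lemma gauss_field_ext: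
  assumes odd: "odd p" and haar: "normalized_haar \<mu>"
  shows "gauss_field \<pi> \<mu> (real (ideal_norm TYPE('k))) (add_char p \<iota> \<pi> d)"
proof
  show "uniformizer \<pi>" by (rule unif)
  show "\<pi> \<noteq> 0" by (rule uniformizer_nonzero)
  show "\<exists>C :: 'k set. countable C \<and> closure C = UNIV" by (rule separable_ext)
  show "normalized_haar \<mu>" by (rule haar)
  show "vabs (2::'k) = 1"
  proof -
    have "coprime (int p) 2" using odd by simp
    then have "vabs (of_int 2 :: 'q) = 1"
      by (rule padic_vabs_of_int_coprime[OF p padic_base])
    then show ?thesis using vabs_of_nat_ext[of 2] by simp
  qed
  show "add_char p \<iota> \<pi> d (x + y) = add_char p \<iota> \<pi> d x * add_char p \<iota> \<pi> d y" for x y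
    by (simp add: add_char_def add_divide_distrib field_trace_add padic_char_add[OF p padic_base])
  show "norm (add_char p \<iota> \<pi> d x) = 1" for x
    by (simp add: add_char_def norm_padic_char[OF p padic_base])
  show "add_char p \<iota> \<pi> d x = 1" if "vabs x \<le> 1" for x
  proof -
    have "field_trace \<iota> (1 / \<pi> ^ d * x) \<in> int_ring"
      using inverse_different_in_codifferent that by (auto simp: codifferent_def int_ring_iff)
    then show ?thesis by (simp add: add_char_def padic_char_eq_1_iff[OF p padic_base])
  qed
  show "\<exists>y. vabs y \<le> 1 \<and> add_char p \<iota> \<pi> d (y / \<pi>) \<noteq> 1"
  proof -
    obtain y where "vabs y \<le> 1" "field_trace \<iota> (1 / \<pi> ^ d / \<pi> * y) \<notin> int_ring"
      using not_in_codifferent by (auto simp: codifferent_def int_ring_iff)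
    then show ?thesis
      by (intro exI[of _ y]) (simp add: add_char_def padic_char_eq_1_iff[OF p padic_base] mult.commute)
  qed
qed simp

end

end


section \<open>The local density of a diagonal quadratic polynomial\<close>

context gauss_field
begin

lemma gs_eq_gauss_sum:
  assumes "\<psi> = add_char p \<iota> \<pi> d"
  shows "gs 1 = gauss_sum p \<iota> \<pi> d"
  unfolding gs_def gauss_sum_def R_def assms[symmetric]
  by (subst sum.reindex[OF inj_on_some_residue]) simp

lemma eps_eq_gauss_eps:
  assumes "\<psi> = add_char p \<iota> \<pi> d"
  shows "eps = gauss_eps p \<iota> \<pi> d"
  unfolding eps_def gauss_eps_def gs_eq_gauss_sum[OF assms, symmetric] q_def[symmetric] by (rule refl)

lemma density_integrand_eq:
  assumes "\<psi> = add_char p \<iota> \<pi> d" and Q: "Q = (\<lambda>x. \<Sum>i\<in>{1..r}. b i * (x i)\<^sup>2 + c i * x i)"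
  shows "density_integrand p \<iota> \<pi> d \<mu> r Q n \<sigma> =
    \<psi> (- \<sigma> * n) * (\<Prod>i\<in>{1..r}. J (\<lambda>x. \<psi> (\<sigma> * (b i * x\<^sup>2 + c i * x))))"
proof -
  let ?f = "\<lambda>i x. \<psi> (\<sigma> * (b i * x\<^sup>2 + c i * x))"
  have lc: "lc_bounded (?f i)" for i
    using lc_bounded_char_quadratic[of "\<sigma> * b i" "\<sigma> * c i" 0] by (simp add: algebra_simps)
  have "\<psi> (\<sigma> * (Q x - n)) = \<psi> (- \<sigma> * n) * (\<Prod>i\<in>{1..r}. ?f i (x i))" for x
  proof -
    have "\<sigma> * (Q x - n) = - \<sigma> * n + (\<Sum>i\<in>{1..r}. \<sigma> * (b i * (x i)\<^sup>2 + c i * x i))"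
      by (simp add: Q right_diff_distrib sum_distrib_left)
    then show ?thesis by (simp only: char_add[of "- \<sigma> * n"] char_sum)
  qed
  then show ?thesis
    unfolding density_integrand_def assms(1)[symmetric]
    by (simp only: set_integral_mult_right integral_PiE_prod[OF finite_atLeastAtMost lc])
qed

lemma density_partial_eq:
  "density_partial p \<iota> \<pi> d \<mu> r Q n k =
    (LINT \<sigma>:cball 0 (w powi (- int k))|\<mu>. density_integrand p \<iota> \<pi> d \<mu> r Q n \<sigma>)"
proof -
  have "{\<sigma>. \<pi> ^ k * \<sigma> \<in> int_ring} = cball 0 (w powi (- int k))"
    using w_pos
    by (auto simp: int_ring_iff mem_cball_vabs vabs_mult vabs_power power_int_minus field_simps
        simp del: mem_cball)
  then show ?thesis by (simp add: density_partial_def)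
qed

end

text \<open>The sum of the formula is encoded as the series of \<open>f\<close>, padded by zeros. It
  can diverge, for instance for one variable with \<open>nn = 0\<close> and \<open>D\<close> empty,
  where the exponents \<open>\<tau>\<close> grow; hence the equivalence of convergence. For
  \<open>tn = Pinf\<close> the default \<open>fin_part tn = 0\<close> does no harm, since then
  \<open>\<omega> = 0\<close>.\<close>

theorem theorem3p5:
  fixes p r d :: nat
    and \<iota> :: "'q::{valued_field, complete_space} \<Rightarrow> 'k::valued_field"
    and \<pi> n nn un :: 'k
    and \<mu> :: "'k measure"
    and b c u :: "nat \<Rightarrow> 'k"
    and Q :: "(nat \<Rightarrow> 'k) \<Rightarrow> 'k"
    and t :: "nat \<Rightarrow> int"
    and D N :: "nat set"
    and td tn :: "int extended"
    and L :: "int \<Rightarrow> nat set" and l :: "int \<Rightarrow> nat"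
    and \<tau> :: "int \<Rightarrow> real" and \<delta> :: "int \<Rightarrow> complex"
    and \<epsilon> \<omega> :: complex and Np :: real
    and f :: "nat \<Rightarrow> complex"
  assumes "prime p" and "odd p"
    and "padic_finite_extension p \<iota>"
    and "uniformizer \<pi>"
    and "different \<iota> = (\<lambda>x. \<pi> ^ d * x) ` int_ring"
    and "normalized_haar \<mu>"
    and "n \<in> int_ring"
    and "\<And>i. i \<in> {1..r} \<Longrightarrow> b i \<in> int_ring - {0}"
    and "\<And>i. i \<in> {1..r} \<Longrightarrow> c i \<in> int_ring"
    and "Q = (\<lambda>x. \<Sum>i\<in>{1..r}. b i * (x i)\<^sup>2 + c i * x i)"
    and "Np = real (ideal_norm TYPE('k))"
    and "\<epsilon> = gauss_eps p \<iota> \<pi> d"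
    and "\<And>i. i \<in> {1..r} \<Longrightarrow> Fin (t i) = min (ord \<pi> (b i)) (ord \<pi> (c i))"
    and "\<And>i. i \<in> {1..r} \<Longrightarrow> u i = \<pi> powi (- fin_part (ord \<pi> (b i))) * b i"
    and "D = {i \<in> {1..r}. ord \<pi> (b i) > ord \<pi> (c i)}"
    and "N = {i \<in> {1..r}. ord \<pi> (b i) \<le> ord \<pi> (c i)}"
    and "td = Min (insert Pinf ((\<lambda>i. Fin (t i)) ` D))"
    and "\<And>s. L s = {i \<in> N. t i - s < 0 \<and> odd (t i - s)}"
    and "\<And>s. l s = card (L s)"
    and "nn = n + (\<Sum>i\<in>N. (c i)\<^sup>2 / (4 * b i))"
    and "nn \<noteq> 0 \<Longrightarrow> \<exists>m. tn = Fin m \<and> un \<in> int_ring - max_ideal \<and> nn = un * \<pi> powi m"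
    and "nn = 0 \<Longrightarrow> tn = Pinf"
    and "\<And>s. \<tau> s = of_int s + (\<Sum>i | i \<in> N \<and> t i < s. of_int (t i - s) / 2)"
    and "\<And>s. \<delta> s = \<epsilon> ^ (3 * l s) * (\<Prod>i\<in>L s. residue_symbol (u i))"
    and "\<omega> = (if tn \<ge> td then 0
              else if even (l (fin_part tn + 1)) then - of_real (1 / Np)
              else \<epsilon> * residue_symbol un * of_real (Np powr (- 1 / 2)))"
    and "\<And>k. f k = (if 1 \<le> k \<and> Fin (int k) \<le> min td tn \<and> even (l (int k))
                    then \<delta> (int k) * of_real (Np powr \<tau> (int k)) else 0)"
  shows "(convergent (density_partial p \<iota> \<pi> d \<mu> r Q n) \<longleftrightarrow> summable f) \<and>
    (summable f \<longrightarrow>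
      local_density p \<iota> \<pi> d \<mu> r Q n =
        1 + of_real (1 - 1 / Np) * (\<Sum>k. f k)
          + \<omega> * \<delta> (fin_part tn + 1) * of_real (Np powr \<tau> (fin_part tn + 1)))"
proof -
  note asm = assms
  interpret gauss_field \<pi> \<mu> Np "add_char p \<iota> \<pi> d"
    unfolding asm(11) by (rule gauss_field_ext[OF asm(1,3,4,5,2,6)])
  define W where "W = \<omega> * \<delta> (fin_part tn + 1) * of_real (Np powr \<tau> (fin_part tn + 1))"
  have eps: "\<epsilon> = eps" unfolding asm(12) by (rule eps_eq_gauss_eps[symmetric, OF refl])
  have Np: "Np > 1" by (rule q_gt_1)

  \<comment> \<open>The hypotheses in terms of absolute values\<close>
  have D_N: "{1..r} = D \<union> N" "D \<inter> N = {}" "finite D" "finite N"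
    unfolding asm(15,16) by auto
  have N_ord: "ord \<pi> (b i) = Fin (t i)" if "i \<in> N" for i
    using asm(13)[of i] that unfolding asm(16) by (auto simp: min_def)
  have N_b: "vabs (b i) = w powi t i" if "i \<in> N" for i
    by (rule ord_Fin_imp[OF N_ord[OF that]])
  have N_c: "vabs (c i) \<le> vabs (b i)" if "i \<in> N" for i
    using that unfolding asm(16) ord_le_iff by simp
  have D_c: "vabs (c i) = w powi t i" if "i \<in> D" for i
    using asm(13)[of i] that unfolding asm(15) by (intro ord_Fin_imp) (auto simp: min_def)
  have D_b: "vabs (b i) < vabs (c i)" if "i \<in> D" for i
    using that unfolding asm(15) by (simp add: ord_le_iff flip: not_le)
  have u: "u i = \<pi> powi (- t i) * b i" if "i \<in> N" for i
  proof -
    have "i \<in> {1..r}" using that D_N(1) by blast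
    then show ?thesis using asm(14)[of i] N_ord[OF that] by simp
  qed
  have td: "Fin s \<le> td \<longleftrightarrow> (\<forall>i\<in>D. s \<le> t i)" for s
    unfolding asm(17) using D_N(3) by simp

  \<comment> \<open>This will make \<open>tn\<close> nonnegative, so that the shell
    \<open>tn + 1\<close> is among those of positive index.\<close>
  have nn: "vabs nn \<le> 1"
    unfolding asm(20)
  proof (intro vabs_add_le vabs_sum_le)
    show "vabs n \<le> 1" using asm(7) by (simp add: int_ring_iff)
    fix i assume i: "i \<in> N"
    then have "i \<in> {1..r}" using D_N(1) by blast
    then have bi: "vabs (b i) \<le> 1" "b i \<noteq> 0"
      using asm(8)[of i] by (auto simp: int_ring_iff)
    have "vabs (4::'k) = 1"
      using vabs_2 vabs_mult[of 2 "2::'k"] by simp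
    then have "vabs ((c i)\<^sup>2 / (4 * b i)) = vabs (c i) * (vabs (c i) / vabs (b i))"
      by (simp add: vabs_divide vabs_mult vabs_power power2_eq_square)
    also have "\<dots> \<le> 1"
      using N_c[OF i] bi by (intro mult_le_one) (auto simp: divide_le_eq)
    finally show "vabs ((c i)\<^sup>2 / (4 * b i)) \<le> 1" .
  qed simp

  \<comment> \<open>The integrand on the ring of integers and on the shells\<close>
  define F where "F = density_integrand p \<iota> \<pi> d \<mu> r Q n"
  define C where "C = (\<lambda>s. of_bool (Fin s \<le> td) *
      of_real (Np powr (\<Sum>i | i \<in> N \<and> t i < s. of_int (t i - s) / 2)) * \<delta> s)"
  have F_shell: "F \<sigma> = C s * (\<eta> (\<sigma> * \<pi> powi s) ^ l s * add_char p \<iota> \<pi> d (- \<sigma> * nn))"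
    if "\<sigma> \<in> shell s" for \<sigma> s
    unfolding F_def density_integrand_eq[OF refl asm(10)] D_N(1) C_def td asm(20) asm(24) asm(19) eps
    by (rule integrand_on_shell[OF D_N(3,4,2) N_b N_c D_c D_b u asm(18)])
      (use that in \<open>simp_all add: shell_def\<close>)
  \<comment> \<open>The source of the leading 1 in the formula.\<close>
  have F_int: "F \<sigma> = 1" if \<sigma>: "vabs \<sigma> \<le> 1" for \<sigma>
  proof -
    have "vabs (\<sigma> * n) \<le> 1"
      using asm(7) \<sigma> by (simp add: vabs_mult int_ring_iff mult_le_one)
    then have "add_char p \<iota> \<pi> d (- \<sigma> * n) = 1" by (intro char_integral) simp
    moreover have "J (\<lambda>x. add_char p \<iota> \<pi> d (\<sigma> * (b i * x\<^sup>2 + c i * x))) = 1" if "i \<in> {1..r}" for i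
    proof (rule J_char_trivial)
      fix x :: 'k assume "vabs x \<le> 1"
      then have "vabs (b i * x\<^sup>2 + c i * x) \<le> 1"
        using asm(8,9)[OF that]
        by (intro vabs_add_le) (auto simp: vabs_mult vabs_power int_ring_iff intro!: mult_le_one power_le_one)
      then show "vabs (\<sigma> * (b i * x\<^sup>2 + c i * x)) \<le> 1"
        using \<sigma> unfolding vabs_mult[of \<sigma>] by (intro mult_le_one) auto
    qed
    ultimately show ?thesis
      unfolding F_def density_integrand_eq[OF refl asm(10)] by simp
  qed

  \<comment> \<open>The two summands exclude each other: \<open>f k\<close> requires
    \<open>k \<le> tn\<close>, whereas \<open>W\<close> belongs to
    \<open>k = tn + 1\<close>.\<close>
  have shell_term: "(LINT \<sigma>:shell (int k)|\<mu>. F \<sigma>) =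
      of_real (1 - 1 / Np) * f k + (if tn = Fin (int k - 1) then W else 0)" if k: "1 \<le> k" for k
  proof -
    let ?s = "int k"
    have "(LINT \<sigma>:shell ?s|\<mu>. F \<sigma>) =
        (LINT \<sigma>:shell ?s|\<mu>. C ?s * (\<eta> (\<sigma> * \<pi> powi ?s) ^ l ?s * add_char p \<iota> \<pi> d (- \<sigma> * nn)))"
      using F_shell by (intro set_lebesgue_integral_cong shell_in_sets) auto
    also have "\<dots> = C ?s * of_real (Np powi ?s) * unit_integral (l ?s) (- (\<pi> powi (- ?s) * nn))"
      by (rule integral_shell_character)
    also have "C ?s * of_real (Np powi ?s) = of_bool (Fin ?s \<le> td) * (\<delta> ?s * of_real (Np powr \<tau> ?s))"
    proof -
      have "Np powr \<tau> ?s = Np powi ?s * Np powr (\<Sum>i | i \<in> N \<and> t i < ?s. of_int (t i - ?s) / 2)"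
        unfolding asm(23) powr_add using Np by (simp add: powr_realpow)
      then show ?thesis by (simp add: C_def mult_ac)
    qed
    finally have eq: "(LINT \<sigma>:shell ?s|\<mu>. F \<sigma>) = of_bool (Fin ?s \<le> td) *
        (\<delta> ?s * of_real (Np powr \<tau> ?s)) * unit_integral (l ?s) (- (\<pi> powi (- ?s) * nn))" .
    have "nn = 0 \<and> tn = Pinf \<or>
        (\<exists>j. tn = Fin j \<and> un \<in> int_ring - max_ideal \<and> nn = un * \<pi> powi j)"
      using asm(21,22) by blast
    note eval = unit_integral_eval[OF this, of "l ?s" ?s]
    consider "Fin ?s \<le> tn" | "tn = Fin (?s - 1)" | "\<not> Fin ?s \<le> tn" "tn \<noteq> Fin (?s - 1)" by blast
    then show ?thesis
    proof cases
      case 1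
      then have "tn \<noteq> Fin (?s - 1)" by auto
      then show ?thesis unfolding eq eval asm(26) using 1 k by (simp add: mult_ac)
    next
      case 2
      have less: "\<not> Fin ?s \<le> tn" using 2 by simp
      \<comment> \<open>Over the integers \<open>td \<le> s - 1\<close> is the negation of
        \<open>s \<le> td\<close>, so the cutoff in \<open>\<omega>\<close> and that of the shell
        integral are the same condition.\<close>
      have "td \<le> tn \<longleftrightarrow> \<not> Fin ?s \<le> td"
        unfolding 2 by (cases td) auto
      then have "W = of_bool (Fin ?s \<le> td) * (\<delta> ?s * of_real (Np powr \<tau> ?s)) *
          (if even (l ?s) then - (1 / Np) else eps * \<eta> un * of_real (Np powr (- 1 / 2)))"
        unfolding W_def asm(25) eps using 2 by simp
      then show ?thesis unfolding eq eval asm(26) using 2 less by simp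
    next
      case 3
      then show ?thesis unfolding eq eval asm(26) by simp
    qed
  qed

  \<comment> \<open>Partial integrals, partial sums and the limit\<close>
  have "density_partial p \<iota> \<pi> d \<mu> r Q n k = 1 + (\<Sum>j=1..k. LINT \<sigma>:shell (int j)|\<mu>. F \<sigma>)" for k
  proof -
    have "set_integrable \<mu> (cball 0 1) F"
    proof -
      have "set_integrable \<mu> (cball 0 1) (\<lambda>_. 1 :: complex)"
        by (rule lc_bounded_set_integrable[OF lc_bounded_const]) (simp_all add: emeasure_int_ring)
      then show ?thesis
        using F_int by (subst set_integrable_cong[where f' = "\<lambda>_. 1"])
          (auto simp: mem_cball_vabs simp del: mem_cball)
    qed
    moreover have "set_integrable \<mu> (shell s) F" for s
      by (subst set_integrable_cong[OF refl refl F_shell], assumption)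
        (intro lc_bounded_set_integrable lc_bounded_shell_character shell_in_sets emeasure_shell)
    moreover have "J F = 1"
      using J_cong[of F "\<lambda>_. 1"] F_int by (simp add: J_const)
    ultimately show ?thesis
      using integral_cball_shells[of F k] unfolding density_partial_eq F_def by simp
  qed
  also have "\<dots> k = 1 + of_real (1 - 1 / Np) * (\<Sum>j<Suc k. f j) +
      (\<Sum>j=1..k. if tn = Fin (int j - 1) then W else 0)" for k
  proof -
    \<comment> \<open>Shells are numbered from 1 and the series from 0; the extra term is
      zero.\<close>
    have "f 0 = 0" unfolding asm(26) by simp
    then have "(\<Sum>j=1..k. f j) = (\<Sum>j<Suc k. f j)"
      by (simp only: lessThan_Suc_atMost sum.atMost_shift) (simp add: sum.atLeast1_atMost_eq)
    then show ?thesis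
      by (simp add: shell_term sum.distrib flip: sum_distrib_left)
  qed
  finally have partial: "density_partial p \<iota> \<pi> d \<mu> r Q n k = 1 + of_real (1 - 1 / Np) * (\<Sum>j<Suc k. f j) +
      (\<Sum>j=1..k. if tn = Fin (int j - 1) then W else 0)" for k .

  have last: "eventually (\<lambda>k. (\<Sum>j=1..k. if tn = Fin (int j - 1) then W else 0) = W) sequentially"
  proof (cases "nn = 0")
    case True
    then have "tn = Pinf" by (rule asm(22))
    \<comment> \<open>\<open>tn = Pinf\<close> forces \<open>\<omega> = 0\<close>, so
      \<open>W\<close> is 0 as well.\<close>
    then show ?thesis by (simp add: W_def asm(25))
  next
    case False
    then obtain m where m: "tn = Fin m" "un \<in> int_ring - max_ideal" "nn = un * \<pi> powi m"
      using asm(21) by blast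
    have "w powi m \<le> w powi 0"
      using nn m by (auto simp: vabs_mult vabs_powi int_ring_iff max_ideal_iff)
    then have m0: "0 \<le> m" by (simp only: w_powi_le_iff)
    define j0 where "j0 = Suc (nat m)"
    have "tn = Fin (int j - 1) \<longleftrightarrow> j = j0" for j
      using m0 by (auto simp: m(1) j0_def)
    then have "(\<Sum>j=1..k. if tn = Fin (int j - 1) then W else 0) = W" if "j0 \<le> k" for k
      using that by (simp add: j0_def)
    then show ?thesis by (rule eventually_sequentiallyI)
  qed
  have partial_ev: "eventually (\<lambda>k. 1 + of_real (1 - 1 / Np) * (\<Sum>j<Suc k. f j) + W =
      density_partial p \<iota> \<pi> d \<mu> r Q n k) sequentially"
    using last by eventually_elim (simp add: partial)
  have limit: "density_partial p \<iota> \<pi> d \<mu> r Q n \<longlonglongrightarrow> 1 + of_real (1 - 1 / Np) * (\<Sum>k. f k) + W"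
    if "summable f"
  proof (rule Lim_transform_eventually[OF _ partial_ev])
    have "(\<lambda>k. \<Sum>j<Suc k. f j) \<longlonglongrightarrow> (\<Sum>k. f k)"
      by (rule LIMSEQ_Suc[OF summable_LIMSEQ[OF that]])
    then show "(\<lambda>k. 1 + of_real (1 - 1 / Np) * (\<Sum>j<Suc k. f j) + W)
        \<longlonglongrightarrow> 1 + of_real (1 - 1 / Np) * (\<Sum>k. f k) + W"
      by (intro tendsto_intros)
  qed
  have "summable f" if conv: "convergent (density_partial p \<iota> \<pi> d \<mu> r Q n)"
  proof -
    obtain A where "density_partial p \<iota> \<pi> d \<mu> r Q n \<longlonglongrightarrow> A"
      using conv by (auto simp: convergent_def)
    \<comment> \<open>Solving for the partial sum divides by the mass of the units, which is nonzero
      because \<open>Np > 1\<close>.\<close>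
    then have "(\<lambda>k. (density_partial p \<iota> \<pi> d \<mu> r Q n k - 1 - W) / of_real (1 - 1 / Np))
        \<longlonglongrightarrow> (A - 1 - W) / of_real (1 - 1 / Np)"
      using Np by (intro tendsto_intros) auto
    moreover have "eventually (\<lambda>k. (density_partial p \<iota> \<pi> d \<mu> r Q n k - 1 - W) / of_real (1 - 1 / Np) =
        (\<Sum>j<Suc k. f j)) sequentially"
      using partial_ev
    proof eventually_elim
      case (elim k)
      have "(1 + a * S + W - 1 - W) / a = S" if "a \<noteq> 0" for a S :: complex
        using that by simp
      moreover have "complex_of_real (1 - 1 / Np) \<noteq> 0" using Np by auto
      ultimately show ?case unfolding elim[symmetric] by blast
    qed
    ultimately have "(\<lambda>k. \<Sum>j<Suc k. f j) \<longlonglongrightarrow> (A - 1 - W) / of_real (1 - 1 / Np)"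
      by (rule Lim_transform_eventually)
    then have "(\<lambda>k. \<Sum>j<k. f j) \<longlonglongrightarrow> (A - 1 - W) / of_real (1 - 1 / Np)"
      by (rule LIMSEQ_imp_Suc)
    then show ?thesis by (auto simp: summable_def sums_def)
  qed
  then have "convergent (density_partial p \<iota> \<pi> d \<mu> r Q n) \<longleftrightarrow> summable f"
    using convergentI[OF limit] by (rule iffI)
  moreover have "summable f \<longrightarrow> local_density p \<iota> \<pi> d \<mu> r Q n = 1 + of_real (1 - 1 / Np) * (\<Sum>k. f k) + W"
    unfolding local_density_def by (intro impI limI limit)
  ultimately show ?thesis unfolding W_def by (rule conjI)
qed

end
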